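(* Let $Q$ be a smooth manifold and let $R_d\colon TQ\to Q\times Q$ be a discretization map on $Q$. Then $R_d^{T^*}=\Phi^{-1}\circ\widehat{R_d}\circ\alpha_Q\colon T(T^*Q)\to T^*Q\times T^*Q$ is a symplectomorphism between $(T(T^*Q),\mathrm{d}_T\omega_Q)$ and $(T^*Q\times T^*Q,\Omega_{12})$.
   Context: Discretization map: let $M$ be a smooth manifold and $U\subset TM$ an open neighborhood of the zero section. A smooth map $R_d\colon U\to M\times M$, $R_d(x,v)=(R^1(x,v),R^2(x,v))$, is a discretization map on $M$ if (1) $R_d(x,0)=(x,x)$ for all $x\in M$; and (2) for every $x\in M$, $T_{0_x}R^2_x-T_{0_x}R^1_x\colon T_{0_x}T_xM\simeq T_xM\to T_xM$ is the identity map of $T_xM$, where $R^a_x$ is the restriction of $R^a$ to (the part in $U$ of) $T_xM$, $a=1,2$. Every discretization map is a local diffeomorphism on some neighborhood of the zero section. Symplectic structures: $\omega_Q=-d\theta_Q$ is the canonical symplectic form of $T^*Q$ ($\theta_Q$ the Liouville 1-form), locally $\omega_Q=\mathrm{d}q\wedge\mathrm{d}p$. On $TT^*Q$, with coordinates $(q,p,\dot q,\dot p)$, $\mathrm{d}_T\omega_Q=\mathrm{d}q\wedge\mathrm{d}\dot p+\mathrm{d}\dot q\wedge\mathrm{d}p$. On $T^*Q\times T^*Q$, $\Omega_{12}=\mathrm{pr}_2^*\omega_Q-\mathrm{pr}_1^*\omega_Q$, where $\mathrm{pr}_i\colon T^*Q\times T^*Q\to T^*Q$ is the projection onto the $i$-th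 factor. Maps involved: - $\alpha_Q\colon TT^*Q\to T^*TQ$ is the canonical (Tulczyjew) diffeomorphism, locally $\alpha_Q(q,p,\dot q,\dot p)=(q,\dot q,\dot p,p)$ in coordinates $(q,v,p_q,p_v)$ of $T^*TQ$. - For a (local) diffeomorphism $F\colon M_1\to M_2$, $\widehat F\colon T^*M_1\to T^*M_2$ is $\widehat F(\alpha_x)=\alpha_x\circ(T_xF)^{-1}\in T^*_{F(x)}M_2$ for $\alpha_x\in T^*_xM_1$; thus $\widehat{R_d}\colon T^*TQ\to T^*(Q\times Q)$. - $\Phi\colon T^*Q\times T^*Q\to T^*(Q\times Q)$ is the diffeomorphism $\Phi(q_0,p_0;q_1,p_1)=(q_0,q_1,-p_0,p_1)$. Convention on domains: everything is understood near zero sections. If $U\subset TQ$ is an open neighborhood of the zero section on which $R_d$ is a local diffeomorphism, then $R_d^{T^*}$ is defined on the open set $\alpha_Q^{-1}(T^*U)$, and "symplectomorphism" means that there it is a local diffeomorphism (a diffeomorphism onto its image if $R_d|_U$ is) with $(R_d^{T^*})^*\Omega_{12}=\mathrm{d}_T\omega_Q$. *)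

theory Defs
  imports "HOL-Analysis.Analysis"
begin

section \<open>Smooth maps between open subsets of Euclidean spaces\<close>

text \<open>\<open>C_on k S f\<close>: the map \<open>f\<close> is of class \<open>C\<^sup>k\<close> on \<open>S\<close>. It is only used for open \<open>S\<close>.\<close>

primrec C_on ::
  "nat \<Rightarrow> 'e::euclidean_space set \<Rightarrow> ('e \<Rightarrow> 'f::euclidean_space) \<Rightarrow> bool" where
  "C_on 0 S f \<longleftrightarrow> continuous_on S f"
| "C_on (Suc k) S f \<longleftrightarrow> (\<forall>x\<in>S. f differentiable (at x)) \<and>
     (\<forall>v. C_on k S (\<lambda>x. frechet_derivative f (at x) v))"

definition smooth_on :: "'e::euclidean_space set \<Rightarrow> ('e \<Rightarrow> 'f::euclidean_space) \<Rightarrow> bool" where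
  "smooth_on S f \<longleftrightarrow> (\<forall>k. C_on k S f)"

section \<open>Smooth manifolds\<close>

text \<open>
  A chart is a pair (domain, coordinate map); the values of the coordinate map outside the
  domain are irrelevant. A manifold modelled on \<open>'e\<close> is given by a smooth atlas, which determines
  the underlying set and its topology. The atlas need not be maximal; every notion below
  depends only on the smooth structure it generates, up to the canonical identification of
  tangent vectors explained below.
\<close>

type_synonym ('a, 'e) chart = "'a set \<times> ('a \<Rightarrow> 'e)"
type_synonym ('a, 'e) atlas = "('a, 'e) chart set"

abbreviation (input) cdom :: "('a, 'e) chart \<Rightarrow> 'a set" where "cdom c \<equiv> fst c"
abbreviation (input) cmap :: "('a, 'e) chart \<Rightarrow> 'a \<Rightarrow> 'e" where "cmap c \<equiv> snd c"

definition cinv :: "('a, 'e) chart \<Rightarrow> 'e \<Rightarrow> 'a" where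
  "cinv c = inv_into (cdom c) (cmap c)"

definition transition :: "('a, 'e) chart \<Rightarrow> ('a, 'e) chart \<Rightarrow> 'e \<Rightarrow> 'e" where
  "transition c d y = cmap d (cinv c y)"

definition points :: "('a, 'e) atlas \<Rightarrow> 'a set" where
  "points M = (\<Union>c\<in>M. cdom c)"

definition charts_at :: "('a, 'e) atlas \<Rightarrow> 'a \<Rightarrow> ('a, 'e) chart set" where
  "charts_at M x = {c \<in> M. x \<in> cdom c}"

definition chart_at :: "('a, 'e) atlas \<Rightarrow> 'a \<Rightarrow> ('a, 'e) chart" where
  "chart_at M x = (SOME c. c \<in> charts_at M x)"

definition smooth_atlas :: "('a, 'e::euclidean_space) atlas \<Rightarrow> bool" where
  "smooth_atlas M \<longleftrightarrow>
     (\<forall>c\<in>M. inj_on (cmap c) (cdom c) \<and> open (cmap c ` cdom c)) \<and>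
     (\<forall>c\<in>M. \<forall>d\<in>M. open (cmap c ` (cdom c \<inter> cdom d)) \<and>
        smooth_on (cmap c ` (cdom c \<inter> cdom d)) (transition c d))"

definition mopen :: "('a, 'e::euclidean_space) atlas \<Rightarrow> 'a set \<Rightarrow> bool" where
  "mopen M W \<longleftrightarrow> W \<subseteq> points M \<and> (\<forall>c\<in>M. open (cmap c ` (W \<inter> cdom c)))"

definition smooth_manifold :: "('a, 'e::euclidean_space) atlas \<Rightarrow> bool" where
  "smooth_manifold M \<longleftrightarrow> smooth_atlas M \<and>
     Hausdorff_space (topology (mopen M)) \<and> second_countable (topology (mopen M))"

definition smooth_map ::
  "('a, 'e::euclidean_space) atlas \<Rightarrow> ('b, 'f::euclidean_space) atlas \<Rightarrow> 'a set \<Rightarrow> ('a \<Rightarrow> 'b) \<Rightarrow> bool"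
where
  "smooth_map M N W F \<longleftrightarrow>
     (\<forall>x\<in>W. \<exists>c\<in>charts_at M x. \<exists>d\<in>charts_at N (F x). \<exists>S.
        open S \<and> cmap c x \<in> S \<and> S \<subseteq> cmap c ` (W \<inter> cdom c) \<and>
        F ` cinv c ` S \<subseteq> cdom d \<and> smooth_on S (\<lambda>y. cmap d (F (cinv c y))))"

text \<open>\<open>F\<close> restricts to a diffeomorphism from the open set \<open>W\<close> onto an open subset of \<open>N\<close>.\<close>

definition diffeo_on ::
  "('a, 'e::euclidean_space) atlas \<Rightarrow> ('b, 'f::euclidean_space) atlas \<Rightarrow> 'a set \<Rightarrow> ('a \<Rightarrow> 'b) \<Rightarrow> bool"
where
  "diffeo_on M N W F \<longleftrightarrow> mopen M W \<and> smooth_map M N W F \<and> inj_on F W \<and>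
     mopen N (F ` W) \<and> smooth_map N M (F ` W) (inv_into W F)"

definition local_diffeo_on ::
  "('a, 'e::euclidean_space) atlas \<Rightarrow> ('b, 'f::euclidean_space) atlas \<Rightarrow> 'a set \<Rightarrow> ('a \<Rightarrow> 'b) \<Rightarrow> bool"
where
  "local_diffeo_on M N W F \<longleftrightarrow> (\<forall>x\<in>W. \<exists>V. x \<in> V \<and> V \<subseteq> W \<and> diffeo_on M N V F)"

definition prod_manifold :: "('a, 'e) atlas \<Rightarrow> ('b, 'f) atlas \<Rightarrow> ('a \<times> 'b, 'e \<times> 'f) atlas" where
  "prod_manifold M N =
     (\<lambda>(c, d). (cdom c \<times> cdom d, \<lambda>(x, y). (cmap c x, cmap d y))) ` (M \<times> N)"

section \<open>Tangent bundle and tangent maps\<close>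

text \<open>
  A tangent vector at \<open>x\<close> is the equivalence class of pairs (chart at \<open>x\<close>, vector of \<open>'e\<close>) under
  the Jacobians of the transition maps. Such a class contains one vector for every chart at \<open>x\<close>
  and is stored as the family of these vectors, extended by \<open>0\<close> to all other charts. The
  vector space operations are pointwise.
\<close>

type_synonym ('a, 'e) tvec = "('a, 'e) chart \<Rightarrow> 'e"
type_synonym ('a, 'e) tangent = "'a \<times> ('a, 'e) tvec"

definition tspace :: "('a, 'e::euclidean_space) atlas \<Rightarrow> 'a \<Rightarrow> ('a, 'e) tvec set" where
  "tspace M x = {v. (\<forall>c. c \<notin> charts_at M x \<longrightarrow> v c = 0) \<and>
     (\<forall>c\<in>charts_at M x. \<forall>d\<in>charts_at M x.
        v d = frechet_derivative (transition c d) (at (cmap c x)) (v c))}"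

text \<open>The tangent vector at \<open>x\<close> whose component in the chart \<open>c\<close> is \<open>w\<close>.\<close>

definition tvec_of ::
  "('a, 'e::euclidean_space) atlas \<Rightarrow> ('a, 'e) chart \<Rightarrow> 'a \<Rightarrow> 'e \<Rightarrow> ('a, 'e) tvec" where
  "tvec_of M c x w = (\<lambda>d. if d \<in> charts_at M x
     then frechet_derivative (transition c d) (at (cmap c x)) w else 0)"

definition tangent_chart ::
  "('a, 'e::euclidean_space) atlas \<Rightarrow> ('a, 'e) chart \<Rightarrow> (('a, 'e) tangent, 'e \<times> 'e) chart" where
  "tangent_chart M c =
     ({(x, v). x \<in> cdom c \<and> v \<in> tspace M x}, \<lambda>(x, v). (cmap c x, v c))"

definition tangent_bundle ::
  "('a, 'e::euclidean_space) atlas \<Rightarrow> (('a, 'e) tangent, 'e \<times> 'e) atlas" where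
  "tangent_bundle M = tangent_chart M ` M"

text \<open>The tangent map of \<open>F\<close> at \<open>x\<close>.\<close>

definition tmap ::
  "('a, 'e::euclidean_space) atlas \<Rightarrow> ('b, 'f::euclidean_space) atlas \<Rightarrow> ('a \<Rightarrow> 'b) \<Rightarrow> 'a \<Rightarrow>
     ('a, 'e) tvec \<Rightarrow> ('b, 'f) tvec" where
  "tmap M N F x v = (\<lambda>d. if d \<in> charts_at N (F x)
     then (let c = chart_at M x in
       frechet_derivative (\<lambda>y. cmap d (F (cinv c y))) (at (cmap c x)) (v c))
     else 0)"

section \<open>Cotangent bundle and cotangent lifts\<close>

text \<open>Covectors at \<open>x\<close> are the linear functionals on the tangent space, extended by \<open>0\<close>.\<close>

type_synonym ('a, 'e) covec = "('a, 'e) tvec \<Rightarrow> real"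
type_synonym ('a, 'e) cotangent = "'a \<times> ('a, 'e) covec"

definition cspace :: "('a, 'e::euclidean_space) atlas \<Rightarrow> 'a \<Rightarrow> ('a, 'e) covec set" where
  "cspace M x = {\<alpha>. (\<forall>v. v \<notin> tspace M x \<longrightarrow> \<alpha> v = 0) \<and>
     (\<forall>v\<in>tspace M x. \<forall>w\<in>tspace M x. \<forall>a b.
        \<alpha> (\<lambda>c. a *\<^sub>R v c + b *\<^sub>R w c) = a * \<alpha> v + b * \<alpha> w)}"

text \<open>
  The fibre coordinate \<open>p\<close> of \<open>\<alpha>\<close> is the vector of the numbers \<open>\<alpha> (\<partial>/\<partial>x\<^sub>b)\<close>, so that
  \<open>\<alpha> v = p \<bullet> v c\<close>.
\<close>

definition cotangent_chart ::
  "('a, 'e::euclidean_space) atlas \<Rightarrow> ('a, 'e) chart \<Rightarrow> (('a, 'e) cotangent, 'e \<times> 'e) chart" where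
  "cotangent_chart M c =
     ({(x, \<alpha>). x \<in> cdom c \<and> \<alpha> \<in> cspace M x},
      \<lambda>(x, \<alpha>). (cmap c x, \<Sum>b\<in>Basis. \<alpha> (tvec_of M c x b) *\<^sub>R b))"

definition cotangent_bundle ::
  "('a, 'e::euclidean_space) atlas \<Rightarrow> (('a, 'e) cotangent, 'e \<times> 'e) atlas" where
  "cotangent_bundle M = cotangent_chart M ` M"

definition cotangent_restrict ::
  "('a, 'e::euclidean_space) atlas \<Rightarrow> 'a set \<Rightarrow> ('a, 'e) cotangent set" where
  "cotangent_restrict M U = {\<zeta> \<in> points (cotangent_bundle M). fst \<zeta> \<in> U}"

definition cotangent_lift ::
  "('a, 'e::euclidean_space) atlas \<Rightarrow> ('b, 'f::euclidean_space) atlas \<Rightarrow> ('a \<Rightarrow> 'b) \<Rightarrow>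
     ('a, 'e) cotangent \<Rightarrow> ('b, 'f) cotangent" where
  "cotangent_lift M N F = (\<lambda>(x, \<alpha>). (F x, \<lambda>w. if w \<in> tspace N (F x)
     then \<alpha> (inv_into (tspace M x) (tmap M N F x) w) else 0))"

section \<open>Differential forms\<close>

type_synonym ('a, 'e) form1 = "'a \<Rightarrow> ('a, 'e) tvec \<Rightarrow> real"
type_synonym ('a, 'e) form2 = "'a \<Rightarrow> ('a, 'e) tvec \<Rightarrow> ('a, 'e) tvec \<Rightarrow> real"

text \<open>
  The exterior derivative \<open>d\<eta>(X,Y) = X(\<eta>(Y)) - Y(\<eta>(X)) - \<eta>([X,Y])\<close>, computed with the vector
  fields that have constant components in a chart. In particular
  \<open>(df \<and> dg)(u,w) = df(u) dg(w) - df(w) dg(u)\<close>.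
\<close>

definition ext_deriv ::
  "('a, 'e::euclidean_space) atlas \<Rightarrow> ('a, 'e) form1 \<Rightarrow> ('a, 'e) form2" where
  "ext_deriv M \<eta> x u w = (let c = chart_at M x in
     frechet_derivative (\<lambda>y. \<eta> (cinv c y) (tvec_of M c (cinv c y) (w c))) (at (cmap c x)) (u c) -
     frechet_derivative (\<lambda>y. \<eta> (cinv c y) (tvec_of M c (cinv c y) (u c))) (at (cmap c x)) (w c))"

definition pullback2 ::
  "('a, 'e::euclidean_space) atlas \<Rightarrow> ('b, 'f::euclidean_space) atlas \<Rightarrow> ('a \<Rightarrow> 'b) \<Rightarrow>
     ('b, 'f) form2 \<Rightarrow> ('a, 'e) form2" where
  "pullback2 M N F \<omega> x u w = \<omega> (F x) (tmap M N F x u) (tmap M N F x w)"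

definition liouville :: "('a, 'e::euclidean_space) atlas \<Rightarrow> (('a, 'e) cotangent, 'e \<times> 'e) form1" where
  "liouville Q z u = snd z (tmap (cotangent_bundle Q) Q fst z u)"

definition canonical_form ::
  "('a, 'e::euclidean_space) atlas \<Rightarrow> (('a, 'e) cotangent, 'e \<times> 'e) form2" where
  "canonical_form Q z u w = - ext_deriv (cotangent_bundle Q) (liouville Q) z u w"

definition Omega12 ::
  "('a, 'e::euclidean_space) atlas \<Rightarrow>
     (('a, 'e) cotangent \<times> ('a, 'e) cotangent, ('e \<times> 'e) \<times> ('e \<times> 'e)) form2" where
  "Omega12 Q z u w = (let T = cotangent_bundle Q in
     pullback2 (prod_manifold T T) T snd (canonical_form Q) z u w -
     pullback2 (prod_manifold T T) T fst (canonical_form Q) z u w)"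

text \<open>
  A chart \<open>c\<close> of \<open>Q\<close> induces the chart of \<open>TT\<^sup>*Q\<close> with coordinates \<open>((q, p), (q', p'))\<close>. The
  two-form \<open>dq \<and> dp' + dq' \<and> dp\<close> does not depend on \<open>c\<close>; the definition asks for the value that is
  given by this formula in all charts at the base point.
\<close>

definition TTs_chart ::
  "('a, 'e::euclidean_space) atlas \<Rightarrow> ('a, 'e) chart \<Rightarrow>
     ((('a, 'e) cotangent, 'e \<times> 'e) tangent, ('e \<times> 'e) \<times> ('e \<times> 'e)) chart" where
  "TTs_chart Q c = tangent_chart (cotangent_bundle Q) (cotangent_chart Q c)"

definition dT_canonical_form ::
  "('a, 'e::euclidean_space) atlas \<Rightarrow>
     ((('a, 'e) cotangent, 'e \<times> 'e) tangent, ('e \<times> 'e) \<times> ('e \<times> 'e)) form2" where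
  "dT_canonical_form Q \<xi> u w = (THE r. \<forall>c\<in>charts_at Q (fst (fst \<xi>)).
     (case (u (TTs_chart Q c), w (TTs_chart Q c)) of
       (((q1, p1), (q1', p1')), ((q2, p2), (q2', p2'))) \<Rightarrow>
         r = (q1 \<bullet> p2' - q2 \<bullet> p1') + (q1' \<bullet> p2 - q2' \<bullet> p1)))"

section \<open>The canonical maps\<close>

text \<open>
  \<open>\<alpha>\<^sub>Q : TT\<^sup>*Q \<rightarrow> T\<^sup>*TQ\<close> is the map that reads \<open>((q, p), (q', p')) \<mapsto> ((q, q'), (p', p))\<close> in the
  coordinates induced by every chart of \<open>Q\<close>.
\<close>

definition tulczyjew ::
  "('a, 'e::euclidean_space) atlas \<Rightarrow> (('a, 'e) cotangent, 'e \<times> 'e) tangent \<Rightarrow>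
     (('a, 'e) tangent, 'e \<times> 'e) cotangent" where
  "tulczyjew Q \<xi> = (THE \<zeta>. \<forall>c\<in>charts_at Q (fst (fst \<xi>)).
     let d = cotangent_chart (tangent_bundle Q) (tangent_chart Q c) in
       \<zeta> \<in> cdom d \<and>
       (case cmap (TTs_chart Q c) \<xi> of ((q, p), (q', p')) \<Rightarrow> cmap d \<zeta> = ((q, q'), (p', p))))"

text \<open>
  \<open>\<Phi>(q\<^sub>0,p\<^sub>0;q\<^sub>1,p\<^sub>1) = (q\<^sub>0,q\<^sub>1,-p\<^sub>0,p\<^sub>1)\<close>, where the pair of covectors \<open>(-p\<^sub>0, p\<^sub>1)\<close> acts on a tangent
  vector of \<open>Q \<times> Q\<close> through its two projections.
\<close>

definition Phi ::
  "('a, 'e::euclidean_space) atlas \<Rightarrow> ('a, 'e) cotangent \<times> ('a, 'e) cotangent \<Rightarrow>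
     ('a \<times> 'a, 'e \<times> 'e) cotangent" where
  "Phi Q = (\<lambda>((x, a), (y, b)). ((x, y), \<lambda>w.
     if w \<in> tspace (prod_manifold Q Q) (x, y)
     then - a (tmap (prod_manifold Q Q) Q fst (x, y) w) + b (tmap (prod_manifold Q Q) Q snd (x, y) w)
     else 0))"

section \<open>Discretization maps\<close>

text \<open>
  The tangent space at \<open>x\<close> as a manifold, with the linear charts \<open>v \<mapsto> v c\<close>, and the
  canonical identification of a vector \<open>v\<close> with a tangent vector to this manifold at \<open>0\<close>.
\<close>

definition tspace_manifold :: "('a, 'e::euclidean_space) atlas \<Rightarrow> 'a \<Rightarrow> (('a, 'e) tvec, 'e) atlas" where
  "tspace_manifold M x = (\<lambda>c. (tspace M x, \<lambda>v. v c)) ` charts_at M x"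

definition tspace_ident ::
  "('a, 'e::euclidean_space) atlas \<Rightarrow> 'a \<Rightarrow> ('a, 'e) tvec \<Rightarrow> (('a, 'e) tvec, 'e) tvec" where
  "tspace_ident M x v = (\<lambda>k. if k \<in> tspace_manifold M x then cmap k v else 0)"

definition zero_section_nhd :: "('a, 'e::euclidean_space) atlas \<Rightarrow> ('a, 'e) tangent set \<Rightarrow> bool" where
  "zero_section_nhd M U \<longleftrightarrow> mopen (tangent_bundle M) U \<and> (\<forall>x\<in>points M. (x, \<lambda>_. 0) \<in> U)"

definition discretization_map ::
  "('a, 'e::euclidean_space) atlas \<Rightarrow> ('a, 'e) tangent set \<Rightarrow> (('a, 'e) tangent \<Rightarrow> 'a \<times> 'a) \<Rightarrow> bool"
where
  "discretization_map M U R \<longleftrightarrow>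
     zero_section_nhd M U \<and>
     smooth_map (tangent_bundle M) (prod_manifold M M) U R \<and>
     (\<forall>x\<in>points M. R (x, \<lambda>_. 0) = (x, x)) \<and>
     (\<forall>x\<in>points M. \<forall>v\<in>tspace M x. \<forall>c.
        tmap (tspace_manifold M x) M (\<lambda>u. snd (R (x, u))) (\<lambda>_. 0) (tspace_ident M x v) c -
        tmap (tspace_manifold M x) M (\<lambda>u. fst (R (x, u))) (\<lambda>_. 0) (tspace_ident M x v) c = v c)"

text \<open>The cotangent lift \<open>R\<^sub>d\<^bsup>T*\<^esup>\<close> of \<open>R\<^sub>d\<close>, and its domain \<open>\<alpha>\<^sub>Q\<^sup>-\<^sup>1(T\<^sup>*U)\<close>.\<close>

definition lifted_map ::
  "('a, 'e::euclidean_space) atlas \<Rightarrow> (('a, 'e) tangent \<Rightarrow> 'a \<times> 'a) \<Rightarrow>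
     (('a, 'e) cotangent, 'e \<times> 'e) tangent \<Rightarrow> ('a, 'e) cotangent \<times> ('a, 'e) cotangent" where
  "lifted_map Q R =
     inv_into (points (prod_manifold (cotangent_bundle Q) (cotangent_bundle Q))) (Phi Q)
     \<circ> cotangent_lift (tangent_bundle Q) (prod_manifold Q Q) R
     \<circ> tulczyjew Q"

definition lifted_domain ::
  "('a, 'e::euclidean_space) atlas \<Rightarrow> ('a, 'e) tangent set \<Rightarrow>
     (('a, 'e) cotangent, 'e \<times> 'e) tangent set" where
  "lifted_domain Q U = {\<xi> \<in> points (tangent_bundle (cotangent_bundle Q)).
     tulczyjew Q \<xi> \<in> cotangent_restrict (tangent_bundle Q) U}"

text \<open>Local symplectomorphisms \<open>F : (W, \<sigma>) \<rightarrow> (N, \<tau>)\<close> defined on an open subset \<open>W\<close> of \<open>M\<close>.\<close>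

definition local_symplecto_on ::
  "('a, 'e::euclidean_space) atlas \<Rightarrow> ('a, 'e) form2 \<Rightarrow> ('b, 'f::euclidean_space) atlas \<Rightarrow>
     ('b, 'f) form2 \<Rightarrow> 'a set \<Rightarrow> ('a \<Rightarrow> 'b) \<Rightarrow> bool" where
  "local_symplecto_on M \<sigma> N \<tau> W F \<longleftrightarrow>
     mopen M W \<and> local_diffeo_on M N W F \<and>
     (\<forall>x\<in>W. \<forall>u\<in>tspace M x. \<forall>w\<in>tspace M x. pullback2 M N F \<tau> x u w = \<sigma> x u w)"

end

(*
  The lifted map is a composition of three maps, each of which is a diffeomorphism compatible with
  the forms. In the coordinates induced by charts of Q, the Tulczyjew map and Phi are the constant
  linear maps ((q,p),(q',p')) |-> ((q,q'),(p',p)) and ((x,a),(y,b)) |-> ((x,y),(-a,b)), and these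
  pull back dq ^ dp on T*TQ and T*(Q x Q) to d_T omega_Q and Omega_12. A cotangent lift preserves
  the canonical form dx ^ dp: in coordinates the covector pi at F(x) satisfies
  pi . DF(x)h = p . h, and after differentiation the terms with the second derivative of F cancel
  by symmetry. The same symmetry makes the Tulczyjew map independent of the chart.
  A discretization map is a local diffeomorphism near the zero section by the inverse function
  theorem: at (x,0) its derivative is (h,e) |-> (h + A e, h + B e) with B - A = id.
*)
theory Submission
  imports Defs
begin

section \<open>Smooth maps between Euclidean spaces\<close>

text \<open>The value of \<open>cotangent_lift\<close> at a covector depends only on
  \<open>R\<close> and its tangent map at the foot of that covector. Hence one formula
  \<open>lifted_map Q R\<close> serves for every open set, and each claim at a point of
  \<open>lifted_domain Q U\<close> can be settled over a smaller set \<open>V\<close> on which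
  \<open>R\<close> is a diffeomorphism. The obstacle is that the notions rest on choices:
  \<open>tmap\<close> and \<open>ext_deriv\<close> use \<open>chart_at\<close>, the Tulczyjew map
  and \<open>dT_canonical_form\<close> are definite descriptions over all charts, lifts use
  \<open>inv_into\<close>. Each choice is removed once, by a lemma giving the value in an arbitrary
  chart. Chart changes of the bundles are then \<open>tangent_lift\<close> and
  \<open>covector_lift\<close> of chart changes below, and every claim becomes a statement about
  open sets of Euclidean space. Smoothness of local inverses is circular at first sight: the
  derivative of the inverse is a pointwise inverse of linear maps, and differentiating such a family
  must not presuppose that it is differentiable. Writing the increment as a product whose first
  factor vanishes at the point breaks the circle.\<close>

abbreviation (input) fderiv :: "('e::euclidean_space \<Rightarrow> 'f::euclidean_space) \<Rightarrow> 'e \<Rightarrow> 'e \<Rightarrow> 'f" where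
  "fderiv f x \<equiv> frechet_derivative f (at x)"

lemma C_on_cong:
  assumes "open S" "C_on k S f" "\<And>x. x \<in> S \<Longrightarrow> f x = g x"
  shows "C_on k S g"
  using assms(2,3)
proof (induction k arbitrary: f g)
  case 0
  then show ?case by (simp cong: continuous_on_cong)
next
  case (Suc k)
  have g: "(g has_derivative fderiv f x) (at x)" if "x \<in> S" for x
  proof (rule has_derivative_transform_within_open[OF _ \<open>open S\<close> that Suc.prems(2)])
    show "(f has_derivative fderiv f x) (at x)"
      using Suc.prems(1) that by (auto simp: frechet_derivative_works[symmetric])
  qed
  have e: "fderiv f x = fderiv g x" if "x \<in> S" for x
    by (rule frechet_derivative_at[OF g[OF that]])
  have "C_on k S (\<lambda>x. fderiv g x v)" for v
  proof (rule Suc.IH)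
    show "C_on k S (\<lambda>x. fderiv f x v)" using Suc.prems(1) by simp
  qed (simp add: e)
  moreover have "g differentiable (at x)" if "x \<in> S" for x
    using g[OF that] differentiable_def by blast
  ultimately show ?case by simp
qed

text \<open>\<open>C_on\<close> refers to the operator \<open>frechet_derivative\<close>, while a
  calculation produces some \<open>f'\<close>. Uniqueness of the derivative identifies the two on
  \<open>S\<close>.\<close>

lemma C_on_SucI:
  assumes "open S" "\<And>x. x \<in> S \<Longrightarrow> (f has_derivative f' x) (at x)"
    and "\<And>v. C_on k S (\<lambda>x. f' x v)"
  shows "C_on (Suc k) S f"
proof -
  have "fderiv f x = f' x" if "x \<in> S" for x
    using frechet_derivative_at assms(2)[OF that] by metis
  then have "C_on k S (\<lambda>x. fderiv f x v)" for v
    by (intro C_on_cong[OF assms(1,3)]) simp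
  moreover have "f differentiable (at x)" if "x \<in> S" for x
    using assms(2)[OF that] differentiable_def by blast
  ultimately show ?thesis by simp
qed

lemma C_on_has_derivative:
  "C_on (Suc k) S f \<Longrightarrow> x \<in> S \<Longrightarrow> (f has_derivative fderiv f x) (at x)"
  by (simp add: frechet_derivative_works)

lemma C_on_continuous: "C_on k S f \<Longrightarrow> continuous_on S f"
  by (cases k) (auto intro!: continuous_at_imp_continuous_on differentiable_imp_continuous_within)

lemma C_on_lower: "C_on (Suc k) S f \<Longrightarrow> C_on k S f"
proof (induction k arbitrary: f)
  case 0
  then show ?case using C_on_continuous[of "Suc 0" S f] by (simp only: C_on.simps(1))
next
  case (Suc k)
  then show ?case by (subst C_on.simps(2)) (metis C_on.simps(2))
qed

lemma C_on_subset: "C_on k S f \<Longrightarrow> T \<subseteq> S \<Longrightarrow> C_on k T f"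
  by (induction k arbitrary: f) (auto intro: continuous_on_subset)

lemma C_on_const: "C_on k S (\<lambda>x. c)"
  by (induction k arbitrary: c) auto

lemma C_on_add:
  assumes "open S" "C_on k S f" "C_on k S g"
  shows "C_on k S (\<lambda>x. f x + g x)"
  using assms(2,3)
proof (induction k arbitrary: f g)
  case 0
  then show ?case by (auto intro: continuous_intros)
next
  case (Suc k)
  show ?case
    by (rule C_on_SucI[OF assms(1) has_derivative_add[OF C_on_has_derivative C_on_has_derivative]])
      (use Suc in auto)
qed

lemma C_on_linear:
  assumes "open S" "bounded_linear L" "C_on k S f"
  shows "C_on k S (\<lambda>x. L (f x))"
  using assms(3)
proof (induction k arbitrary: f)
  case 0
  then show ?case using assms(2) by (auto intro: continuous_intros bounded_linear.continuous_on)
next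
  case (Suc k)
  show ?case
    by (rule C_on_SucI[OF assms(1) bounded_linear.has_derivative[OF assms(2) C_on_has_derivative]])
      (use Suc in auto)
qed

text \<open>The product rule leaves an undifferentiated factor beside each differentiated one;
  \<open>C_on_lower\<close> brings both to the same order for the induction.\<close>

lemma C_on_bilinear:
  assumes "open S" "bounded_bilinear b" "C_on k S f" "C_on k S g"
  shows "C_on k S (\<lambda>x. b (f x) (g x))"
  using assms(3,4)
proof (induction k arbitrary: f g)
  case 0
  then show ?case using assms(2) by (auto intro: bounded_bilinear.continuous_on)
next
  case (Suc k)
  show ?case
    by (rule C_on_SucI[OF assms(1) bounded_bilinear.FDERIV[OF assms(2) C_on_has_derivative C_on_has_derivative]])
      (use Suc.prems C_on_lower[OF Suc.prems(1)] C_on_lower[OF Suc.prems(2)] in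
        \<open>auto intro!: C_on_add[OF assms(1)] Suc.IH\<close>)
qed

lemma C_on_sum:
  assumes "open S" "\<And>i. i \<in> I \<Longrightarrow> C_on k S (f i)"
  shows "C_on k S (\<lambda>x. \<Sum>i\<in>I. f i x)"
  using assms(2)
  by (induction I rule: infinite_finite_induct) (auto intro: C_on_const C_on_add[OF assms(1)])

lemma linear_sum_Basis:
  assumes "linear L"
  shows "L x = (\<Sum>b\<in>Basis. (x \<bullet> b) *\<^sub>R L b)"
proof -
  have "L x = L (\<Sum>b\<in>Basis. (x \<bullet> b) *\<^sub>R b)"
    by (simp add: euclidean_representation)
  then show ?thesis by (simp add: linear_sum[OF assms] linear_cmul[OF assms])
qed

lemma linear_fderiv: "f differentiable (at x) \<Longrightarrow> linear (fderiv f x)"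
  using frechet_derivative_works has_derivative_linear by blast

lemma C_on_ident: "C_on k S (\<lambda>x. x)"
  by (cases k) (auto simp: frechet_derivative_ident C_on_const)

text \<open>In the chain rule the direction \<open>fderiv f x v\<close> moves with \<open>x\<close>,
  but \<open>C_on\<close> controls derivatives in fixed directions only. Expanding the direction in
  \<open>Basis\<close> gives a sum of products to which the induction hypothesis applies.\<close>

lemma C_on_compose:
  assumes "open S" "open T"
  shows "C_on k T g \<Longrightarrow> C_on k S f \<Longrightarrow> f ` S \<subseteq> T \<Longrightarrow> C_on k S (\<lambda>x. g (f x))"
proof (induction k arbitrary: f g)
  case 0
  then show ?case by (auto intro: continuous_on_compose2)
next
  case (Suc k)
  have d: "((\<lambda>x. g (f x)) has_derivative (\<lambda>v. fderiv g (f x) (fderiv f x v))) (at x)" if "x \<in> S" for x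
    using Suc.prems that C_on_has_derivative
    by (metis has_derivative_compose image_subset_iff)
  have e: "fderiv g (f x) w = (\<Sum>b\<in>Basis. (w \<bullet> b) *\<^sub>R fderiv g (f x) b)" if "x \<in> S" for x w
    by (rule linear_sum_Basis[OF linear_fderiv]) (use Suc.prems that in auto)
  show ?case
  proof (rule C_on_SucI[OF assms(1) d])
    fix v
    have "C_on k S (\<lambda>x. \<Sum>b\<in>Basis. (fderiv f x v \<bullet> b) *\<^sub>R fderiv g (f x) b)"
      using Suc.prems C_on_lower[OF Suc.prems(2)]
      by (intro C_on_sum C_on_bilinear[OF assms(1) bounded_bilinear_scaleR]
          C_on_bilinear[OF assms(1) bounded_bilinear_inner] C_on_const assms Suc.IH) auto
    then show "C_on k S (\<lambda>x. fderiv g (f x) (fderiv f x v))"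
      by (rule C_on_cong[OF assms(1)]) (metis e)
  qed
qed

lemma smooth_on_const: "smooth_on S (\<lambda>x. c)"
  by (simp add: smooth_on_def C_on_const)

lemma smooth_on_ident: "smooth_on S (\<lambda>x. x)"
  by (simp add: smooth_on_def C_on_ident)

lemma smooth_on_subset: "smooth_on S f \<Longrightarrow> T \<subseteq> S \<Longrightarrow> smooth_on T f"
  by (auto simp: smooth_on_def intro: C_on_subset)

lemma smooth_on_cong:
  "open S \<Longrightarrow> smooth_on S f \<Longrightarrow> (\<And>x. x \<in> S \<Longrightarrow> f x = g x) \<Longrightarrow> smooth_on S g"
  unfolding smooth_on_def using C_on_cong by blast

lemma smooth_on_compose:
  "smooth_on T g \<Longrightarrow> smooth_on S f \<Longrightarrow> open S \<Longrightarrow> open T \<Longrightarrow> f ` S \<subseteq> T \<Longrightarrow>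
    smooth_on S (\<lambda>x. g (f x))"
  unfolding smooth_on_def using C_on_compose by blast

lemma smooth_on_linear:
  "bounded_linear L \<Longrightarrow> smooth_on S f \<Longrightarrow> open S \<Longrightarrow> smooth_on S (\<lambda>x. L (f x))"
  unfolding smooth_on_def using C_on_linear by blast

lemma smooth_on_sum:
  "open S \<Longrightarrow> (\<And>i. i \<in> I \<Longrightarrow> smooth_on S (f i)) \<Longrightarrow> smooth_on S (\<lambda>x. \<Sum>i\<in>I. f i x)"
  unfolding smooth_on_def by (intro allI C_on_sum) auto

lemma smooth_on_add:
  "open S \<Longrightarrow> smooth_on S f \<Longrightarrow> smooth_on S g \<Longrightarrow> smooth_on S (\<lambda>x. f x + g x)"
  unfolding smooth_on_def using C_on_add by blast

lemma smooth_on_bilinear: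
  "bounded_bilinear b \<Longrightarrow> open S \<Longrightarrow> smooth_on S f \<Longrightarrow> smooth_on S g \<Longrightarrow> smooth_on S (\<lambda>x. b (f x) (g x))"
  unfolding smooth_on_def using C_on_bilinear by blast

lemmas smooth_on_scaleR = smooth_on_bilinear[OF bounded_bilinear_scaleR]
lemmas smooth_on_inner = smooth_on_bilinear[OF bounded_bilinear_inner]

lemma smooth_on_fst: "smooth_on S f \<Longrightarrow> open S \<Longrightarrow> smooth_on S (\<lambda>x. fst (f x))"
  by (rule smooth_on_linear[OF bounded_linear_fst])

lemma smooth_on_snd: "smooth_on S f \<Longrightarrow> open S \<Longrightarrow> smooth_on S (\<lambda>x. snd (f x))"
  by (rule smooth_on_linear[OF bounded_linear_snd])

lemma smooth_on_Pair:
  assumes "open S" "smooth_on S f" "smooth_on S g"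
  shows "smooth_on S (\<lambda>x. (f x, g x))"
proof -
  have "smooth_on S (\<lambda>x. (f x, 0) + (0, g x))"
    using assms
    by (intro smooth_on_add smooth_on_linear[of "\<lambda>x. (x, 0)"] smooth_on_linear[of "\<lambda>x. (0, x)"]
        bounded_linear_Pair bounded_linear_ident bounded_linear_zero)
  then show ?thesis by simp
qed

lemma smooth_on_continuous: "smooth_on S f \<Longrightarrow> continuous_on S f"
  unfolding smooth_on_def using C_on_continuous by blast

lemma smooth_on_has_derivative: "smooth_on S f \<Longrightarrow> x \<in> S \<Longrightarrow> (f has_derivative fderiv f x) (at x)"
  unfolding smooth_on_def using C_on_has_derivative by blast

lemma smooth_on_differentiable: "smooth_on S f \<Longrightarrow> x \<in> S \<Longrightarrow> f differentiable (at x)"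
  using smooth_on_has_derivative differentiable_def by blast

lemma smooth_on_linear_fderiv: "smooth_on S f \<Longrightarrow> x \<in> S \<Longrightarrow> linear (fderiv f x)"
  by (rule linear_fderiv[OF smooth_on_differentiable])

lemma smooth_on_fderiv_const: "smooth_on S f \<Longrightarrow> smooth_on S (\<lambda>x. fderiv f x v)"
  unfolding smooth_on_def using C_on.simps(2) by blast

text \<open>Point and direction both vary, so the direction is again expanded in
  \<open>Basis\<close>. This yields the smoothness of tangent and covector lifts.\<close>

lemma smooth_on_fderiv:
  assumes "smooth_on T f" "smooth_on S g" "smooth_on S h" "open S" "open T" "g ` S \<subseteq> T"
  shows "smooth_on S (\<lambda>x. fderiv f (g x) (h x))"
proof (rule smooth_on_cong[OF \<open>open S\<close>])
  show "smooth_on S (\<lambda>x. \<Sum>b\<in>Basis. (h x \<bullet> b) *\<^sub>R fderiv f (g x) b)"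
    using assms
    by (intro smooth_on_sum smooth_on_scaleR smooth_on_inner smooth_on_const
        smooth_on_compose[OF smooth_on_fderiv_const[OF assms(1)]]) auto
  fix x assume "x \<in> S"
  then show "(\<Sum>b\<in>Basis. (h x \<bullet> b) *\<^sub>R fderiv f (g x) b) = fderiv f (g x) (h x)"
    using linear_sum_Basis[OF smooth_on_linear_fderiv[OF assms(1)]] assms(6) by (metis image_subset_iff)
qed

lemma fderiv_compose:
  assumes "g differentiable (at (f x))" "f differentiable (at x)"
  shows "fderiv (\<lambda>y. g (f y)) x v = fderiv g (f x) (fderiv f x v)"
  by (metis assms frechet_derivative_at frechet_derivative_works has_derivative_compose)

lemma fderiv_cong:
  assumes "open S" "x \<in> S" "f differentiable (at x)" "\<And>y. y \<in> S \<Longrightarrow> f y = g y"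
  shows "fderiv f x = fderiv g x"
  using frechet_derivative_transform_within_open assms by blast

lemma fderiv_eqI: "(f has_derivative f') (at x) \<Longrightarrow> fderiv f x v = f' v"
  by (metis frechet_derivative_at)

lemma fderiv_inverse:
  assumes "open S" "x \<in> S" "f differentiable (at x)" "g differentiable (at (f x))"
    and "\<And>y. y \<in> S \<Longrightarrow> g (f y) = y"
  shows "fderiv g (f x) (fderiv f x v) = v"
proof -
  have "fderiv (\<lambda>y. g (f y)) x = fderiv (\<lambda>y. y) x"
    by (rule fderiv_cong[OF assms(1,2) _ assms(5)])
      (use assms(3,4) differentiable_chain_at[of f x g] in \<open>auto simp: o_def\<close>)
  then show ?thesis using fderiv_compose[OF assms(4,3)] by simp
qed

section \<open>Symmetry of the second derivative\<close>

text \<open>Two mean value steps: first along \<open>h\<close> for the difference of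
  \<open>f\<close> on two parallel edges of the parallelogram, then along \<open>k\<close>. The left
  side is symmetric in \<open>h\<close> and \<open>k\<close>, whereas the right side fixes an order
  of differentiation; comparing both orders gives the symmetry below.\<close>

lemma second_difference_mean_value:
  fixes f :: "'e::euclidean_space \<Rightarrow> real"
  assumes S: "open S" "smooth_on S f" and s: "0 < s"
    and sub: "\<And>a b. 0 \<le> a \<Longrightarrow> a \<le> s \<Longrightarrow> 0 \<le> b \<Longrightarrow> b \<le> s \<Longrightarrow> x + a *\<^sub>R h + b *\<^sub>R k \<in> S"
  shows "\<exists>a b. 0 \<le> a \<and> a \<le> s \<and> 0 \<le> b \<and> b \<le> s \<and>
    f (x + s *\<^sub>R h + s *\<^sub>R k) - f (x + s *\<^sub>R h) - f (x + s *\<^sub>R k) + f x =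
    s * s * fderiv (\<lambda>y. fderiv f y h) (x + a *\<^sub>R h + b *\<^sub>R k) k"
proof -
  have d: "((\<lambda>r. g (z + r *\<^sub>R v)) has_field_derivative fderiv g (z + r *\<^sub>R v) v) (at r)"
    if "smooth_on S g" "z + r *\<^sub>R v \<in> S" for g :: "'e \<Rightarrow> real" and z r v
  proof -
    have "((\<lambda>r. z + r *\<^sub>R v) has_derivative (\<lambda>t. t *\<^sub>R v)) (at r)"
      by (auto intro!: derivative_eq_intros)
    from has_derivative_compose[OF this smooth_on_has_derivative[OF that]]
    have "((\<lambda>r. g (z + r *\<^sub>R v)) has_derivative (\<lambda>t. fderiv g (z + r *\<^sub>R v) (t *\<^sub>R v))) (at r)" .
    then show ?thesis
      using linear_cmul[OF smooth_on_linear_fderiv[OF that]]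
      by (simp add: has_field_derivative_def mult_commute_abs)
  qed
  have "((\<lambda>r. f (x + s *\<^sub>R k + r *\<^sub>R h) - f (x + r *\<^sub>R h)) has_field_derivative
      fderiv f (x + s *\<^sub>R k + r *\<^sub>R h) h - fderiv f (x + r *\<^sub>R h) h) (at r)" if "0 \<le> r" "r \<le> s" for r
    using sub[of r s] sub[of r 0] that s
    by (intro DERIV_diff d S) (auto simp: algebra_simps)
  from MVT2[OF s this] obtain a where a: "0 < a" "a < s"
    "f (x + s *\<^sub>R k + s *\<^sub>R h) - f (x + s *\<^sub>R h) - (f (x + s *\<^sub>R k) - f x) =
      s * (fderiv f (x + s *\<^sub>R k + a *\<^sub>R h) h - fderiv f (x + a *\<^sub>R h) h)"
    by force
  have "((\<lambda>r. fderiv f (x + a *\<^sub>R h + r *\<^sub>R k) h) has_field_derivative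
      fderiv (\<lambda>y. fderiv f y h) (x + a *\<^sub>R h + r *\<^sub>R k) k) (at r)" if "0 \<le> r" "r \<le> s" for r
    using sub[of a r] that a(1,2) smooth_on_fderiv_const[OF S(2)] by (intro d) auto
  from MVT2[OF s this] obtain b where b: "0 < b" "b < s"
    "fderiv f (x + a *\<^sub>R h + s *\<^sub>R k) h - fderiv f (x + a *\<^sub>R h) h =
      s * fderiv (\<lambda>y. fderiv f y h) (x + a *\<^sub>R h + b *\<^sub>R k) k"
    by force
  then show ?thesis
    using a by (intro exI[of _ a] exI[of _ b]) (simp add: algebra_simps)
qed

text \<open>The same second difference, evaluated in both orders, makes the two mixed derivatives
  agree at two points close to \<open>x\<close>. Their continuity at \<open>x\<close> costs
  \<open>e / 2\<close> each.\<close>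

lemma second_fderiv_symmetric_real:
  fixes f :: "'e::euclidean_space \<Rightarrow> real"
  assumes S: "open S" "smooth_on S f" and x: "x \<in> S"
  shows "fderiv (\<lambda>y. fderiv f y h) x k = fderiv (\<lambda>y. fderiv f y k) x h"
proof -
  define A where "A = (\<lambda>h k y. fderiv (\<lambda>y. fderiv f y h) y k)"
  have cont: "isCont (A h k) x" for h k
  proof -
    have "smooth_on S (A h k)"
      unfolding A_def by (intro smooth_on_fderiv_const S(2))
    then show ?thesis
      using smooth_on_continuous S(1) x continuous_on_eq_continuous_at by blast
  qed
  have "\<bar>A h k x - A k h x\<bar> \<le> e" if "0 < e" for e
  proof -
    from cont[of h k] \<open>0 < e\<close> obtain d1 where d1: "0 < d1"
      "\<And>y. dist y x < d1 \<Longrightarrow> dist (A h k y) (A h k x) < e / 2"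
      unfolding continuous_at_eps_delta by (meson half_gt_zero)
    from cont[of k h] \<open>0 < e\<close> obtain d2 where d2: "0 < d2"
      "\<And>y. dist y x < d2 \<Longrightarrow> dist (A k h y) (A k h x) < e / 2"
      unfolding continuous_at_eps_delta by (meson half_gt_zero)
    from S x obtain d3 where d3: "0 < d3" "ball x d3 \<subseteq> S"
      by (meson openE)
    define d where "d = min d1 (min d2 d3)"
    \<comment> \<open>Small enough for the whole parallelogram with sides
      \<open>s *\<^sub>R h\<close> and \<open>s *\<^sub>R k\<close> to stay within distance
      \<open>d\<close> of \<open>x\<close>; the summand 1 keeps the denominator positive when
      \<open>h\<close> and \<open>k\<close> vanish.\<close>
    define s where "s = d / (2 * (norm h + norm k + 1))"
    have "0 < d" using d1 d2 d3 by (simp add: d_def)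
    then have "0 < s" by (simp add: s_def add_nonneg_pos)
    have sd: "s * (norm h + norm k) < d"
      using \<open>0 < d\<close> by (simp add: s_def field_simps add_nonneg_pos add_pos_nonneg add_strict_increasing)
    have near: "dist (x + a *\<^sub>R h + b *\<^sub>R k) x < d"
      if "0 \<le> a" "a \<le> s" "0 \<le> b" "b \<le> s" for a b
    proof -
      have "dist (x + a *\<^sub>R h + b *\<^sub>R k) x = norm (a *\<^sub>R h + b *\<^sub>R k)" by (simp add: dist_norm)
      also have "\<dots> \<le> a * norm h + b * norm k"
        using that norm_triangle_ineq[of "a *\<^sub>R h" "b *\<^sub>R k"] by simp
      also have "\<dots> \<le> s * norm h + s * norm k"
        using that by (intro add_mono mult_right_mono) auto
      also have "\<dots> < d" using sd by (simp add: algebra_simps)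
      finally show ?thesis .
    qed
    have inS: "x + a *\<^sub>R h + b *\<^sub>R k \<in> S" if "0 \<le> a" "a \<le> s" "0 \<le> b" "b \<le> s" for a b
      using near[OF that] d3(2) by (auto simp: d_def dist_commute)
    from second_difference_mean_value[OF S \<open>0 < s\<close> inS] obtain a b where
      ab: "0 \<le> a" "a \<le> s" "0 \<le> b" "b \<le> s"
      "f (x + s *\<^sub>R h + s *\<^sub>R k) - f (x + s *\<^sub>R h) - f (x + s *\<^sub>R k) + f x =
        s * s * A h k (x + a *\<^sub>R h + b *\<^sub>R k)"
      unfolding A_def by blast
    have inS': "x + a *\<^sub>R k + b *\<^sub>R h \<in> S" if "0 \<le> a" "a \<le> s" "0 \<le> b" "b \<le> s" for a b
      using inS[OF that(3,4,1,2)] by (simp add: algebra_simps)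
    from second_difference_mean_value[OF S \<open>0 < s\<close> inS'] obtain a' b' where
      ab': "0 \<le> a'" "a' \<le> s" "0 \<le> b'" "b' \<le> s"
      "f (x + s *\<^sub>R k + s *\<^sub>R h) - f (x + s *\<^sub>R k) - f (x + s *\<^sub>R h) + f x =
        s * s * A k h (x + a' *\<^sub>R k + b' *\<^sub>R h)"
      unfolding A_def by blast
    have "s * s * A h k (x + a *\<^sub>R h + b *\<^sub>R k) = s * s * A k h (x + b' *\<^sub>R h + a' *\<^sub>R k)"
      using ab(5) ab'(5) by (simp add: algebra_simps)
    then have "A h k (x + a *\<^sub>R h + b *\<^sub>R k) = A k h (x + b' *\<^sub>R h + a' *\<^sub>R k)"
      using \<open>0 < s\<close> by simp
    moreover have "dist (A h k (x + a *\<^sub>R h + b *\<^sub>R k)) (A h k x) < e / 2"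
      using d1(2) near[OF ab(1-4)] by (auto simp: d_def)
    moreover have "dist (A k h (x + b' *\<^sub>R h + a' *\<^sub>R k)) (A k h x) < e / 2"
      using d2(2) near[OF ab'(3,4,1,2)] by (auto simp: d_def)
    ultimately show ?thesis unfolding dist_real_def by linarith
  qed
  then have "\<bar>A h k x - A k h x\<bar> \<le> 0" by (rule field_le_epsilon[of _ 0, simplified])
  then show ?thesis by (simp add: A_def)
qed

lemma fderiv_inner:
  assumes "f differentiable (at x)"
  shows "fderiv (\<lambda>y. f y \<bullet> b) x v = fderiv f x v \<bullet> b"
  using assms has_derivative_inner_left frechet_derivative_works fderiv_eqI by blast

text \<open>The mean value argument is real-valued, so it is applied to each component
  \<open>f y \<bullet> b\<close>.\<close>

lemma second_fderiv_symmetric: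
  assumes S: "open S" "smooth_on S f" and x: "x \<in> S"
  shows "fderiv (\<lambda>y. fderiv f y h) x k = fderiv (\<lambda>y. fderiv f y k) x h"
proof (rule euclidean_eqI)
  fix b :: 'b
  have e: "fderiv (\<lambda>y. fderiv f y h) x k \<bullet> b = fderiv (\<lambda>y. fderiv (\<lambda>y. f y \<bullet> b) y h) x k" for h k
  proof -
    have "fderiv (\<lambda>y. fderiv f y h) x k \<bullet> b = fderiv (\<lambda>y. fderiv f y h \<bullet> b) x k"
      by (rule fderiv_inner[symmetric, OF smooth_on_differentiable[OF smooth_on_fderiv_const[OF S(2)] x]])
    also have "fderiv (\<lambda>y. fderiv f y h \<bullet> b) x = fderiv (\<lambda>y. fderiv (\<lambda>y. f y \<bullet> b) y h) x"
    proof (rule fderiv_cong[OF S(1) x])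
      show "(\<lambda>y. fderiv f y h \<bullet> b) differentiable (at x)"
        using has_derivative_inner_left[OF smooth_on_has_derivative[OF smooth_on_fderiv_const[OF S(2), of h] x], of b]
        unfolding differentiable_def by blast
    qed (rule fderiv_inner[symmetric, OF smooth_on_differentiable[OF S(2)]])
    finally show ?thesis .
  qed
  have "smooth_on S (\<lambda>y. f y \<bullet> b)"
    by (intro smooth_on_inner S smooth_on_const)
  from second_fderiv_symmetric_real[OF S(1) this x]
  show "fderiv (\<lambda>y. fderiv f y h) x k \<bullet> b = fderiv (\<lambda>y. fderiv f y k) x h \<bullet> b"
    unfolding e .
qed

lemma fderiv_Pair:
  assumes "f differentiable (at (x, y))"
  shows "fderiv f (x, y) (u, v) = fderiv (\<lambda>x. f (x, y)) x u + fderiv (\<lambda>y. f (x, y)) y v"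
proof -
  have f: "(f has_derivative fderiv f (x, y)) (at (x, y))"
    using assms by (simp add: frechet_derivative_works[symmetric])
  have "((\<lambda>x. (x, y)) has_derivative (\<lambda>u. (u, 0))) (at x)"
    by (intro has_derivative_Pair has_derivative_ident has_derivative_const)
  from has_derivative_compose[OF this f]
  have 1: "fderiv (\<lambda>x. f (x, y)) x u = fderiv f (x, y) (u, 0)"
    by (rule fderiv_eqI)
  have "((\<lambda>y. (x, y)) has_derivative (\<lambda>v. (0, v))) (at y)"
    by (intro has_derivative_Pair has_derivative_ident has_derivative_const)
  from has_derivative_compose[OF this f]
  have 2: "fderiv (\<lambda>y. f (x, y)) y v = fderiv f (x, y) (0, v)"
    by (rule fderiv_eqI)
  show ?thesis
    unfolding 1 2 using linear_add[OF linear_fderiv[OF assms], of "(u, 0)" "(0, v)"] by simp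
qed

section \<open>Smooth inverse functions\<close>

text \<open>Since \<open>u\<close> vanishes at \<open>x\<close>, the product-rule term containing a
  derivative of \<open>h\<close> carries the factor 0, and continuity of \<open>h\<close> is enough.
  This allows the inverse family to be differentiated before it is known to be
  differentiable.\<close>

lemma has_derivative_scaleR_zero:
  fixes u :: "'e::euclidean_space \<Rightarrow> real" and h :: "'e \<Rightarrow> 'f::euclidean_space"
  assumes u: "(u has_derivative u') (at x)" "u x = 0" and h: "isCont h x"
  shows "((\<lambda>y. u y *\<^sub>R h y) has_derivative (\<lambda>v. u' v *\<^sub>R h x)) (at x)"
  unfolding has_derivative_at2
proof
  have lin: "bounded_linear u'" using u(1) has_derivative_bounded_linear by blast
  then show "bounded_linear (\<lambda>v. u' v *\<^sub>R h x)"
    by (rule bounded_linear_scaleR_const)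
  obtain K where K: "\<And>v. norm (u' v) \<le> norm v * K"
    using bounded_linear.bounded[OF lin] by blast
  have h0: "((\<lambda>y. h y - h x) \<longlongrightarrow> 0) (at x)"
    using h LIM_zero isContD by blast
  have "((\<lambda>y. ((1 / norm (y - x)) *\<^sub>R (u y - (u x + u' (y - x)))) *\<^sub>R h y) \<longlongrightarrow> 0 *\<^sub>R h x) (at x)"
    by (rule tendsto_scaleR[OF conjunct2[OF u(1)[unfolded has_derivative_at2]] h[unfolded isCont_def]])
  moreover have "((\<lambda>y. (u' (y - x) / norm (y - x)) *\<^sub>R (h y - h x)) \<longlongrightarrow> 0) (at x)"
  proof (rule Lim_null_comparison)
    show "eventually (\<lambda>y. norm ((u' (y - x) / norm (y - x)) *\<^sub>R (h y - h x)) \<le> K * norm (h y - h x)) (at x)"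
    proof (rule eventually_at_topological[THEN iffD2], intro exI[of _ UNIV] conjI ballI impI)
      fix y assume "y \<noteq> x"
      then have "\<bar>u' (y - x)\<bar> / norm (y - x) \<le> K"
        using K[of "y - x"] by (simp add: divide_le_eq mult.commute)
      then show "norm ((u' (y - x) / norm (y - x)) *\<^sub>R (h y - h x)) \<le> K * norm (h y - h x)"
        using mult_right_mono[of "\<bar>u' (y - x)\<bar> / norm (y - x)" K "norm (h y - h x)"] by simp
    qed auto
    show "((\<lambda>y. K * norm (h y - h x)) \<longlongrightarrow> 0) (at x)"
      using tendsto_mult_right_zero[OF tendsto_norm_zero[OF h0]] by simp
  qed
  ultimately have "((\<lambda>y. ((1 / norm (y - x)) *\<^sub>R (u y - (u x + u' (y - x)))) *\<^sub>R h y +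
      (u' (y - x) / norm (y - x)) *\<^sub>R (h y - h x)) \<longlongrightarrow> 0 + 0) (at x)"
    by (intro tendsto_add) simp_all
  then show "((\<lambda>y. (1 / norm (y - x)) *\<^sub>R (u y *\<^sub>R h y - (u x *\<^sub>R h x + u' (y - x) *\<^sub>R h x))) \<longlongrightarrow> 0) (at x)"
    by (simp add: u(2) algebra_simps)
qed

context
  fixes A :: "'a::euclidean_space \<Rightarrow> 'e::euclidean_space \<Rightarrow> 'f::euclidean_space" and B T
  assumes T: "open T"
    and A: "\<And>y. y \<in> T \<Longrightarrow> linear (A y)" and B: "\<And>y. y \<in> T \<Longrightarrow> linear (B y)"
    and BA: "\<And>y v. y \<in> T \<Longrightarrow> B y (A y v) = v" and AB: "\<And>y v. y \<in> T \<Longrightarrow> A y (B y v) = v"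
begin

text \<open>With \<open>w = B z v - B y v\<close> one has
  \<open>A z w = - (A z - A y) (B y v)\<close>. The inverse at \<open>y\<close> bounds
  \<open>norm w\<close> by a multiple of \<open>norm (A y w)\<close>, and for \<open>z\<close> near
  \<open>y\<close> replacing \<open>A y\<close> by \<open>A z\<close> changes this little.\<close>

lemma continuous_on_inverse_family:
  assumes "\<And>v. continuous_on T (\<lambda>y. A y v)"
  shows "continuous_on T (\<lambda>y. B y v)"
proof (rule continuous_at_imp_continuous_on, rule)
  fix y assume y: "y \<in> T"
  have A': "((\<lambda>z. A z v) \<longlongrightarrow> A y v) (at y)" for v
    using assms[of v] y T continuous_on_eq_continuous_at isCont_def by blast
  obtain c where c: "0 < c" "\<And>w. norm w \<le> c * norm (A y w)"
    using linear_bounded_pos[OF B[OF y]] BA[OF y] by metis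
  \<comment> \<open>Dominates the operator norm of \<open>A z - A y\<close> by finitely many values,
    for which continuity is assumed.\<close>
  define s where "s z = (\<Sum>b\<in>Basis. norm (A z b - A y b))" for z
  have "(s \<longlongrightarrow> (\<Sum>b\<in>Basis. norm (A y b - A y b))) (at y)"
    unfolding s_def by (intro tendsto_sum tendsto_norm tendsto_diff A' tendsto_const)
  then have s0: "(s \<longlongrightarrow> 0) (at y)" by simp
  have low: "norm ((A z - A y) w) \<le> s z * norm w" if "z \<in> T" for z w
  proof -
    have "linear (A z - A y)"
      unfolding fun_diff_def by (intro linear_compose_sub A that y)
    from linear_sum_Basis[OF this, of w]
    have "norm ((A z - A y) w) \<le> (\<Sum>b\<in>Basis. \<bar>w \<bullet> b\<bar> * norm (A z b - A y b))"
      using norm_sum[of "\<lambda>b. (w \<bullet> b) *\<^sub>R (A z - A y) b" Basis] by simp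
    also have "\<dots> \<le> (\<Sum>b\<in>Basis. norm w * norm (A z b - A y b))"
      by (intro sum_mono mult_right_mono Basis_le_norm) auto
    finally show ?thesis by (simp add: s_def sum_distrib_left mult.commute)
  qed
  \<comment> \<open>The bound 1/2 lets the term with \<open>norm ?w\<close> be absorbed into the
    left side below, at the price of the factor 2.\<close>
  have ev: "eventually (\<lambda>z. z \<in> T \<and> c * s z \<le> 1 / 2) (at y)"
  proof (rule eventually_conj)
    show "eventually (\<lambda>z. z \<in> T) (at y)" using T y eventually_at_topological by blast
    have "eventually (\<lambda>z. s z < 1 / (2 * c)) (at y)"
      using order_tendstoD(2)[OF s0] c(1) by simp
    then show "eventually (\<lambda>z. c * s z \<le> 1 / 2) (at y)"
      by (rule eventually_mono) (use c(1) in \<open>simp add: field_simps\<close>)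
  qed
  have "((\<lambda>z. B z v - B y v) \<longlongrightarrow> 0) (at y)"
  proof (rule Lim_null_comparison)
    show "eventually (\<lambda>z. norm (B z v - B y v) \<le> 2 * c * (s z * norm (B y v))) (at y)"
      using ev
    proof (rule eventually_mono)
      fix z assume "z \<in> T \<and> c * s z \<le> 1 / 2"
      then have z: "z \<in> T" "c * s z \<le> 1 / 2" by auto
      let ?w = "B z v - B y v"
      have "A z ?w = - (A z - A y) (B y v)"
        by (simp add: linear_diff[OF A[OF z(1)]] AB z y)
      then have "norm (A z ?w) \<le> s z * norm (B y v)"
        using low[OF z(1), of "B y v"] by (simp add: norm_minus_commute)
      moreover have "norm (A y ?w) \<le> norm (A z ?w) + norm ((A z - A y) ?w)"
        using norm_triangle_ineq4[of "A z ?w" "(A z - A y) ?w"] by simp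
      ultimately have "norm (A y ?w) \<le> s z * norm (B y v) + s z * norm ?w"
        using low[OF z(1), of ?w] by linarith
      then have "norm ?w \<le> c * (s z * norm (B y v) + s z * norm ?w)"
        using c(2)[of ?w] mult_left_mono[of _ _ c] c(1) by (meson less_imp_le order_trans)
      also have "\<dots> = c * (s z * norm (B y v)) + (c * s z) * norm ?w" by (simp add: algebra_simps)
      also have "\<dots> \<le> c * (s z * norm (B y v)) + 1 / 2 * norm ?w"
        by (intro add_left_mono mult_right_mono z) auto
      finally show "norm ?w \<le> 2 * c * (s z * norm (B y v))" by (simp add: algebra_simps)
    qed
    show "((\<lambda>z. 2 * c * (s z * norm (B y v))) \<longlongrightarrow> 0) (at y)"
      by (intro tendsto_mult_right_zero tendsto_mult_left_zero s0)
  qed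
  then show "isCont (\<lambda>y. B y v) y"
    unfolding isCont_def by (rule LIM_zero_cancel)
qed

text \<open>Differentiating \<open>A y (B y v) = v\<close> gives \<open>D(B v) = - B (DA) (B v)\<close>, so each order of
  differentiability of \<open>A\<close> passes to \<open>B\<close>.\<close>

lemma C_on_inverse_family:
  assumes "\<And>v. C_on k T (\<lambda>y. A y v)"
  shows "C_on k T (\<lambda>y. B y v)"
  using assms
proof (induction k arbitrary: v)
  case 0
  then show ?case using continuous_on_inverse_family by simp
next
  case (Suc k)
  have IH: "C_on k T (\<lambda>y. B y v)" for v
    using Suc.IH C_on_lower[OF Suc.prems] by blast
  have "continuous_on T (\<lambda>y. A y v)" for v using C_on_continuous[OF Suc.prems] .
  then have contB: "isCont (\<lambda>y. B y v) y" if "y \<in> T" for v y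
    using continuous_on_inverse_family that T continuous_on_eq_continuous_at by blast
  \<comment> \<open>The derivative of \<open>\<lambda>z. A z w\<close>, expanded in \<open>w\<close>
    so that the moving vector \<open>B x v\<close> can later be inserted for \<open>w\<close>
    without losing the class \<open>C_on k\<close>.\<close>
  define DA where "DA = (\<lambda>y w e. \<Sum>c\<in>Basis. (w \<bullet> c) *\<^sub>R fderiv (\<lambda>z. A z c) y e)"
  show ?case
  proof (rule C_on_SucI[OF T])
    fix y assume y: "y \<in> T"
    have dA: "((\<lambda>z. A z w) has_derivative DA y w) (at y)" for w
    proof (rule has_derivative_transform_within_open[OF _ T y])
      show "((\<lambda>z. \<Sum>c\<in>Basis. (w \<bullet> c) *\<^sub>R A z c) has_derivative DA y w) (at y)"
        unfolding DA_def
        by (intro has_derivative_sum has_derivative_scaleR_right C_on_has_derivative[OF Suc.prems y])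
    qed (simp add: linear_sum_Basis[OF A, symmetric])
    \<comment> \<open>Chosen so that \<open>B z (u z) = B y v - B z v\<close> and
      \<open>u y = 0\<close>. Expanding \<open>B z (u z)\<close> in \<open>Basis\<close> gives
      products to which \<open>has_derivative_scaleR_zero\<close> applies.\<close>
    define u where "u = (\<lambda>z. A z (B y v) - v)"
    have du: "((\<lambda>z. u z \<bullet> b) has_derivative (\<lambda>e. DA y (B y v) e \<bullet> b)) (at y)" for b
      unfolding u_def by (auto intro!: derivative_eq_intros dA)
    have "((\<lambda>z. \<Sum>b\<in>Basis. (u z \<bullet> b) *\<^sub>R B z b) has_derivative
        (\<lambda>e. \<Sum>b\<in>Basis. (DA y (B y v) e \<bullet> b) *\<^sub>R B y b)) (at y)"
      by (intro has_derivative_sum has_derivative_scaleR_zero du contB[OF y])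
        (simp add: u_def AB y)
    then have "((\<lambda>z. B y v - (\<Sum>b\<in>Basis. (u z \<bullet> b) *\<^sub>R B z b)) has_derivative
        (\<lambda>e. 0 - (\<Sum>b\<in>Basis. (DA y (B y v) e \<bullet> b) *\<^sub>R B y b))) (at y)"
      by (intro has_derivative_diff has_derivative_const)
    then show "((\<lambda>y. B y v) has_derivative
        (\<lambda>e. 0 - (\<Sum>b\<in>Basis. (DA y (B y v) e \<bullet> b) *\<^sub>R B y b))) (at y)"
    proof (rule has_derivative_transform_within_open[OF _ T y])
      fix z assume z: "z \<in> T"
      have "(\<Sum>b\<in>Basis. (u z \<bullet> b) *\<^sub>R B z b) = B z (u z)"
        using linear_sum_Basis[OF B[OF z]] by metis
      also have "\<dots> = B y v - B z v"
        unfolding u_def by (simp add: linear_diff[OF B[OF z]] BA z)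
      finally show "B y v - (\<Sum>b\<in>Basis. (u z \<bullet> b) *\<^sub>R B z b) = B z v" by simp
    qed
  next
    fix e
    have "C_on k T (\<lambda>x. fderiv (\<lambda>z. A z c) x e)" for c using Suc.prems by simp
    then have "C_on k T (\<lambda>x. - (\<Sum>b\<in>Basis. (DA x (B x v) e \<bullet> b) *\<^sub>R B x b))"
      unfolding DA_def
      by (intro C_on_linear[OF T bounded_linear_minus[OF bounded_linear_ident]] C_on_sum T
          C_on_bilinear[OF T bounded_bilinear_scaleR] C_on_bilinear[OF T bounded_bilinear_inner]
          C_on_const IH)
    then show "C_on k T (\<lambda>x. 0 - (\<Sum>b\<in>Basis. (DA x (B x v) e \<bullet> b) *\<^sub>R B x b))" by simp
  qed
qed

end

text \<open>Bootstrapping: if \<open>g\<close> is of class k, so is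
  \<open>y \<mapsto> fderiv f (g y)\<close>, hence so is its inverse family \<open>g'\<close>, and
  \<open>g\<close> is of class k + 1.\<close>

lemma smooth_on_inverse:
  assumes S: "open S" "smooth_on S f" and T: "open T" "g ` T \<subseteq> S"
    and g: "\<And>y. y \<in> T \<Longrightarrow> (g has_derivative g' y) (at y)"
    and inv: "\<And>y v. y \<in> T \<Longrightarrow> g' y (fderiv f (g y) v) = v"
      "\<And>y v. y \<in> T \<Longrightarrow> fderiv f (g y) (g' y v) = v"
  shows "smooth_on T g"
proof -
  have "C_on k T g" for k
  proof (induction k)
    case 0
    then show ?case
      using g by (auto intro!: continuous_at_imp_continuous_on has_derivative_continuous)
  next
    case (Suc k)
    have A: "C_on k T (\<lambda>y. fderiv f (g y) v)" for v
      using C_on_compose[OF T(1) S(1) _ Suc T(2)] smooth_on_fderiv_const[OF S(2)]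
      unfolding smooth_on_def by blast
    have l: "linear (fderiv f (g y))" "linear (g' y)" if "y \<in> T" for y
      using that T(2) smooth_on_linear_fderiv[OF S(2)] has_derivative_linear[OF g[OF that]] by auto
    have g': "C_on k T (\<lambda>y. g' y v)" for v
      by (rule C_on_inverse_family[where A = "\<lambda>y. fderiv f (g y)", OF T(1) l inv A])
    show ?case by (rule C_on_SucI[OF T(1) g g'])
  qed
  then show ?thesis by (simp add: smooth_on_def)
qed

text \<open>The inverse function theorem provides a local inverse whose derivative is the inverse of
  \<open>fderiv f (g y)\<close>; \<open>smooth_on_inverse\<close> upgrades it to a smooth
  map.\<close>

lemma smooth_inverse_function_theorem:
  fixes f :: "'e::euclidean_space \<Rightarrow> 'e"
  assumes S: "open S" "smooth_on S f" and x: "x \<in> S" and inj: "inj (fderiv f x)"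
  obtains U V g where "open U" "U \<subseteq> S" "x \<in> U" "open V" "f x \<in> V"
    "homeomorphism U V f g" "smooth_on V g"
proof -
  have bl: "bounded_linear (fderiv f y)" if "y \<in> S" for y
    using smooth_on_has_derivative[OF S(2) that] has_derivative_bounded_linear by blast
  define f' where "f' y = Blinfun (fderiv f y)" for y
  have f': "blinfun_apply (f' y) = fderiv f y" if "y \<in> S" for y
    unfolding f'_def by (rule bounded_linear_Blinfun_apply[OF bl[OF that]])
  \<comment> \<open>A left inverse of the derivative at \<open>x\<close> is the invertibility datum
    that the inverse function theorem takes; injectivity supplies it.\<close>
  obtain G where G: "linear G" "\<And>v. G (fderiv f x v) = v"
    using linear_injective_left_inverse[OF smooth_on_linear_fderiv[OF S(2) x] inj]
    by (metis comp_apply id_apply)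
  have "continuous_on S f'"
  proof (rule continuous_on_blinfun_componentwise)
    fix i
    show "continuous_on S (\<lambda>x. blinfun_apply (f' x) i)"
      using smooth_on_continuous[OF smooth_on_fderiv_const[OF S(2), of i]]
      by (rule continuous_on_eq) (simp add: f')
  qed
  moreover have "(f has_derivative blinfun_apply (f' y)) (at y)" if "y \<in> S" for y
    using smooth_on_has_derivative[OF S(2) that] f'[OF that] by simp
  moreover have "Blinfun G o\<^sub>L f' x = id_blinfun"
    by (rule blinfun_eqI) (simp add: f'[OF x] bounded_linear_Blinfun_apply G linear_conv_bounded_linear[symmetric])
  ultimately obtain U V g g' where UV: "open U" "U \<subseteq> S" "x \<in> U" "open V" "f x \<in> V"
      "homeomorphism U V f g" and g: "\<And>y. y \<in> V \<Longrightarrow> (g has_derivative g' y) (at y)"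
      "\<And>y. y \<in> V \<Longrightarrow> g' y = inv (blinfun_apply (f' (g y)))"
      "\<And>y. y \<in> V \<Longrightarrow> bij (blinfun_apply (f' (g y)))"
    using inverse_function_theorem[OF S(1) _ _ x] by metis
  have gV: "g y \<in> S" if "y \<in> V" for y
    using that UV(2,6) unfolding homeomorphism_def by blast
  have "smooth_on V g"
  proof (rule smooth_on_inverse[OF S UV(4) _ g(1)])
    show "g ` V \<subseteq> S" using gV by blast
    fix y v assume y: "y \<in> V"
    show "g' y (fderiv f (g y) v) = v"
      using g(2,3)[OF y] f'[OF gV[OF y]] by (simp add: bij_is_inj)
    show "fderiv f (g y) (g' y v) = v"
      using g(2,3)[OF y] f'[OF gV[OF y]] by (simp add: bij_is_surj surj_f_inv_f)
  qed
  with UV show ?thesis using that by blast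
qed

section \<open>Tangent and covector lifts in coordinates\<close>

text \<open>The inverse is an explicit second map: this keeps the notion symmetric, and the covector
  lift is built from both maps.\<close>

definition smooth_inverses ::
  "'e::euclidean_space set \<Rightarrow> 'f::euclidean_space set \<Rightarrow> ('e \<Rightarrow> 'f) \<Rightarrow> ('f \<Rightarrow> 'e) \<Rightarrow> bool" where
  "smooth_inverses S T F G \<longleftrightarrow> open S \<and> open T \<and> smooth_on S F \<and> smooth_on T G \<and>
     (\<forall>x\<in>S. F x \<in> T \<and> G (F x) = x) \<and> (\<forall>y\<in>T. G y \<in> S \<and> F (G y) = y)"

lemma smooth_inverses_sym: "smooth_inverses S T F G \<Longrightarrow> smooth_inverses T S G F"
  by (auto simp: smooth_inverses_def)

lemma smooth_inversesD:
  assumes "smooth_inverses S T F G"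
  shows "open S" "open T" "smooth_on S F" "smooth_on T G"
    "x \<in> S \<Longrightarrow> F x \<in> T" "x \<in> S \<Longrightarrow> G (F x) = x" "y \<in> T \<Longrightarrow> G y \<in> S" "y \<in> T \<Longrightarrow> F (G y) = y"
  using assms by (auto simp: smooth_inverses_def)

lemma smooth_inverses_fderiv:
  assumes "smooth_inverses S T F G" "x \<in> S"
  shows "fderiv G (F x) (fderiv F x v) = v"
  by (rule fderiv_inverse[of S])
    (use assms in \<open>auto simp: smooth_inverses_def intro: smooth_on_differentiable\<close>)

definition tangent_lift ::
  "('e::euclidean_space \<Rightarrow> 'f::euclidean_space) \<Rightarrow> 'e \<times> 'e \<Rightarrow> 'f \<times> 'f" where
  "tangent_lift F z = (F (fst z), fderiv F (fst z) (snd z))"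

text \<open>Coordinate form of the cotangent lift: for \<open>G\<close> inverse to \<open>F\<close>,
  the adjoint of the derivative of \<open>G\<close> at the image point is the inverse transpose of
  the derivative of \<open>F\<close>.\<close>

definition covector_lift ::
  "('e::euclidean_space \<Rightarrow> 'f::euclidean_space) \<Rightarrow> ('f \<Rightarrow> 'e) \<Rightarrow> 'e \<times> 'e \<Rightarrow> 'f \<times> 'f" where
  "covector_lift F G z = (F (fst z), adjoint (fderiv G (F (fst z))) (snd z))"

text \<open>The constant form dq ^ dp on position-momentum pairs.\<close>

definition symplectic_product :: "'e::euclidean_space \<times> 'e \<Rightarrow> 'e \<times> 'e \<Rightarrow> real" where
  "symplectic_product u w = fst u \<bullet> snd w - fst w \<bullet> snd u"

definition interchange :: "('a \<times> 'b) \<times> ('c \<times> 'd) \<Rightarrow> ('a \<times> 'c) \<times> ('d \<times> 'b)" where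
  "interchange = (\<lambda>((q, p), (q', p')). ((q, q'), (p', p)))"

text \<open>Replaces the adjoint, a definite choice of linear map, by a finite sum of derivatives in
  fixed directions, from which smoothness can be read off.\<close>

lemma adjoint_sum_Basis:
  fixes L :: "'e::euclidean_space \<Rightarrow> 'f::euclidean_space"
  assumes "linear L"
  shows "adjoint L p = (\<Sum>b\<in>Basis. (L b \<bullet> p) *\<^sub>R b)"
proof -
  have "adjoint L p = (\<Sum>b\<in>Basis. (adjoint L p \<bullet> b) *\<^sub>R b)"
    by (simp add: euclidean_representation)
  then show ?thesis using adjoint_works[OF assms] by (simp add: inner_commute)
qed

lemma smooth_on_tangent_lift:
  assumes "open S" "smooth_on S F"
  shows "smooth_on (S \<times> UNIV) (tangent_lift F)"
  unfolding tangent_lift_def[abs_def]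
  using assms
  by (intro smooth_on_Pair smooth_on_fderiv[OF assms(2)] smooth_on_compose[OF assms(2)] smooth_on_fst
      smooth_on_snd smooth_on_ident open_Times) auto

lemma smooth_inverses_tangent_lift:
  assumes "smooth_inverses S T F G"
  shows "smooth_inverses (S \<times> UNIV) (T \<times> UNIV) (tangent_lift F) (tangent_lift G)"
  using assms smooth_inverses_fderiv[OF assms] smooth_inverses_fderiv[OF smooth_inverses_sym[OF assms]]
  by (auto simp: smooth_inverses_def smooth_on_tangent_lift open_Times)
    (auto simp: tangent_lift_def)

lemma smooth_on_covector_lift:
  assumes "open S" "open T" "smooth_on S F" "smooth_on T G" "F ` S \<subseteq> T"
  shows "smooth_on (S \<times> UNIV) (covector_lift F G)"
proof (rule smooth_on_cong)
  show o: "open (S \<times> (UNIV :: 'a set))" using assms(1) by (simp add: open_Times)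
  have F: "smooth_on (S \<times> UNIV) (\<lambda>z :: 'a \<times> 'a. F (fst z))"
    using assms(1) o by (intro smooth_on_compose[OF assms(3)] smooth_on_fst smooth_on_ident) auto
  then show "smooth_on (S \<times> UNIV) (\<lambda>z. (F (fst z), \<Sum>b\<in>Basis. (fderiv G (F (fst z)) b \<bullet> snd z) *\<^sub>R b))"
    using assms(5)
    by (intro smooth_on_Pair smooth_on_sum smooth_on_scaleR smooth_on_inner smooth_on_const
        smooth_on_fderiv[OF assms(4)] smooth_on_snd smooth_on_ident o assms(2)) auto
  show "(F (fst z), \<Sum>b\<in>Basis. (fderiv G (F (fst z)) b \<bullet> snd z) *\<^sub>R b) = covector_lift F G z"
    if "z \<in> S \<times> UNIV" for z
    using that assms(5) unfolding covector_lift_def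
    by (subst adjoint_sum_Basis[OF smooth_on_linear_fderiv[OF assms(4)]]) auto
qed

lemma inner_covector_lift:
  assumes "smooth_inverses S T F G" "x \<in> S"
  shows "snd (covector_lift F G (x, p)) \<bullet> w = p \<bullet> fderiv G (F x) w"
proof -
  have "linear (fderiv G (F x))"
    using smooth_on_linear_fderiv smooth_inversesD[OF assms(1)] assms(2) by blast
  from adjoint_works[OF this, of w p] show ?thesis
    by (simp add: covector_lift_def inner_commute)
qed

lemma inner_covector_lift_fderiv:
  assumes "smooth_inverses S T F G" "x \<in> S"
  shows "snd (covector_lift F G (x, p)) \<bullet> fderiv F x w = p \<bullet> w"
  by (simp add: inner_covector_lift[OF assms] smooth_inverses_fderiv[OF assms])

text \<open>A fibre component is determined by its pairings with all vectors, and in these pairings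
  the derivatives of \<open>F\<close> and \<open>G\<close> cancel.\<close>

lemma covector_lift_inverse:
  assumes "smooth_inverses S T F G" "z \<in> S \<times> UNIV"
  shows "covector_lift G F (covector_lift F G z) = z"
proof -
  obtain x p where z: "z = (x, p)" "x \<in> S" using assms(2) by auto
  have Fx: "F x \<in> T" "G (F x) = x" using smooth_inversesD(5,6)[OF assms(1) z(2)] by auto
  have "snd (covector_lift G F (covector_lift F G (x, p))) = p"
  proof (rule euclidean_eqI)
    fix b
    have e: "covector_lift F G (x, p) = (F x, snd (covector_lift F G (x, p)))"
      by (simp add: covector_lift_def)
    have "snd (covector_lift G F (F x, snd (covector_lift F G (x, p)))) \<bullet> b = p \<bullet> b"
      using inner_covector_lift[OF smooth_inverses_sym[OF assms(1)] Fx(1)]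
      by (simp add: Fx(2) inner_covector_lift_fderiv[OF assms(1) z(2)])
    then show "snd (covector_lift G F (covector_lift F G (x, p))) \<bullet> b = p \<bullet> b" using e by simp
  qed
  then show ?thesis by (simp add: z(1) covector_lift_def Fx)
qed

lemma smooth_inverses_covector_lift:
  assumes "smooth_inverses S T F G"
  shows "smooth_inverses (S \<times> UNIV) (T \<times> UNIV) (covector_lift F G) (covector_lift G F)"
proof -
  note D = smooth_inversesD[OF assms]
  have "smooth_on (S \<times> UNIV) (covector_lift F G)" "smooth_on (T \<times> UNIV) (covector_lift G F)"
    using D by (auto intro!: smooth_on_covector_lift)
  then show ?thesis
    using covector_lift_inverse[OF assms] covector_lift_inverse[OF smooth_inverses_sym[OF assms]] D
    unfolding smooth_inverses_def
    by (auto simp: open_Times) (auto simp: covector_lift_def)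
qed

text \<open>The lift satisfies \<open>\<pi> \<bullet> DF(x) w = p \<bullet> w\<close>; in the derivative of this identity the terms
  with the second derivative of \<open>F\<close> cancel by symmetry.\<close>

lemma symplectic_product_covector_lift:
  assumes inv: "smooth_inverses S T F G" and z: "z \<in> S \<times> UNIV"
  shows "symplectic_product (fderiv (covector_lift F G) z u) (fderiv (covector_lift F G) z w) =
    symplectic_product u w"
proof -
  let ?H = "covector_lift F G"
  note D = smooth_inversesD[OF inv]
  have x: "fst z \<in> S" using z by auto
  have oS: "open (S \<times> (UNIV :: 'a set))" using D(1) by (simp add: open_Times)
  have H: "(?H has_derivative fderiv ?H z) (at z)"
    using smooth_inversesD(3)[OF smooth_inverses_covector_lift[OF inv]] smooth_on_has_derivative z by blast
  have "((\<lambda>z. F (fst z)) has_derivative (\<lambda>u. fderiv F (fst z) (fst u))) (at z)"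
    by (rule has_derivative_compose[OF has_derivative_fst[OF has_derivative_ident]
          smooth_on_has_derivative[OF D(3) x]])
  moreover have "((\<lambda>z. F (fst z)) has_derivative (\<lambda>u. fst (fderiv ?H z u))) (at z)"
    using has_derivative_fst[OF H] by (simp add: covector_lift_def)
  ultimately have fst: "fst (fderiv ?H z u) = fderiv F (fst z) (fst u)" for u
    using has_derivative_unique by metis
  have snd: "snd (fderiv ?H z u) \<bullet> fderiv F (fst z) h +
      snd (?H z) \<bullet> fderiv (\<lambda>y. fderiv F y h) (fst z) (fst u) = snd u \<bullet> h" for u h
  proof -
    have "((\<lambda>z. fderiv F (fst z) h) has_derivative
        (\<lambda>u. fderiv (\<lambda>y. fderiv F y h) (fst z) (fst u))) (at z)"
      by (rule has_derivative_compose[OF has_derivative_fst[OF has_derivative_ident]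
            smooth_on_has_derivative[OF smooth_on_fderiv_const[OF D(3)] x]])
    from has_derivative_inner[OF has_derivative_snd[OF H] this]
    have "((\<lambda>z. snd z \<bullet> h) has_derivative (\<lambda>u. snd (?H z) \<bullet>
        fderiv (\<lambda>y. fderiv F y h) (fst z) (fst u) + snd (fderiv ?H z u) \<bullet> fderiv F (fst z) h)) (at z)"
      by (rule has_derivative_transform_within_open[OF _ oS z])
        (use inner_covector_lift_fderiv[OF inv] in auto)
    moreover have "((\<lambda>z. snd z \<bullet> h) has_derivative (\<lambda>u. snd u \<bullet> h)) (at z)"
      by (intro has_derivative_inner_left has_derivative_snd has_derivative_ident)
    ultimately have "(\<lambda>u. snd (?H z) \<bullet> fderiv (\<lambda>y. fderiv F y h) (fst z) (fst u) +
        snd (fderiv ?H z u) \<bullet> fderiv F (fst z) h) = (\<lambda>u. snd u \<bullet> h)"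
      by (rule has_derivative_unique)
    from fun_cong[OF this, of u] show ?thesis by simp
  qed
  have "fderiv (\<lambda>y. fderiv F y (fst w)) (fst z) (fst u) = fderiv (\<lambda>y. fderiv F y (fst u)) (fst z) (fst w)"
    by (rule second_fderiv_symmetric[OF D(1,3) x])
  with snd[of u "fst w"] snd[of w "fst u"] show ?thesis
    by (simp add: symplectic_product_def fst inner_commute)
qed

text \<open>Moving the base point by \<open>e\<close> differentiates \<open>fderiv G y w\<close>
  once more; moving the fibre by \<open>f\<close> contributes linearly. \<open>fderiv_Pair\<close>
  adds the two partial derivatives.\<close>

lemma fderiv_tangent_lift:
  assumes "open T" "smooth_on T G" "y \<in> T"
  shows "fderiv (tangent_lift G) (y, w) (e, f) =
    (fderiv G y e, fderiv (\<lambda>z. fderiv G z w) y e + fderiv G y f)"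
proof -
  have T: "tangent_lift G differentiable (at (y, w))"
    using smooth_on_differentiable[OF smooth_on_tangent_lift[OF assms(1,2)]] assms(3) by auto
  have "((\<lambda>z. tangent_lift G (z, w)) has_derivative
      (\<lambda>e. (fderiv G y e, fderiv (\<lambda>z. fderiv G z w) y e))) (at y)"
    unfolding tangent_lift_def fst_conv snd_conv
    by (intro has_derivative_Pair smooth_on_has_derivative[OF assms(2,3)]
        smooth_on_has_derivative[OF smooth_on_fderiv_const[OF assms(2)] assms(3)])
  from fderiv_eqI[OF this]
  have 1: "fderiv (\<lambda>z. tangent_lift G (z, w)) y e = (fderiv G y e, fderiv (\<lambda>z. fderiv G z w) y e)" .
  have "((\<lambda>v. tangent_lift G (y, v)) has_derivative (\<lambda>f. (0, fderiv G y f))) (at w)"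
    unfolding tangent_lift_def fst_conv snd_conv
    by (intro has_derivative_Pair has_derivative_const linear_imp_has_derivative
        smooth_on_linear_fderiv[OF assms(2,3)])
  from fderiv_eqI[OF this] have "fderiv (\<lambda>v. tangent_lift G (y, v)) w f = (0, fderiv G y f)" .
  with 1 show ?thesis using fderiv_Pair[OF T] by simp
qed

text \<open>Coordinate form of the fact that the Tulczyjew map does not depend on the chart.\<close>

lemma interchange_tangent_covector_lift:
  assumes inv: "smooth_inverses S T F G" and z: "z \<in> S \<times> UNIV"
  shows "interchange (tangent_lift (covector_lift F G) (z, w)) =
    covector_lift (tangent_lift F) (tangent_lift G) (interchange (z, w))"
proof -
  obtain q p q' p' where zw: "z = (q, p)" "w = (q', p')" by (cases z, cases w)
  let ?H = "covector_lift F G"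
  note D = smooth_inversesD[OF inv]
  have q: "q \<in> S" using z zw by auto
  have oS: "open (S \<times> (UNIV :: 'a set))" using D(1) by (simp add: open_Times)
  have H: "(?H has_derivative fderiv ?H z) (at z)"
    using smooth_inversesD(3)[OF smooth_inverses_covector_lift[OF inv]] smooth_on_has_derivative z by blast
  have x: "fst z \<in> S" using q zw by simp
  have dF: "((\<lambda>z. F (fst z)) has_derivative (\<lambda>u. fderiv F q (fst u))) (at z)"
    using has_derivative_compose[OF has_derivative_fst[OF has_derivative_ident]
          smooth_on_has_derivative[OF D(3) x]] zw by simp
  moreover have "((\<lambda>z. F (fst z)) has_derivative (\<lambda>u. fst (fderiv ?H z u))) (at z)"
    using has_derivative_fst[OF H] by (simp add: covector_lift_def)
  ultimately have fst: "fst (fderiv ?H z u) = fderiv F q (fst u)" for u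
    using has_derivative_unique by metis
  have snd: "snd (fderiv ?H z w) \<bullet> e =
      p \<bullet> fderiv (\<lambda>y. fderiv G y e) (F q) (fderiv F q q') + p' \<bullet> fderiv G (F q) e" for e
  proof -
    have "((\<lambda>z. fderiv G (F (fst z)) e) has_derivative
        (\<lambda>u. fderiv (\<lambda>y. fderiv G y e) (F q) (fderiv F q (fst u)))) (at z)"
      using has_derivative_compose[OF dF smooth_on_has_derivative[OF smooth_on_fderiv_const[OF D(4)], of "F (fst z)" e]]
        D(5)[OF q] zw by simp
    from has_derivative_inner[OF has_derivative_snd[OF has_derivative_ident] this]
    have "((\<lambda>z. snd (?H z) \<bullet> e) has_derivative (\<lambda>u. snd z \<bullet>
        fderiv (\<lambda>y. fderiv G y e) (F q) (fderiv F q (fst u)) + snd u \<bullet> fderiv G (F (fst z)) e)) (at z)"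
      by (rule has_derivative_transform_within_open[OF _ oS z])
        (use inner_covector_lift[OF inv] in auto)
    moreover have "((\<lambda>z. snd (?H z) \<bullet> e) has_derivative (\<lambda>u. snd (fderiv ?H z u) \<bullet> e)) (at z)"
      by (intro has_derivative_inner_left has_derivative_snd H)
    ultimately have "(\<lambda>u. snd z \<bullet> fderiv (\<lambda>y. fderiv G y e) (F q) (fderiv F q (fst u)) +
        snd u \<bullet> fderiv G (F (fst z)) e) = (\<lambda>u. snd (fderiv ?H z u) \<bullet> e)"
      by (rule has_derivative_unique)
    from fun_cong[OF this, of w, symmetric] show ?thesis by (simp add: zw)
  qed
  let ?c = "covector_lift (tangent_lift F) (tangent_lift G) ((q, q'), (p', p))"
  have tF: "tangent_lift F (q, q') = (F q, fderiv F q q')" by (simp add: tangent_lift_def)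
  have "snd ?c \<bullet> (e, f) = (snd (fderiv ?H z w), snd (?H z)) \<bullet> (e, f)" for e f
  proof -
    have "snd ?c \<bullet> (e, f) = (p', p) \<bullet> fderiv (tangent_lift G) (tangent_lift F (q, q')) (e, f)"
      by (rule inner_covector_lift[OF smooth_inverses_tangent_lift[OF inv]]) (use q in auto)
    also have "\<dots> = p' \<bullet> fderiv G (F q) e +
        p \<bullet> (fderiv (\<lambda>z. fderiv G z (fderiv F q q')) (F q) e + fderiv G (F q) f)"
      unfolding tF fderiv_tangent_lift[OF D(2,4) D(5)[OF q]] by simp
    \<comment> \<open>The two sides differ only in the order of differentiation: the tangent lift
      differentiates along the velocity first, the covector lift along the test vector
      \<open>e\<close> first.\<close>
    also have "fderiv (\<lambda>z. fderiv G z (fderiv F q q')) (F q) e = fderiv (\<lambda>y. fderiv G y e) (F q) (fderiv F q q')"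
      by (rule second_fderiv_symmetric[OF D(2,4) D(5)[OF q]])
    finally show ?thesis
      using snd[of e] inner_covector_lift[OF inv q, of p f] by (simp add: zw inner_right_distrib)
  qed
  then have "snd ?c = (snd (fderiv ?H z w), snd (?H z))"
    by (metis euclidean_eqI prod.collapse)
  moreover have "fst ?c = (F q, fderiv F q q')" by (simp add: covector_lift_def tF)
  ultimately have "?c = ((F q, fderiv F q q'), (snd (fderiv ?H z w), snd (?H z)))"
    by (metis prod.collapse)
  then show ?thesis
    using fst[of w] by (simp add: zw interchange_def tangent_lift_def case_prod_beta)
      (simp add: covector_lift_def)
qed

section \<open>Charts, tangent vectors and smooth maps\<close>

text \<open>Charts are pairs; these rules would split every bound chart variable into its components.\<close>

declare split_paired_All [simp del] split_paired_Ex [simp del]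

lemma charts_at_iff: "c \<in> charts_at M x \<longleftrightarrow> c \<in> M \<and> x \<in> cdom c"
  by (simp add: charts_at_def)

lemma points_iff: "x \<in> points M \<longleftrightarrow> (\<exists>c. c \<in> charts_at M x)"
  unfolding points_def charts_at_def by blast

lemma chart_at_in: "x \<in> points M \<Longrightarrow> chart_at M x \<in> charts_at M x"
  unfolding chart_at_def points_iff by (rule someI_ex)

lemma smooth_atlasD:
  assumes "smooth_atlas M" "c \<in> M"
  shows "inj_on (cmap c) (cdom c)" "open (cmap c ` cdom c)"
    "d \<in> M \<Longrightarrow> open (cmap c ` (cdom c \<inter> cdom d))"
    "d \<in> M \<Longrightarrow> smooth_on (cmap c ` (cdom c \<inter> cdom d)) (transition c d)"
  using assms by (auto simp: smooth_atlas_def)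

lemma cinv_cmap: "smooth_atlas M \<Longrightarrow> c \<in> M \<Longrightarrow> x \<in> cdom c \<Longrightarrow> cinv c (cmap c x) = x"
  by (simp add: cinv_def smooth_atlasD(1))

lemma cmap_cinv: "y \<in> cmap c ` cdom c \<Longrightarrow> cmap c (cinv c y) = y"
  by (simp add: cinv_def f_inv_into_f)

lemma cinv_in: "y \<in> cmap c ` cdom c \<Longrightarrow> cinv c y \<in> cdom c"
  by (simp add: cinv_def inv_into_into)

lemma transition_cmap:
  "smooth_atlas M \<Longrightarrow> c \<in> M \<Longrightarrow> x \<in> cdom c \<Longrightarrow> transition c d (cmap c x) = cmap d x"
  by (simp add: transition_def cinv_cmap)

lemma smooth_inverses_transition:
  assumes "smooth_atlas M" "c \<in> M" "d \<in> M"
  shows "smooth_inverses (cmap c ` (cdom c \<inter> cdom d)) (cmap d ` (cdom c \<inter> cdom d))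
    (transition c d) (transition d c)"
  using smooth_atlasD(3,4)[OF assms(1,2,3)] smooth_atlasD(3,4)[OF assms(1,3,2)]
  by (auto simp: smooth_inverses_def Int_commute transition_cmap[OF assms(1)] assms)

lemma cmap_in_overlap:
  "c \<in> charts_at M x \<Longrightarrow> d \<in> charts_at M x \<Longrightarrow> cmap c x \<in> cmap c ` (cdom c \<inter> cdom d)"
  by (auto simp: charts_at_iff)

lemma transition_differentiable:
  assumes "smooth_atlas M" "c \<in> charts_at M x" "d \<in> charts_at M x"
  shows "transition c d differentiable (at (cmap c x))"
  using smooth_on_differentiable[OF smooth_atlasD(4)[of M c d] cmap_in_overlap[OF assms(2,3)]] assms
  by (simp add: charts_at_iff)

text \<open>Chain rule on the triple overlap \<open>?S\<close>. This cocycle identity is what makes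
  \<open>tvec_of\<close> a consistent family of components.\<close>

lemma fderiv_transition_trans:
  assumes M: "smooth_atlas M"
    and c: "c \<in> charts_at M x" "d \<in> charts_at M x" "e \<in> charts_at M x"
  shows "fderiv (transition d e) (cmap d x) (fderiv (transition c d) (cmap c x) w) =
    fderiv (transition c e) (cmap c x) w"
proof -
  note c' = c[unfolded charts_at_iff]
  have x: "transition c d (cmap c x) = cmap d x"
    using transition_cmap[OF M] c' by blast
  let ?S = "cmap c ` (cdom c \<inter> cdom d) \<inter> cmap c ` (cdom c \<inter> cdom e)"
  have "fderiv (\<lambda>y. transition d e (transition c d y)) (cmap c x) = fderiv (transition c e) (cmap c x)"
  proof (rule fderiv_cong[of ?S])
    show "open ?S" using c' by (intro open_Int smooth_atlasD(3)[OF M]) simp_all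
    show "cmap c x \<in> ?S" using cmap_in_overlap[OF c(1,2)] cmap_in_overlap[OF c(1,3)] by simp
    show "(\<lambda>y. transition d e (transition c d y)) differentiable (at (cmap c x))"
      using differentiable_chain_at[OF transition_differentiable[OF M c(1,2)], of "transition d e"]
        transition_differentiable[OF M c(2,3)] x by (simp add: o_def)
    fix y assume "y \<in> ?S"
    then obtain z z' where "y = cmap c z" "z \<in> cdom c \<inter> cdom d" "y = cmap c z'" "z' \<in> cdom c \<inter> cdom e"
      by blast
    moreover from this have "z = z'"
      using inj_onD[OF smooth_atlasD(1)[OF M], of c z z'] c' by auto
    ultimately show "transition d e (transition c d y) = transition c e y"
      using transition_cmap[OF M] c' by simp
  qed
  then show ?thesis
    using fderiv_compose[OF _ transition_differentiable[OF M c(1,2)], of "transition d e" w]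
      transition_differentiable[OF M c(2,3)] x by simp
qed

lemma fderiv_transition_refl:
  assumes M: "smooth_atlas M" and c: "c \<in> charts_at M x"
  shows "fderiv (transition c c) (cmap c x) w = w"
proof -
  have "fderiv (\<lambda>y. y) (cmap c x) = fderiv (transition c c) (cmap c x)"
    by (rule fderiv_cong[of "cmap c ` cdom c"])
      (use c smooth_atlasD(2)[OF M, of c] transition_cmap[OF M, of c _ c] in \<open>auto simp: charts_at_iff\<close>)
  then show ?thesis by (simp add: fun_eq_iff)
qed

lemma tvec_of_in_tspace:
  assumes "smooth_atlas M" "c \<in> charts_at M x"
  shows "tvec_of M c x w \<in> tspace M x"
  unfolding tspace_def mem_Collect_eq
  by (auto simp: tvec_of_def fderiv_transition_trans[OF assms])

lemma tvec_of_apply: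
  assumes "smooth_atlas M" "c \<in> charts_at M x"
  shows "tvec_of M c x w c = w"
  using assms by (simp add: tvec_of_def fderiv_transition_refl)

lemma tspace_change:
  "v \<in> tspace M x \<Longrightarrow> c \<in> charts_at M x \<Longrightarrow> d \<in> charts_at M x \<Longrightarrow>
    v d = fderiv (transition c d) (cmap c x) (v c)"
  unfolding tspace_def mem_Collect_eq by blast

lemma tspace_outside: "v \<in> tspace M x \<Longrightarrow> c \<notin> charts_at M x \<Longrightarrow> v c = 0"
  by (auto simp: tspace_def)

text \<open>One component determines a tangent vector: the transition Jacobians give the others, and
  charts away from \<open>x\<close> carry 0.\<close>

lemma tspace_eqI:
  assumes "v \<in> tspace M x" "w \<in> tspace M x" "c \<in> charts_at M x" "v c = w c"
  shows "v = w"
proof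
  fix d
  show "v d = w d"
    using assms by (cases "d \<in> charts_at M x")
      (simp_all add: tspace_change[of _ _ _ c d] tspace_outside)
qed

lemma tvec_of_eq:
  assumes "smooth_atlas M" "v \<in> tspace M x" "c \<in> charts_at M x"
  shows "tvec_of M c x (v c) = v"
  using tspace_eqI[OF tvec_of_in_tspace[OF assms(1,3)] assms(2,3) tvec_of_apply[OF assms(1,3)]] .

lemma tvec_of_linear:
  assumes "smooth_atlas M" "c \<in> charts_at M x"
  shows "tvec_of M c x (a *\<^sub>R u + b *\<^sub>R w) = (\<lambda>d. a *\<^sub>R tvec_of M c x u d + b *\<^sub>R tvec_of M c x w d)"
proof
  fix d
  have "linear (fderiv (transition c d) (cmap c x))" if "d \<in> charts_at M x"
    using linear_fderiv[OF transition_differentiable[OF assms that]] .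
  then show "tvec_of M c x (a *\<^sub>R u + b *\<^sub>R w) d = a *\<^sub>R tvec_of M c x u d + b *\<^sub>R tvec_of M c x w d"
    by (simp add: tvec_of_def linear_add linear_cmul)
qed

lemma tspace_zero:
  assumes "smooth_atlas M"
  shows "(\<lambda>_. 0) \<in> tspace M x"
  by (simp add: tspace_def linear_0[OF linear_fderiv[OF transition_differentiable[OF assms]]])

section \<open>Open subsets of a manifold\<close>

lemma mopen_chart_image: "mopen M W \<Longrightarrow> c \<in> M \<Longrightarrow> open (cmap c ` (W \<inter> cdom c))"
  by (simp add: mopen_def)

lemma cmap_image_Int:
  assumes "smooth_atlas M" "c \<in> M" "y \<in> cmap c ` (A \<inter> cdom c)"
  shows "cinv c y \<in> A" "cinv c y \<in> cdom c" "cmap c (cinv c y) = y"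
proof -
  from assms(3) obtain x where "y = cmap c x" "x \<in> A" "x \<in> cdom c" by blast
  then show "cinv c y \<in> A" "cinv c y \<in> cdom c" "cmap c (cinv c y) = y"
    using cinv_cmap[OF assms(1,2)] by simp_all
qed

text \<open>Seen from another chart \<open>d\<close>, the set is the preimage of \<open>S\<close>
  under a transition map, which is continuous on an open overlap.\<close>

lemma mopen_cinv_image:
  assumes M: "smooth_atlas M" and c: "c \<in> M" and S: "open S" "S \<subseteq> cmap c ` cdom c"
  shows "mopen M (cinv c ` S)"
  unfolding mopen_def
proof (intro conjI ballI)
  show "cinv c ` S \<subseteq> points M"
    using S(2) c cinv_in[of _ c] unfolding points_def by blast
  fix d assume d: "d \<in> M"
  have "cmap d ` (cinv c ` S \<inter> cdom d) =
    cmap d ` (cdom d \<inter> cdom c) \<inter> transition d c -` S" (is "?L = ?R")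
  proof
    show "?L \<subseteq> ?R"
    proof
      fix y assume "y \<in> ?L"
      then obtain s where s: "s \<in> S" "cinv c s \<in> cdom d" "y = cmap d (cinv c s)" by blast
      moreover from this have "cinv c s \<in> cdom c" "cmap c (cinv c s) = s"
        using S(2) cinv_in[of s c] cmap_cinv[of s c] by auto
      ultimately show "y \<in> ?R" using transition_cmap[OF M d] by auto
    qed
    show "?R \<subseteq> ?L"
    proof
      fix y assume "y \<in> ?R"
      then obtain x where x: "x \<in> cdom d" "x \<in> cdom c" "y = cmap d x" "cmap c x \<in> S"
        using transition_cmap[OF M d, of _ c] by auto
      then have "x \<in> cinv c ` S" using cinv_cmap[OF M c] by force
      then show "y \<in> ?L" using x by blast
    qed
  qed
  then show "open (cmap d ` (cinv c ` S \<inter> cdom d))"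
    using continuous_open_preimage[OF smooth_on_continuous[OF smooth_atlasD(4)[OF M d c]]
        smooth_atlasD(3)[OF M d c] S(1)] by simp
qed

lemma mopen_Union:
  assumes "\<And>W. W \<in> \<W> \<Longrightarrow> mopen M W"
  shows "mopen M (\<Union>\<W>)"
proof -
  have e: "cmap c ` (\<Union>\<W> \<inter> cdom c) = (\<Union>W\<in>\<W>. cmap c ` (W \<inter> cdom c))" for c :: "('a, 'b) chart"
    by blast
  show ?thesis using assms unfolding mopen_def e by blast
qed

text \<open>\<open>mopen\<close> tests a set in every chart. One chart around each point suffices,
  because a union of sets obtained by \<open>mopen_cinv_image\<close> is open in all charts.\<close>

lemma mopenI_local:
  assumes "smooth_atlas M"
    and "\<And>x. x \<in> W \<Longrightarrow> \<exists>c\<in>charts_at M x. \<exists>S. open S \<and> cmap c x \<in> S \<and> S \<subseteq> cmap c ` (W \<inter> cdom c)"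
  shows "mopen M W"
proof -
  have "\<exists>V. x \<in> V \<and> V \<subseteq> W \<and> mopen M V" if x: "x \<in> W" for x
  proof -
    from assms(2)[OF x] obtain c S where "c \<in> charts_at M x"
      and S: "open S" "cmap c x \<in> S" "S \<subseteq> cmap c ` (W \<inter> cdom c)"
      by blast
    then have c: "c \<in> M" "x \<in> cdom c" by (auto simp: charts_at_iff)
    have "x \<in> cinv c ` S" using S(2) cinv_cmap[OF assms(1) c] by force
    moreover have "cinv c ` S \<subseteq> W" using S(3) cmap_image_Int(1)[OF assms(1) c(1)] by blast
    moreover have "mopen M (cinv c ` S)" using S by (intro mopen_cinv_image assms(1) c(1)) auto
    ultimately show ?thesis by blast
  qed
  then have "W = \<Union>{V. V \<subseteq> W \<and> mopen M V}" by blast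
  then show ?thesis using mopen_Union[of "{V. V \<subseteq> W \<and> mopen M V}" M] by simp
qed

lemma mopen_points: "smooth_atlas M \<Longrightarrow> mopen M (points M)"
  unfolding mopen_def
proof (intro conjI ballI)
  fix c assume "smooth_atlas M" "c \<in> M"
  moreover have "points M \<inter> cdom c = cdom c" using \<open>c \<in> M\<close> by (auto simp: points_def)
  ultimately show "open (cmap c ` (points M \<inter> cdom c))" using smooth_atlasD(2) by metis
qed simp

section \<open>Smooth maps read in arbitrary charts\<close>

abbreviation (input) local_rep :: "('a \<Rightarrow> 'b) \<Rightarrow> ('a, 'e) chart \<Rightarrow> ('b, 'f) chart \<Rightarrow> 'e \<Rightarrow> 'f" where
  "local_rep F c d \<equiv> \<lambda>y. snd d (F (cinv c y))"

text \<open>\<open>smooth_map\<close> grants one suitable pair of charts at each point. Composing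
  the local representative with transitions on both sides, on a smaller domain, transfers smoothness
  to any prescribed pair.\<close>

lemma smooth_mapE:
  assumes M: "smooth_atlas M" and N: "smooth_atlas N" and F: "smooth_map M N W F" and x: "x \<in> W"
    and c: "c \<in> charts_at M x" and d: "d \<in> charts_at N (F x)"
  obtains S where "open S" "cmap c x \<in> S" "S \<subseteq> cmap c ` (W \<inter> cdom c)"
    "\<And>y. y \<in> S \<Longrightarrow> F (cinv c y) \<in> cdom d" "smooth_on S (local_rep F c d)"
proof -
  from F x obtain a b S0 where a: "a \<in> charts_at M x" and b: "b \<in> charts_at N (F x)"
    and S0: "open S0" "cmap a x \<in> S0" "S0 \<subseteq> cmap a ` (W \<inter> cdom a)"
      "F ` cinv a ` S0 \<subseteq> cdom b" "smooth_on S0 (local_rep F a b)"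
    unfolding smooth_map_def by meson
  note in' = a[unfolded charts_at_iff] b[unfolded charts_at_iff] c[unfolded charts_at_iff] d[unfolded charts_at_iff]
  \<comment> \<open>\<open>S1\<close> keeps the coordinates whose image under \<open>F\<close> also
    lies in the new target chart \<open>d\<close>; \<open>S\<close> carries \<open>S1\<close> over
    to the new source chart \<open>c\<close>.\<close>
  define S1 where "S1 = S0 \<inter> local_rep F a b -` (cmap b ` (cdom b \<inter> cdom d))"
  define S where "S = cmap c ` (cdom c \<inter> cdom a) \<inter> transition c a -` S1"
  have "open S1"
    unfolding S1_def using in' by (intro continuous_open_preimage smooth_on_continuous S0 smooth_atlasD(3)[OF N]) auto
  then have "open S"
    unfolding S_def using in' by (intro continuous_open_preimage smooth_on_continuous smooth_atlasD(3,4)[OF M]) auto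
  have "cmap a x \<in> S1"
    using in' S0(2) cinv_cmap[OF M, of a x] by (auto simp: S1_def)
  then have xS: "cmap c x \<in> S"
    using in' transition_cmap[OF M, of c x a] by (auto simp: S_def)
  have *: "cinv c y \<in> W \<and> cinv c y \<in> cdom c \<and> cinv c y \<in> cdom a \<and> cmap c (cinv c y) = y \<and> F (cinv c y) \<in> cdom d
    \<and> F (cinv c y) \<in> cdom b \<and> transition c a y = cmap a (cinv c y)" if "y \<in> S" for y
  proof -
    from that obtain z where z: "z \<in> cdom c" "z \<in> cdom a" "y = cmap c z" "cmap a z \<in> S1"
      using in' transition_cmap[OF M, of c _ a] by (auto simp: S_def)
    have zy: "cinv c y = z" "cinv a (cmap a z) = z" using z in' cinv_cmap[OF M] by auto
    have "z \<in> W" using z(4) S0(3) cmap_image_Int(1)[OF M, of a "cmap a z" W] in' zy by (auto simp: S1_def)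
    moreover have Fb: "F z \<in> cdom b" using z(4) S0(4) zy(2) by (force simp: S1_def)
    moreover have "cmap b (F z) \<in> cmap b ` (cdom b \<inter> cdom d)" using z(4) zy by (simp add: S1_def)
    then have "F z \<in> cdom d"
      using inj_on_image_mem_iff[OF smooth_atlasD(1)[OF N], of b "F z" "cdom b \<inter> cdom d"] Fb in' by auto
    ultimately show ?thesis using zy z transition_cmap[OF M] in' by auto
  qed
  have "smooth_on S (\<lambda>y. transition b d (local_rep F a b (transition c a y)))"
  proof (rule smooth_on_compose[where T = S1])
    show "smooth_on S1 (\<lambda>y. transition b d (local_rep F a b y))"
      by (rule smooth_on_compose[OF smooth_atlasD(4)[OF N] smooth_on_subset[OF S0(5)] \<open>open S1\<close>])
        (use in' smooth_atlasD(3)[OF N] in \<open>auto simp: S1_def\<close>)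
    show "smooth_on S (transition c a)"
      using smooth_atlasD(4)[OF M, of c a] in' by (auto simp: S_def intro: smooth_on_subset)
  qed (use \<open>open S\<close> \<open>open S1\<close> in \<open>auto simp: S_def\<close>)
  then have "smooth_on S (local_rep F c d)"
  proof (rule smooth_on_cong[OF \<open>open S\<close>])
    fix y assume "y \<in> S"
    note y = *[OF this]
    have "cinv a (transition c a y) = cinv c y" using y cinv_cmap[OF M] in' by simp
    then show "transition b d (local_rep F a b (transition c a y)) = local_rep F c d y"
      using transition_cmap[OF N] in' y by simp
  qed
  moreover have "S \<subseteq> cmap c ` (W \<inter> cdom c)" using * by force
  ultimately show thesis using that \<open>open S\<close> xS * by blast
qed

text \<open>The formula \<open>f\<close> may live on a set \<open>S\<close> larger than the chart
  image, for instance \<open>UNIV\<close>; intersecting with the open chart image of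
  \<open>W\<close> restores the domain that \<open>smooth_map\<close> asks for.\<close>

lemma smooth_mapI:
  assumes M: "smooth_atlas M" and W: "mopen M W"
    and ex: "\<And>x. x \<in> W \<Longrightarrow> \<exists>c\<in>charts_at M x. \<exists>d\<in>N. \<exists>S f. open S \<and> cmap c x \<in> S \<and> smooth_on S f \<and>
      (\<forall>z\<in>W \<inter> cdom c. cmap c z \<in> S \<longrightarrow> F z \<in> cdom d \<and> cmap d (F z) = f (cmap c z))"
  shows "smooth_map M N W F"
  unfolding smooth_map_def
proof
  fix x assume x: "x \<in> W"
  from ex[OF this] obtain c d S f where c: "c \<in> charts_at M x" and d: "d \<in> N"
    and S: "open S" "cmap c x \<in> S" "smooth_on S f"
      "\<And>z. z \<in> W \<Longrightarrow> z \<in> cdom c \<Longrightarrow> cmap c z \<in> S \<Longrightarrow> F z \<in> cdom d \<and> cmap d (F z) = f (cmap c z)"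
    by (metis IntI)
  have c': "c \<in> M" "x \<in> cdom c" using c by (auto simp: charts_at_iff)
  let ?S = "S \<inter> cmap c ` (W \<inter> cdom c)"
  have o: "open ?S" using S(1) mopen_chart_image[OF W c'(1)] by blast
  have *: "F (cinv c y) \<in> cdom d \<and> cmap d (F (cinv c y)) = f y" if "y \<in> ?S" for y
    using that S(4)[of "cinv c y"] cmap_image_Int[OF M c'(1), of y W] by auto
  have "smooth_on ?S (local_rep F c d)"
    by (rule smooth_on_cong[OF o smooth_on_subset[OF S(3)]]) (use * in auto)
  moreover have "d \<in> charts_at N (F x)" using S(4)[OF x c'(2) S(2)] d by (simp add: charts_at_iff)
  moreover have "cmap c x \<in> ?S" using S(2) x c'(2) by blast
  moreover have "F ` cinv c ` ?S \<subseteq> cdom d" using * by blast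
  ultimately show "\<exists>c\<in>charts_at M x. \<exists>d\<in>charts_at N (F x). \<exists>S. open S \<and> cmap c x \<in> S \<and>
      S \<subseteq> cmap c ` (W \<inter> cdom c) \<and> F ` cinv c ` S \<subseteq> cdom d \<and> smooth_on S (local_rep F c d)"
    using c o by blast
qed

lemma smooth_map_points:
  assumes "smooth_map M N W F" "x \<in> W"
  shows "x \<in> points M" "F x \<in> points N"
  using assms unfolding smooth_map_def points_iff by blast+

lemma smooth_map_mopen: "smooth_atlas M \<Longrightarrow> smooth_map M N W F \<Longrightarrow> mopen M W"
  unfolding smooth_map_def by (rule mopenI_local) blast+

lemma smooth_map_cong:
  assumes M: "smooth_atlas M" and F: "smooth_map M N W F" and V: "mopen M V" "V \<subseteq> W"
    and eq: "\<And>x. x \<in> V \<Longrightarrow> F x = G x"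
  shows "smooth_map M N V G"
proof (rule smooth_mapI[OF M V(1)])
  fix x assume x: "x \<in> V"
  with F V(2) obtain c d S where c: "c \<in> charts_at M x" and d: "d \<in> charts_at N (F x)"
    and S: "open S" "cmap c x \<in> S" "F ` cinv c ` S \<subseteq> cdom d" "smooth_on S (local_rep F c d)"
    unfolding smooth_map_def by blast
  have "G z \<in> cdom d \<and> cmap d (G z) = local_rep F c d (cmap c z)"
    if "z \<in> V" "z \<in> cdom c" "cmap c z \<in> S" for z
  proof -
    have "cinv c (cmap c z) = z" using cinv_cmap[OF M _ that(2)] c by (simp add: charts_at_iff)
    moreover from this have "F z \<in> cdom d" using S(3) that(3) by (metis image_eqI subsetD)
    ultimately show ?thesis using eq[OF that(1)] by simp
  qed
  then show "\<exists>c\<in>charts_at M x. \<exists>d\<in>N. \<exists>S f. open S \<and> cmap c x \<in> S \<and> smooth_on S f \<and>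
      (\<forall>z\<in>V \<inter> cdom c. cmap c z \<in> S \<longrightarrow> G z \<in> cdom d \<and> cmap d (G z) = f (cmap c z))"
    using c d S
    by (intro bexI[of _ c] bexI[of _ d] exI[of _ S] exI[of _ "local_rep F c d"])
      (auto simp: charts_at_iff)
qed

lemma smooth_map_compose:
  assumes M: "smooth_atlas M" and N: "smooth_atlas N" and P: "smooth_atlas P"
    and F: "smooth_map M N W F" and G: "smooth_map N P W' G" and sub: "F ` W \<subseteq> W'"
  shows "smooth_map M P W (G \<circ> F)"
proof (rule smooth_mapI[OF M smooth_map_mopen[OF M F]])
  fix x assume x: "x \<in> W"
  then have FW: "F x \<in> W'" using sub by blast
  obtain c where c: "c \<in> charts_at M x" using smooth_map_points[OF F x] points_iff by metis
  obtain d where d: "d \<in> charts_at N (F x)" using smooth_map_points[OF F x] points_iff by metis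
  obtain e where e: "e \<in> charts_at P (G (F x))" using smooth_map_points[OF G FW] points_iff by metis
  obtain S where S: "open S" "cmap c x \<in> S" "S \<subseteq> cmap c ` (W \<inter> cdom c)"
    "\<And>y. y \<in> S \<Longrightarrow> F (cinv c y) \<in> cdom d" "smooth_on S (local_rep F c d)"
    using smooth_mapE[OF M N F x c d] by blast
  obtain T where T: "open T" "cmap d (F x) \<in> T" "T \<subseteq> cmap d ` (W' \<inter> cdom d)"
    "\<And>y. y \<in> T \<Longrightarrow> G (cinv d y) \<in> cdom e" "smooth_on T (local_rep G d e)"
    using smooth_mapE[OF N P G FW d e] by blast
  note in' = c[unfolded charts_at_iff] d[unfolded charts_at_iff] e[unfolded charts_at_iff]
  let ?S = "S \<inter> local_rep F c d -` T"
  have o: "open ?S" by (intro continuous_open_preimage smooth_on_continuous S T)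
  have "cmap c x \<in> ?S" using S(2) T(2) cinv_cmap[OF M] in' by simp
  moreover have "smooth_on ?S (\<lambda>y. local_rep G d e (local_rep F c d y))"
    by (rule smooth_on_compose[OF T(5) smooth_on_subset[OF S(5)] o T(1)]) auto
  moreover have "(G \<circ> F) z \<in> cdom e \<and> cmap e ((G \<circ> F) z) = local_rep G d e (local_rep F c d (cmap c z))"
    if "z \<in> W \<inter> cdom c" "cmap c z \<in> ?S" for z
  proof -
    have "cinv c (cmap c z) = z" using that in' cinv_cmap[OF M] by blast
    moreover from this have "cinv d (cmap d (F z)) = F z"
      using that S(4)[of "cmap c z"] in' cinv_cmap[OF N, of d "F z"] by auto
    ultimately show ?thesis using T(4)[of "cmap d (F z)"] that(2) by auto
  qed
  ultimately show "\<exists>c\<in>charts_at M x. \<exists>d\<in>P. \<exists>S f. open S \<and> cmap c x \<in> S \<and> smooth_on S f \<and>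
      (\<forall>z\<in>W \<inter> cdom c. cmap c z \<in> S \<longrightarrow> (G \<circ> F) z \<in> cdom d \<and> cmap d ((G \<circ> F) z) = f (cmap c z))"
    using c in' o
    by (intro bexI[of _ c] bexI[of _ e] exI[of _ "S \<inter> local_rep F c d -` T"]
        exI[of _ "\<lambda>y. local_rep G d e (local_rep F c d y)"]) (blast | simp)+
qed

section \<open>Diffeomorphisms and tangent maps\<close>

text \<open>\<open>diffeo_on\<close> concerns \<open>inv_into W F\<close>, which agrees with a given
  inverse \<open>G\<close> on \<open>W'\<close>; smoothness is transferred by that
  agreement.\<close>

lemma diffeo_onI:
  assumes M: "smooth_atlas M" and N: "smooth_atlas N"
    and F: "smooth_map M N W F" and G: "smooth_map N M W' G"
    and FW: "\<And>x. x \<in> W \<Longrightarrow> F x \<in> W'" "\<And>x. x \<in> W \<Longrightarrow> G (F x) = x"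
    and GW: "\<And>y. y \<in> W' \<Longrightarrow> G y \<in> W" "\<And>y. y \<in> W' \<Longrightarrow> F (G y) = y"
  shows "diffeo_on M N W F"
proof -
  have im: "F ` W = W'" using FW(1) GW by force
  have inj: "inj_on F W" using FW(2) by (metis inj_onI)
  have "smooth_map N M W' (inv_into W F)"
    using GW by (intro smooth_map_cong[OF N G smooth_map_mopen[OF N G]])
      (auto intro!: inv_into_f_eq[OF inj, symmetric])
  then show ?thesis
    unfolding diffeo_on_def im using F inj smooth_map_mopen[OF M F] smooth_map_mopen[OF N G] by blast
qed

lemma diffeo_onD:
  assumes "diffeo_on M N W F"
  shows "mopen M W" "smooth_map M N W F" "inj_on F W" "mopen N (F ` W)"
    "smooth_map N M (F ` W) (inv_into W F)"
  using assms by (auto simp: diffeo_on_def)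

lemma diffeo_on_inverse:
  assumes "smooth_atlas M" "smooth_atlas N" "diffeo_on M N W F"
  shows "diffeo_on N M (F ` W) (inv_into W F)"
  using diffeo_onD(2,3,5)[OF assms(3)]
  by (intro diffeo_onI[OF assms(2,1), of _ _ W F]) (auto simp: f_inv_into_f)

lemma diffeo_on_subset:
  assumes M: "smooth_atlas M" and N: "smooth_atlas N" and F: "diffeo_on M N W F"
    and V: "mopen M V" "V \<subseteq> W"
  shows "diffeo_on M N V F"
proof -
  note D = diffeo_onD[OF F]
  have FV: "smooth_map M N V F" by (rule smooth_map_cong[OF M D(2) V]) simp
  have "mopen N (F ` V)"
  proof (rule mopenI_local[OF N])
    fix y assume "y \<in> F ` V"
    then obtain x where x: "y = F x" "x \<in> V" by blast
    then have yW: "y \<in> F ` W" and inv: "inv_into W F y = x"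
      using V(2) inv_into_f_f[OF D(3)] by auto
    obtain c where c: "c \<in> charts_at M x" using V(1) x(2) unfolding mopen_def points_iff by (metis points_iff subsetD)
    obtain d where d: "d \<in> charts_at N y" using smooth_map_points(1)[OF D(5) yW] points_iff by metis
    have d': "d \<in> N" "y \<in> cdom d" and c': "c \<in> M" "x \<in> cdom c" using c d by (auto simp: charts_at_iff)
    obtain S where S: "open S" "cmap d y \<in> S" "S \<subseteq> cmap d ` (F ` W \<inter> cdom d)"
      "\<And>s. s \<in> S \<Longrightarrow> inv_into W F (cinv d s) \<in> cdom c"
      "smooth_on S (local_rep (inv_into W F) d c)"
      using smooth_mapE[OF N M D(5) yW d, of c] c inv by metis
    \<comment> \<open>The coordinates of target points whose preimage under \<open>F\<close> lies in
      \<open>V\<close>, open as a preimage under a continuous local representative.\<close>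
    let ?S = "S \<inter> local_rep (inv_into W F) d c -` (cmap c ` (V \<inter> cdom c))"
    have "open ?S"
      by (intro continuous_open_preimage smooth_on_continuous S mopen_chart_image[OF V(1) c'(1)])
    moreover have "cmap d y \<in> ?S"
      using S(2) cinv_cmap[OF N d'] inv x c' by simp
    moreover have "?S \<subseteq> cmap d ` (F ` V \<inter> cdom d)"
    proof
      fix s assume s: "s \<in> ?S"
      let ?x = "inv_into W F (cinv d s)"
      have sd: "cinv d s \<in> F ` W" "cinv d s \<in> cdom d" "cmap d (cinv d s) = s"
        using s S(3) cmap_image_Int[OF N d'(1), of s "F ` W"] by auto
      have "?x \<in> cdom c" using s S(4) by blast
      then have "?x \<in> V"
        using s inj_on_image_mem_iff[OF smooth_atlasD(1)[OF M c'(1)], of ?x "V \<inter> cdom c"] by auto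
      then have "cinv d s \<in> F ` V" using f_inv_into_f[OF sd(1)] by (metis imageI)
      then show "s \<in> cmap d ` (F ` V \<inter> cdom d)" using sd by (metis IntI imageI)
    qed
    ultimately show "\<exists>d\<in>charts_at N y. \<exists>S. open S \<and> cmap d y \<in> S \<and> S \<subseteq> cmap d ` (F ` V \<inter> cdom d)"
      using d by blast
  qed
  moreover have "F ` V \<subseteq> F ` W" using V(2) by blast
  ultimately have "smooth_map N M (F ` V) (inv_into W F)"
    by (intro smooth_map_cong[OF N D(5)]) simp_all
  then show ?thesis
    using V(2) inv_into_f_f[OF D(3)] by (intro diffeo_onI[OF M N FV]) (auto simp: subset_iff)
qed

lemma diffeo_on_compose:
  assumes M: "smooth_atlas M" and N: "smooth_atlas N" and P: "smooth_atlas P"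
    and F: "diffeo_on M N W F" and G: "diffeo_on N P (F ` W) G"
  shows "diffeo_on M P W (G \<circ> F)"
proof -
  note D = diffeo_onD[OF F] and E = diffeo_onD[OF G]
  show ?thesis
  proof (rule diffeo_onI[OF M P])
    show "smooth_map M P W (G \<circ> F)"
      by (rule smooth_map_compose[OF M N P D(2) E(2)]) simp
    show "smooth_map P M (G ` F ` W) (inv_into W F \<circ> inv_into (F ` W) G)"
      by (rule smooth_map_compose[OF P N M E(5) D(5)]) (auto simp: inv_into_into)
  qed (use D(3) E(3) in \<open>auto simp: inv_into_into\<close>)
qed

text \<open>Frees \<open>tmap\<close> from the arbitrary \<open>chart_at\<close>: the Jacobian
  between the chosen chart and \<open>c\<close> is absorbed by the transformation law of the
  components of \<open>v\<close>.\<close>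

lemma tmap_local_rep:
  assumes M: "smooth_atlas M" and N: "smooth_atlas N" and F: "smooth_map M N W F" and x: "x \<in> W"
    and v: "v \<in> tspace M x" and c: "c \<in> charts_at M x" and d: "d \<in> charts_at N (F x)"
  shows "tmap M N F x v d = fderiv (local_rep F c d) (cmap c x) (v c)"
proof -
  let ?a = "chart_at M x"
  have a: "?a \<in> charts_at M x" by (rule chart_at_in[OF smooth_map_points(1)[OF F x]])
  note in' = a[unfolded charts_at_iff] c[unfolded charts_at_iff]
  obtain S where S: "open S" "cmap ?a x \<in> S" "smooth_on S (local_rep F ?a d)"
    using smooth_mapE[OF M N F x a d] by metis
  obtain S' where S': "open S'" "cmap c x \<in> S'" "smooth_on S' (local_rep F c d)"
    using smooth_mapE[OF M N F x c d] by metis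
  have d1: "local_rep F ?a d differentiable (at (cmap ?a x))"
    using smooth_on_differentiable S by blast
  have d2: "local_rep F c d differentiable (at (cmap c x))"
    using smooth_on_differentiable S' by blast
  have t: "transition ?a c (cmap ?a x) = cmap c x"
    using transition_cmap[OF M] in' by blast
  have "fderiv (local_rep F ?a d) (cmap ?a x) =
    fderiv (\<lambda>y. local_rep F c d (transition ?a c y)) (cmap ?a x)"
  proof (rule fderiv_cong[of "cmap ?a ` (cdom ?a \<inter> cdom c)", OF _ cmap_in_overlap[OF a c] d1])
    show "open (cmap ?a ` (cdom ?a \<inter> cdom c))" using smooth_atlasD(3)[OF M] in' by blast
    show "local_rep F ?a d y = local_rep F c d (transition ?a c y)"
      if "y \<in> cmap ?a ` (cdom ?a \<inter> cdom c)" for y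
      using that in' by (auto simp: transition_cmap[OF M] cinv_cmap[OF M])
  qed
  then have "tmap M N F x v d = fderiv (local_rep F c d) (cmap c x) (fderiv (transition ?a c) (cmap ?a x) (v ?a))"
    using fderiv_compose[OF _ transition_differentiable[OF M a c], of "local_rep F c d"] d2 t d
    by (simp add: tmap_def Let_def)
  then show ?thesis using tspace_change[OF v a c] by simp
qed

text \<open>For computing with explicit formulas: the derivative depends only on the representative
  near the point, so any \<open>f\<close> agreeing with it there may be differentiated.\<close>

lemma tmap_coordinates:
  assumes M: "smooth_atlas M" and N: "smooth_atlas N" and F: "smooth_map M N W F" and x: "x \<in> W"
    and v: "v \<in> tspace M x" and c: "c \<in> charts_at M x" and d: "d \<in> charts_at N (F x)"
    and S: "open S" "cmap c x \<in> S" "f differentiable (at (cmap c x))"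
    and eq: "\<And>z. z \<in> W \<Longrightarrow> z \<in> cdom c \<Longrightarrow> cmap c z \<in> S \<Longrightarrow> cmap d (F z) = f (cmap c z)"
  shows "tmap M N F x v d = fderiv f (cmap c x) (v c)"
proof -
  have c': "c \<in> M" "x \<in> cdom c" using c by (auto simp: charts_at_iff)
  let ?S = "S \<inter> cmap c ` (W \<inter> cdom c)"
  have "open ?S" using S(1) mopen_chart_image[OF smooth_map_mopen[OF M F] c'(1)] by blast
  moreover have "cmap c x \<in> ?S" using S(2) x c' by blast
  moreover have "f y = local_rep F c d y" if "y \<in> ?S" for y
    using that eq[of "cinv c y"] cmap_image_Int[OF M c'(1), of y W] by auto
  ultimately have "fderiv f (cmap c x) = fderiv (local_rep F c d) (cmap c x)"
    using S(3) by (intro fderiv_cong[of ?S])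
  then show ?thesis using tmap_local_rep[OF M N F x v c d] by simp
qed

text \<open>Changing the target chart composes the representative with a transition, so the chain
  rule gives the required compatibility of components.\<close>

lemma tmap_in_tspace:
  assumes M: "smooth_atlas M" and N: "smooth_atlas N" and F: "smooth_map M N W F" and x: "x \<in> W"
    and v: "v \<in> tspace M x"
  shows "tmap M N F x v \<in> tspace N (F x)"
proof -
  obtain c where c: "c \<in> charts_at M x" using smooth_map_points(1)[OF F x] points_iff by metis
  note c' = c[unfolded charts_at_iff]
  have "tmap M N F x v e = fderiv (transition d e) (cmap d (F x)) (tmap M N F x v d)"
    if d: "d \<in> charts_at N (F x)" and e: "e \<in> charts_at N (F x)" for d e
  proof -
    note de = d[unfolded charts_at_iff] e[unfolded charts_at_iff]
    obtain S where S: "open S" "cmap c x \<in> S" "\<And>y. y \<in> S \<Longrightarrow> F (cinv c y) \<in> cdom d"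
      "smooth_on S (local_rep F c d)"
      using smooth_mapE[OF M N F x c d] by metis
    have dl: "local_rep F c d differentiable (at (cmap c x))"
      using smooth_on_differentiable S by blast
    have x': "local_rep F c d (cmap c x) = cmap d (F x)" using cinv_cmap[OF M] c' by simp
    have dt: "transition d e differentiable (at (local_rep F c d (cmap c x)))"
      unfolding x' by (rule transition_differentiable[OF N d e])
    have "tmap M N F x v e = fderiv (\<lambda>y. transition d e (local_rep F c d y)) (cmap c x) (v c)"
    proof (rule tmap_coordinates[OF M N F x v c e S(1,2)])
      show "(\<lambda>y. transition d e (local_rep F c d y)) differentiable (at (cmap c x))"
        using differentiable_chain_at[OF dl dt] by (simp add: o_def)
      fix z assume z: "z \<in> W" "z \<in> cdom c" "cmap c z \<in> S"
      then have "cinv c (cmap c z) = z" using cinv_cmap[OF M] c' by blast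
      then show "cmap e (F z) = transition d e (local_rep F c d (cmap c z))"
        using S(3)[OF z(3)] transition_cmap[OF N] de by simp
    qed
    then show ?thesis
      using fderiv_compose[OF dt dl] tmap_local_rep[OF M N F x v c d] x' by simp
  qed
  moreover have "tmap M N F x v e = 0" if "e \<notin> charts_at N (F x)" for e
    using that by (simp add: tmap_def)
  ultimately show ?thesis unfolding tspace_def mem_Collect_eq by blast
qed

lemma tmap_compose:
  assumes M: "smooth_atlas M" and N: "smooth_atlas N" and P: "smooth_atlas P"
    and F: "smooth_map M N W F" and G: "smooth_map N P W' G" and sub: "F ` W \<subseteq> W'"
    and x: "x \<in> W" and v: "v \<in> tspace M x"
  shows "tmap M P (G \<circ> F) x v = tmap N P G (F x) (tmap M N F x v)"
proof -
  have FW: "F x \<in> W'" using sub x by blast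
  note GF = smooth_map_compose[OF M N P F G sub]
  obtain c where c: "c \<in> charts_at M x" using smooth_map_points[OF F x] points_iff by metis
  obtain d where d: "d \<in> charts_at N (F x)" using smooth_map_points[OF F x] points_iff by metis
  obtain e where e: "e \<in> charts_at P (G (F x))" using smooth_map_points[OF G FW] points_iff by metis
  have e': "e \<in> charts_at P ((G \<circ> F) x)" using e by simp
  note in' = c[unfolded charts_at_iff] d[unfolded charts_at_iff] e[unfolded charts_at_iff]
  note Fv = tmap_in_tspace[OF M N F x v]
  obtain S where S: "open S" "cmap c x \<in> S" "\<And>y. y \<in> S \<Longrightarrow> F (cinv c y) \<in> cdom d"
    "smooth_on S (local_rep F c d)"
    using smooth_mapE[OF M N F x c d] by metis
  obtain T where T: "open T" "cmap d (F x) \<in> T" "smooth_on T (local_rep G d e)"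
    using smooth_mapE[OF N P G FW d e] by metis
  have x': "local_rep F c d (cmap c x) = cmap d (F x)" using cinv_cmap[OF M] in' by simp
  have dF: "local_rep F c d differentiable (at (cmap c x))"
    using smooth_on_differentiable S by blast
  have dG: "local_rep G d e differentiable (at (local_rep F c d (cmap c x)))"
    unfolding x' using smooth_on_differentiable T by blast
  show ?thesis
  proof (rule tspace_eqI[OF tmap_in_tspace[OF M P GF x v] _ e'])
    show "tmap N P G (F x) (tmap M N F x v) \<in> tspace P ((G \<circ> F) x)"
      using tmap_in_tspace[OF N P G FW Fv] by simp
    have "tmap M P (G \<circ> F) x v e = fderiv (\<lambda>y. local_rep G d e (local_rep F c d y)) (cmap c x) (v c)"
    proof (rule tmap_coordinates[OF M P GF x v c e' S(1,2)])
      show "(\<lambda>y. local_rep G d e (local_rep F c d y)) differentiable (at (cmap c x))"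
        using differentiable_chain_at[OF dF dG] by (simp add: o_def)
      fix z assume z: "z \<in> W" "z \<in> cdom c" "cmap c z \<in> S"
      then have "cinv c (cmap c z) = z" using cinv_cmap[OF M] in' by blast
      moreover from this have "cinv d (cmap d (F z)) = F z"
        using S(3)[OF z(3)] cinv_cmap[OF N] in' by simp
      ultimately show "cmap e ((G \<circ> F) z) = local_rep G d e (local_rep F c d (cmap c z))" by simp
    qed
    also have "\<dots> = tmap N P G (F x) (tmap M N F x v) e"
      using fderiv_compose[OF dG dF] tmap_local_rep[OF M N F x v c d]
        tmap_local_rep[OF N P G FW Fv d e] x' by simp
    finally show "tmap M P (G \<circ> F) x v e = tmap N P G (F x) (tmap M N F x v) e" .
  qed
qed

lemma tmap_id_on:
  assumes M: "smooth_atlas M" and F: "smooth_map M M W F" and id: "\<And>x. x \<in> W \<Longrightarrow> F x = x"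
    and x: "x \<in> W" and v: "v \<in> tspace M x"
  shows "tmap M M F x v = v"
proof -
  obtain c where c: "c \<in> charts_at M x" using smooth_map_points[OF F x] points_iff by metis
  then have c': "c \<in> charts_at M (F x)" using id[OF x] by simp
  have "tmap M M F x v c = fderiv (\<lambda>y. y) (cmap c x) (v c)"
    by (rule tmap_coordinates[OF M M F x v c c' open_UNIV]) (auto simp: id)
  then show ?thesis
    using tmap_in_tspace[OF M M F x v] id[OF x] by (intro tspace_eqI[OF _ v c]) auto
qed

lemma tmap_inverse:
  assumes M: "smooth_atlas M" and N: "smooth_atlas N" and F: "smooth_map M N W F"
    and G: "smooth_map N M W' G" and FW: "F ` W \<subseteq> W'" and inv: "\<And>x. x \<in> W \<Longrightarrow> G (F x) = x"
    and x: "x \<in> W" and v: "v \<in> tspace M x"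
  shows "tmap N M G (F x) (tmap M N F x v) = v"
  using tmap_compose[OF M N M F G FW x v]
    tmap_id_on[OF M smooth_map_compose[OF M N M F G FW] _ x v] inv by simp

text \<open>\<open>cotangent_lift\<close> inverts the tangent map by \<open>inv_into\<close> on a
  single fibre. Functoriality identifies this with the tangent map of the inverse diffeomorphism,
  which has a coordinate expression.\<close>

lemma inv_into_tmap:
  assumes M: "smooth_atlas M" and N: "smooth_atlas N" and F: "diffeo_on M N W F"
    and x: "x \<in> W" and w: "w \<in> tspace N (F x)"
  shows "inv_into (tspace M x) (tmap M N F x) w = tmap N M (inv_into W F) (F x) w"
    "tmap N M (inv_into W F) (F x) w \<in> tspace M x"
    "tmap M N F x (tmap N M (inv_into W F) (F x) w) = w"
proof -
  note D = diffeo_onD[OF F]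
  have Fx: "F x \<in> F ` W" "inv_into W F (F x) = x" using x inv_into_f_f[OF D(3)] by auto
  have sub: "inv_into W F ` F ` W \<subseteq> W" by (auto simp: inv_into_into)
  have inj: "inj_on (tmap M N F x) (tspace M x)"
    using tmap_inverse[OF M N D(2,5) order_refl inv_into_f_f[OF D(3)] x] by (metis inj_onI)
  show t: "tmap N M (inv_into W F) (F x) w \<in> tspace M x"
    using tmap_in_tspace[OF N M D(5) Fx(1) w] Fx(2) by simp
  show e: "tmap M N F x (tmap N M (inv_into W F) (F x) w) = w"
    using tmap_inverse[OF N M D(5,2) sub _ Fx(1) w] Fx(2) by (simp add: f_inv_into_f)
  show "inv_into (tspace M x) (tmap M N F x) w = tmap N M (inv_into W F) (F x) w"
    by (rule inv_into_f_eq[OF inj t]) (rule e)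
qed

text \<open>The passage from diffeomorphisms of manifolds to the Euclidean lemmas on
  \<open>tangent_lift\<close> and \<open>covector_lift\<close>.\<close>

lemma smooth_inverses_local_rep:
  assumes M: "smooth_atlas M" and N: "smooth_atlas N" and F: "diffeo_on M N W F"
    and x: "x \<in> W" and c: "c \<in> charts_at M x" and d: "d \<in> charts_at N (F x)"
  obtains S T where "cmap c x \<in> S" "S \<subseteq> cmap c ` (W \<inter> cdom c)" "T \<subseteq> cmap d ` (F ` W \<inter> cdom d)"
    "\<And>y. y \<in> S \<Longrightarrow> F (cinv c y) \<in> cdom d" "\<And>y. y \<in> T \<Longrightarrow> inv_into W F (cinv d y) \<in> cdom c"
    "smooth_inverses S T (local_rep F c d) (local_rep (inv_into W F) d c)"
proof -
  note D = diffeo_onD[OF F]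
  let ?G = "inv_into W F"
  have Fx: "F x \<in> F ` W" "?G (F x) = x" using x inv_into_f_f[OF D(3)] by auto
  have c2: "c \<in> charts_at M (?G (F x))" using c Fx by simp
  note in' = c[unfolded charts_at_iff] d[unfolded charts_at_iff]
  obtain S where S: "open S" "cmap c x \<in> S" "S \<subseteq> cmap c ` (W \<inter> cdom c)"
    "\<And>y. y \<in> S \<Longrightarrow> F (cinv c y) \<in> cdom d" "smooth_on S (local_rep F c d)"
    using smooth_mapE[OF M N D(2) x c d] by metis
  obtain T where T: "open T" "cmap d (F x) \<in> T" "T \<subseteq> cmap d ` (F ` W \<inter> cdom d)"
    "\<And>y. y \<in> T \<Longrightarrow> ?G (cinv d y) \<in> cdom c" "smooth_on T (local_rep ?G d c)"
    using smooth_mapE[OF N M D(5) Fx(1) d c2] by metis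
  have GF: "local_rep ?G d c (local_rep F c d y) = y" if "y \<in> S" for y
  proof -
    have "cinv c y \<in> W" "cinv c y \<in> cdom c" "cmap c (cinv c y) = y"
      using that S(3) cmap_image_Int[OF M, of c y W] in' by auto
    then show ?thesis using S(4)[OF that] cinv_cmap[OF N, of d] in' inv_into_f_f[OF D(3)] by simp
  qed
  have FG: "local_rep F c d (local_rep ?G d c y) = y" if "y \<in> T" for y
  proof -
    have "cinv d y \<in> F ` W" "cinv d y \<in> cdom d" "cmap d (cinv d y) = y"
      using that T(3) cmap_image_Int[OF N, of d y "F ` W"] in' by auto
    then show ?thesis using T(4)[OF that] cinv_cmap[OF M, of c] in' by (simp add: f_inv_into_f)
  qed
  \<comment> \<open>Each domain is cut down by the preimage of the other; as the two representatives
    cancel, they then map \<open>?S\<close> and \<open>?T\<close> onto each other.\<close>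
  let ?S = "S \<inter> local_rep F c d -` T" and ?T = "T \<inter> local_rep ?G d c -` S"
  have "open ?S" "open ?T"
    by (intro continuous_open_preimage smooth_on_continuous S T)+
  then have "smooth_inverses ?S ?T (local_rep F c d) (local_rep ?G d c)"
    using smooth_on_subset[OF S(5), of ?S] smooth_on_subset[OF T(5), of ?T] GF FG
    by (auto simp: smooth_inverses_def)
  moreover have "cmap c x \<in> ?S" using S(2) T(2) cinv_cmap[OF M] in' by simp
  ultimately show thesis using that[of ?S ?T] S T by blast
qed

text \<open>Both manifolds share the model space, so an injective derivative is invertible. The
  neighbourhoods found in coordinates are carried back by \<open>cinv c\<close> and
  \<open>cinv d\<close>.\<close>

lemma local_diffeo_inverse_function:
  fixes M :: "('a, 'e::euclidean_space) atlas" and N :: "('b, 'e) atlas"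
  assumes M: "smooth_atlas M" and N: "smooth_atlas N" and F: "smooth_map M N W F" and x: "x \<in> W"
    and c: "c \<in> charts_at M x" and d: "d \<in> charts_at N (F x)"
    and inj: "inj (fderiv (local_rep F c d) (cmap c x))"
  shows "\<exists>V\<subseteq>W. x \<in> V \<and> diffeo_on M N V F"
proof -
  note in' = c[unfolded charts_at_iff] d[unfolded charts_at_iff]
  obtain S where S: "open S" "cmap c x \<in> S" "S \<subseteq> cmap c ` (W \<inter> cdom c)"
    "\<And>y. y \<in> S \<Longrightarrow> F (cinv c y) \<in> cdom d" "smooth_on S (local_rep F c d)"
    using smooth_mapE[OF M N F x c d] by metis
  have Fx: "local_rep F c d (cmap c x) = cmap d (F x)" using cinv_cmap[OF M] in' by simp
  have oS: "open (S \<inter> local_rep F c d -` (cmap d ` cdom d))"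
    using in' by (intro continuous_open_preimage smooth_on_continuous S smooth_atlasD(2)[OF N]) auto
  obtain U V g where UV: "open U" "U \<subseteq> S" "cmap c x \<in> U" "open V"
    "homeomorphism U V (local_rep F c d) g" "smooth_on V g"
    using smooth_inverse_function_theorem[OF S(1,5,2) inj] by metis
  have h: "\<And>y. y \<in> U \<Longrightarrow> local_rep F c d y \<in> V \<and> g (local_rep F c d y) = y"
    "\<And>y. y \<in> V \<Longrightarrow> g y \<in> U \<and> local_rep F c d (g y) = y"
    using UV(5) unfolding homeomorphism_def by blast+
  have Ud: "U \<subseteq> cmap c ` (W \<inter> cdom c)" using UV(2) S(3) by blast
  have U: "cinv c y \<in> W \<and> cinv c y \<in> cdom c \<and> cmap c (cinv c y) = y \<and> F (cinv c y) \<in> cdom d" if "y \<in> U" for y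
    using cmap_image_Int[OF M, of c y W] in' Ud that UV(2) S(4) by blast
  have Vd: "V \<subseteq> cmap d ` cdom d"
  proof
    fix y assume "y \<in> V"
    then have "g y \<in> U" "y = cmap d (F (cinv c (g y)))" using h(2) by metis+
    then show "y \<in> cmap d ` cdom d" using U by blast
  qed
  have V: "cinv d y \<in> cdom d \<and> cmap d (cinv d y) = y" if "y \<in> V" for y
    using Vd that cinv_in[of y d] cmap_cinv[of y d] by blast
  let ?A = "cinv c ` U" and ?B = "cinv d ` V" and ?G = "\<lambda>z. cinv c (g (cmap d z))"
  have oA: "mopen M ?A" using in' Ud by (intro mopen_cinv_image M UV) auto
  have oB: "mopen N ?B" using in' Vd by (intro mopen_cinv_image N UV) auto
  have AW: "?A \<subseteq> W" using U by blast
  have "diffeo_on M N ?A F"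
  proof (rule diffeo_onI[OF M N, of _ _ ?B ?G])
    show "smooth_map M N ?A F" by (rule smooth_map_cong[OF M F oA AW]) simp
    show "smooth_map N M ?B ?G"
    proof (rule smooth_mapI[OF N oB])
      fix z assume "z \<in> ?B"
      then obtain y where y: "y \<in> V" "z = cinv d y" by blast
      then have "d \<in> charts_at N z" "cmap d z \<in> V" using V in' by (auto simp: charts_at_iff)
      moreover have "?G w \<in> cdom c \<and> cmap c (?G w) = g (cmap d w)" if "cmap d w \<in> V" for w
        using U h(2)[OF that] by blast
      ultimately show "\<exists>a\<in>charts_at N z. \<exists>b\<in>M. \<exists>S f. open S \<and> cmap a z \<in> S \<and> smooth_on S f \<and>
          (\<forall>w\<in>?B \<inter> cdom a. cmap a w \<in> S \<longrightarrow> ?G w \<in> cdom b \<and> cmap b (?G w) = f (cmap a w))"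
        using in' UV(4,6) by blast
    qed
    show "F x \<in> ?B" "?G (F x) = x" if "x \<in> ?A" for x
    proof -
      from that obtain y where y: "y \<in> U" "x = cinv c y" by blast
      note y' = h(1)[OF y(1)] U[OF y(1)]
      have "F x = cinv d (cmap d (F x))" using y' y(2) cinv_cmap[OF N, of d] in' by simp
      then show "F x \<in> ?B" using y' y(2) by (metis imageI)
      show "?G (F x) = x" using y' y(2) by simp
    qed
    show "?G z \<in> ?A" "F (?G z) = z" if "z \<in> ?B" for z
    proof -
      from that obtain y where y: "y \<in> V" "z = cinv d y" by blast
      note y' = h(2)[OF y(1)] V[OF y(1)]
      show "?G z \<in> ?A" using y y' by simp
      have "F (cinv c (g y)) \<in> cdom d" using U y' by blast
      then have "F (cinv c (g y)) = cinv d (cmap d (F (cinv c (g y))))"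
        using cinv_cmap[OF N, of d] in' by simp
      then show "F (?G z) = z" using y y' by simp
    qed
  qed
  moreover have "x \<in> ?A" using UV(3) cinv_cmap[OF M, of c x] in' by force
  ultimately show ?thesis using AW by blast
qed

section \<open>Atlases of products and bundles\<close>

text \<open>A coordinate change may be given by any smooth formula \<open>f\<close>; on the overlap
  it coincides with \<open>transition\<close>.\<close>

lemma smooth_atlasI:
  assumes inj: "\<And>c. c \<in> M \<Longrightarrow> inj_on (cmap c) (cdom c)"
    and op: "\<And>c d. c \<in> M \<Longrightarrow> d \<in> M \<Longrightarrow> open (cmap c ` (cdom c \<inter> cdom d))"
    and sm: "\<And>c d. c \<in> M \<Longrightarrow> d \<in> M \<Longrightarrow> \<exists>f. smooth_on (cmap c ` (cdom c \<inter> cdom d)) f \<and>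
      (\<forall>x\<in>cdom c \<inter> cdom d. cmap d x = f (cmap c x))"
  shows "smooth_atlas M"
proof -
  have "open (cmap c ` cdom c)" if "c \<in> M" for c using op[OF that that] by simp
  moreover have "smooth_on (cmap c ` (cdom c \<inter> cdom d)) (transition c d)" if cd: "c \<in> M" "d \<in> M" for c d
  proof -
    from sm[OF cd] obtain f where f: "smooth_on (cmap c ` (cdom c \<inter> cdom d)) f"
      "\<And>x. x \<in> cdom c \<inter> cdom d \<Longrightarrow> cmap d x = f (cmap c x)" by blast
    then have "f y = transition c d y" if "y \<in> cmap c ` (cdom c \<inter> cdom d)" for y
      using that inv_into_f_f[OF inj[OF cd(1)]] by (auto simp: transition_def cinv_def)
    then show ?thesis by (rule smooth_on_cong[OF op[OF cd] f(1)])
  qed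
  ultimately show ?thesis using inj op by (simp add: smooth_atlas_def)
qed

definition prod_chart ::
  "('a, 'e) chart \<Rightarrow> ('b, 'f) chart \<Rightarrow> ('a \<times> 'b, 'e \<times> 'f) chart" where
  "prod_chart c d = (cdom c \<times> cdom d, \<lambda>(x, y). (cmap c x, cmap d y))"

lemma prod_manifold_eq: "prod_manifold M N = (\<lambda>(c, d). prod_chart c d) ` (M \<times> N)"
  unfolding prod_manifold_def prod_chart_def ..

lemma fst_prod_chart [simp]: "fst (prod_chart c d) = cdom c \<times> cdom d"
  by (simp add: prod_chart_def)

lemma snd_prod_chart [simp]: "snd (prod_chart c d) z = (cmap c (fst z), cmap d (snd z))"
  by (simp add: prod_chart_def case_prod_beta)

lemma prod_chart_in:
  "c \<in> charts_at M x \<Longrightarrow> d \<in> charts_at N y \<Longrightarrow> prod_chart c d \<in> charts_at (prod_manifold M N) (x, y)"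
  by (auto simp: charts_at_iff prod_manifold_eq)

lemma charts_at_prodE:
  assumes "k \<in> charts_at (prod_manifold M N) z"
  obtains c d where "k = prod_chart c d" "c \<in> charts_at M (fst z)" "d \<in> charts_at N (snd z)"
  using assms that by (auto simp: charts_at_iff prod_manifold_eq)

lemma points_prod: "points (prod_manifold M N) = points M \<times> points N"
  by (auto simp: points_def prod_manifold_eq)

lemma image_prod_chart: "cmap (prod_chart c d) ` (A \<times> B) = cmap c ` A \<times> cmap d ` B"
  by (auto simp: image_iff)

lemma smooth_atlas_prod:
  assumes M: "smooth_atlas M" and N: "smooth_atlas N"
  shows "smooth_atlas (prod_manifold M N)"
proof (rule smooth_atlasI)
  fix k assume "k \<in> prod_manifold M N"
  then obtain c d where cd: "k = prod_chart c d" "c \<in> M" "d \<in> N" by (auto simp: prod_manifold_eq)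
  show "inj_on (cmap k) (cdom k)"
    using smooth_atlasD(1)[OF M cd(2)] smooth_atlasD(1)[OF N cd(3)]
    by (auto simp: cd inj_on_def)
  fix l assume "l \<in> prod_manifold M N"
  then obtain c' d' where cd': "l = prod_chart c' d'" "c' \<in> M" "d' \<in> N" by (auto simp: prod_manifold_eq)
  have im: "cmap k ` (cdom k \<inter> cdom l) = cmap c ` (cdom c \<inter> cdom c') \<times> cmap d ` (cdom d \<inter> cdom d')"
    unfolding cd(1) cd'(1) fst_prod_chart Times_Int_Times by (rule image_prod_chart)
  then show o: "open (cmap k ` (cdom k \<inter> cdom l))"
    using smooth_atlasD(3)[OF M cd(2) cd'(2)] smooth_atlasD(3)[OF N cd(3) cd'(3)] by (simp add: open_Times)
  let ?f = "\<lambda>y. (transition c c' (fst y), transition d d' (snd y))"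
  have "smooth_on (cmap k ` (cdom k \<inter> cdom l)) ?f"
    by (intro smooth_on_Pair o smooth_on_compose[OF smooth_atlasD(4)[OF M cd(2) cd'(2)]]
        smooth_on_compose[OF smooth_atlasD(4)[OF N cd(3) cd'(3)]] smooth_on_fst smooth_on_snd
        smooth_on_ident smooth_atlasD(3)[OF M cd(2) cd'(2)] smooth_atlasD(3)[OF N cd(3) cd'(3)])
      (auto simp: im)
  moreover have "\<forall>x\<in>cdom k \<inter> cdom l. cmap l x = ?f (cmap k x)"
    using transition_cmap[OF M cd(2)] transition_cmap[OF N cd(3)] by (simp add: cd(1) cd'(1) mem_Times_iff)
  ultimately show "\<exists>f. smooth_on (cmap k ` (cdom k \<inter> cdom l)) f \<and>
      (\<forall>x\<in>cdom k \<inter> cdom l. cmap l x = f (cmap k x))" by blast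
qed

section \<open>Covectors and their components\<close>

definition covec_comp ::
  "('a, 'e::euclidean_space) atlas \<Rightarrow> ('a, 'e) chart \<Rightarrow> 'a \<Rightarrow> ('a, 'e) covec \<Rightarrow> 'e" where
  "covec_comp M c x \<alpha> = (\<Sum>b\<in>Basis. \<alpha> (tvec_of M c x b) *\<^sub>R b)"

text \<open>The value 0 off the tangent space follows the convention of \<open>cspace\<close>, so
  that equal covectors are equal functions.\<close>

definition covec_of ::
  "('a, 'e::euclidean_space) atlas \<Rightarrow> ('a, 'e) chart \<Rightarrow> 'a \<Rightarrow> 'e \<Rightarrow> ('a, 'e) covec" where
  "covec_of M c x p = (\<lambda>v. if v \<in> tspace M x then p \<bullet> v c else 0)"

lemma cspace_outside: "\<alpha> \<in> cspace M x \<Longrightarrow> v \<notin> tspace M x \<Longrightarrow> \<alpha> v = 0"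
  by (simp add: cspace_def)

lemma cspace_lincomb:
  "\<alpha> \<in> cspace M x \<Longrightarrow> v \<in> tspace M x \<Longrightarrow> w \<in> tspace M x \<Longrightarrow>
    \<alpha> (\<lambda>c. a *\<^sub>R v c + b *\<^sub>R w c) = a * \<alpha> v + b * \<alpha> w"
  unfolding cspace_def mem_Collect_eq by blast

lemma tspace_lincomb:
  assumes M: "smooth_atlas M" and v: "v \<in> tspace M x" and w: "w \<in> tspace M x"
  shows "(\<lambda>c. a *\<^sub>R v c + b *\<^sub>R w c) \<in> tspace M x"
proof (cases "x \<in> points M")
  case True
  then obtain c where c: "c \<in> charts_at M x" using points_iff by metis
  have "(\<lambda>d. a *\<^sub>R v d + b *\<^sub>R w d) = tvec_of M c x (a *\<^sub>R v c + b *\<^sub>R w c)"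
    by (simp add: tvec_of_linear[OF M c] tvec_of_eq[OF M v c] tvec_of_eq[OF M w c])
  then show ?thesis using tvec_of_in_tspace[OF M c] by simp
next
  case False
  then have "charts_at M x = {}" using points_iff by fastforce
  then show ?thesis by (simp add: tspace_def tspace_outside[OF v] tspace_outside[OF w])
qed

text \<open>Every tangent vector is \<open>tvec_of\<close> of its component, and
  \<open>tvec_of\<close> is linear; the values of the functional on basis vectors therefore
  determine it.\<close>

lemma covec_apply:
  assumes M: "smooth_atlas M" and a: "\<alpha> \<in> cspace M x" and c: "c \<in> charts_at M x" and v: "v \<in> tspace M x"
  shows "\<alpha> v = covec_comp M c x \<alpha> \<bullet> v c"
proof -
  note t = tvec_of_in_tspace[OF M c]
  have "linear (\<lambda>w. \<alpha> (tvec_of M c x w))"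
  proof (rule linearI)
    show "\<alpha> (tvec_of M c x (u + w)) = \<alpha> (tvec_of M c x u) + \<alpha> (tvec_of M c x w)" for u w
      using tvec_of_linear[OF M c, of 1 u 1 w] cspace_lincomb[OF a t t, of 1 u 1 w] by simp
    show "\<alpha> (tvec_of M c x (r *\<^sub>R w)) = r *\<^sub>R \<alpha> (tvec_of M c x w)" for r w
      using tvec_of_linear[OF M c, of r w 0 0] cspace_lincomb[OF a t t, of r w 0 0] by simp
  qed
  from linear_sum_Basis[OF this, of "v c"] show ?thesis
    by (simp add: tvec_of_eq[OF M v c] covec_comp_def inner_sum_left inner_commute[of "v c"] mult.commute)
qed

lemma covec_comp_eqI:
  assumes M: "smooth_atlas M" and c: "c \<in> charts_at M x" and p: "\<And>v. v \<in> tspace M x \<Longrightarrow> \<alpha> v = p \<bullet> v c"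
  shows "covec_comp M c x \<alpha> = p"
proof -
  have "covec_comp M c x \<alpha> = (\<Sum>b\<in>Basis. (p \<bullet> b) *\<^sub>R b)"
    by (simp add: covec_comp_def p[OF tvec_of_in_tspace[OF M c]] tvec_of_apply[OF M c])
  then show ?thesis by (simp add: euclidean_representation)
qed

lemma covec_of_in_cspace: "smooth_atlas M \<Longrightarrow> covec_of M c x p \<in> cspace M x"
  by (simp add: cspace_def covec_of_def tspace_lincomb inner_add_right)

lemma covec_comp_of:
  "smooth_atlas M \<Longrightarrow> c \<in> charts_at M x \<Longrightarrow> covec_comp M c x (covec_of M c x p) = p"
  by (rule covec_comp_eqI) (simp_all add: covec_of_def)

lemma cspace_eqI:
  assumes "smooth_atlas M" "\<alpha> \<in> cspace M x" "\<beta> \<in> cspace M x" "c \<in> charts_at M x"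
    "covec_comp M c x \<alpha> = covec_comp M c x \<beta>"
  shows "\<alpha> = \<beta>"
proof
  fix v
  show "\<alpha> v = \<beta> v"
    using covec_apply[OF assms(1,2,4), of v] covec_apply[OF assms(1,3,4), of v] assms(5)
      cspace_outside[OF assms(2), of v] cspace_outside[OF assms(3), of v]
    by (cases "v \<in> tspace M x") simp_all
qed

text \<open>Preserving the pairing with vectors forces covectors to change by the transposed
  Jacobian of the reverse transition.\<close>

lemma covec_comp_change:
  assumes M: "smooth_atlas M" and a: "\<alpha> \<in> cspace M x" and c: "c \<in> charts_at M x" "d \<in> charts_at M x"
  shows "covec_comp M d x \<alpha> = adjoint (fderiv (transition d c) (cmap d x)) (covec_comp M c x \<alpha>)"
proof (rule covec_comp_eqI[OF M c(2)])
  fix v assume v: "v \<in> tspace M x"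
  show "\<alpha> v = adjoint (fderiv (transition d c) (cmap d x)) (covec_comp M c x \<alpha>) \<bullet> v d"
    using covec_apply[OF M a c(1) v] tspace_change[OF v c(2,1)]
      adjoint_clauses(2)[OF linear_fderiv[OF transition_differentiable[OF M c(2,1)]]] by simp
qed

section \<open>Charts of the tangent and cotangent bundles\<close>

lemma fst_tangent_chart [simp]:
  "z \<in> fst (tangent_chart M c) \<longleftrightarrow> fst z \<in> cdom c \<and> snd z \<in> tspace M (fst z)"
  by (simp add: tangent_chart_def case_prod_beta)

lemma snd_tangent_chart [simp]: "snd (tangent_chart M c) z = (cmap c (fst z), snd z c)"
  by (simp add: tangent_chart_def case_prod_beta)

lemma fst_cotangent_chart [simp]:
  "z \<in> fst (cotangent_chart M c) \<longleftrightarrow> fst z \<in> cdom c \<and> snd z \<in> cspace M (fst z)"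
  by (simp add: cotangent_chart_def case_prod_beta)

lemma snd_cotangent_chart [simp]:
  "snd (cotangent_chart M c) z = (cmap c (fst z), covec_comp M c (fst z) (snd z))"
  by (simp add: cotangent_chart_def covec_comp_def case_prod_beta)

lemma points_tangent: "z \<in> points (tangent_bundle M) \<longleftrightarrow> fst z \<in> points M \<and> snd z \<in> tspace M (fst z)"
  by (auto simp: points_def tangent_bundle_def)

lemma points_cotangent: "z \<in> points (cotangent_bundle M) \<longleftrightarrow> fst z \<in> points M \<and> snd z \<in> cspace M (fst z)"
  by (auto simp: points_def cotangent_bundle_def)

lemma tangent_chart_in:
  "c \<in> charts_at M (fst z) \<Longrightarrow> snd z \<in> tspace M (fst z) \<Longrightarrow> tangent_chart M c \<in> charts_at (tangent_bundle M) z"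
  by (simp add: charts_at_iff tangent_bundle_def)

lemma cotangent_chart_in:
  "c \<in> charts_at M (fst z) \<Longrightarrow> snd z \<in> cspace M (fst z) \<Longrightarrow>
    cotangent_chart M c \<in> charts_at (cotangent_bundle M) z"
  by (simp add: charts_at_iff cotangent_bundle_def)

lemma charts_at_cotangentE:
  assumes "k \<in> charts_at (cotangent_bundle M) z"
  obtains c where "k = cotangent_chart M c" "c \<in> charts_at M (fst z)" "snd z \<in> cspace M (fst z)"
  using assms that by (auto simp: charts_at_iff cotangent_bundle_def)

lemma image_tangent_chart:
  assumes M: "smooth_atlas M" and c: "c \<in> M" and A: "A \<subseteq> cdom c"
  shows "cmap (tangent_chart M c) ` {z. fst z \<in> A \<and> snd z \<in> tspace M (fst z)} = cmap c ` A \<times> UNIV"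
proof
  show "cmap c ` A \<times> UNIV \<subseteq> cmap (tangent_chart M c) ` {z. fst z \<in> A \<and> snd z \<in> tspace M (fst z)}"
  proof clarify
    fix x w assume x: "x \<in> A"
    then have cx: "c \<in> charts_at M x" using A c by (auto simp: charts_at_iff)
    show "(cmap c x, w) \<in> cmap (tangent_chart M c) ` {z. fst z \<in> A \<and> snd z \<in> tspace M (fst z)}"
      by (rule image_eqI[of _ _ "(x, tvec_of M c x w)"])
        (simp_all add: x tvec_of_apply[OF M cx] tvec_of_in_tspace[OF M cx])
  qed
qed auto

lemma image_cotangent_chart:
  assumes M: "smooth_atlas M" and c: "c \<in> M" and A: "A \<subseteq> cdom c"
  shows "cmap (cotangent_chart M c) ` {z. fst z \<in> A \<and> snd z \<in> cspace M (fst z)} = cmap c ` A \<times> UNIV"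
proof
  show "cmap c ` A \<times> UNIV \<subseteq> cmap (cotangent_chart M c) ` {z. fst z \<in> A \<and> snd z \<in> cspace M (fst z)}"
  proof clarify
    fix x w assume x: "x \<in> A"
    then have cx: "c \<in> charts_at M x" using A c by (auto simp: charts_at_iff)
    show "(cmap c x, w) \<in> cmap (cotangent_chart M c) ` {z. fst z \<in> A \<and> snd z \<in> cspace M (fst z)}"
      by (rule image_eqI[of _ _ "(x, covec_of M c x w)"])
        (simp_all add: x covec_comp_of[OF M cx] covec_of_in_cspace[OF M])
  qed
qed auto

text \<open>This and the next lemma express bundle coordinate changes as lifts of base transitions,
  which brings in the Euclidean lemmas on lifts.\<close>

lemma tangent_chart_change:
  assumes M: "smooth_atlas M" and c: "c \<in> charts_at M (fst z)" "d \<in> charts_at M (fst z)"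
    and z: "snd z \<in> tspace M (fst z)"
  shows "cmap (tangent_chart M d) z = tangent_lift (transition c d) (cmap (tangent_chart M c) z)"
  using tspace_change[OF z c] transition_cmap[OF M] c by (simp add: tangent_lift_def charts_at_iff)

lemma cotangent_chart_change:
  assumes M: "smooth_atlas M" and c: "c \<in> charts_at M (fst z)" "d \<in> charts_at M (fst z)"
    and z: "snd z \<in> cspace M (fst z)"
  shows "cmap (cotangent_chart M d) z =
    covector_lift (transition c d) (transition d c) (cmap (cotangent_chart M c) z)"
  using covec_comp_change[OF M z c] transition_cmap[OF M] c by (simp add: covector_lift_def charts_at_iff)

lemma smooth_atlas_tangent:
  assumes M: "smooth_atlas M"
  shows "smooth_atlas (tangent_bundle M)"
proof (rule smooth_atlasI)
  fix k assume "k \<in> tangent_bundle M"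
  then obtain c where c: "k = tangent_chart M c" "c \<in> M" by (auto simp: tangent_bundle_def)
  show "inj_on (cmap k) (cdom k)"
  proof (rule inj_onI)
    fix z w assume z: "z \<in> cdom k" and w: "w \<in> cdom k" and e: "cmap k z = cmap k w"
    have "fst z = fst w" using inj_onD[OF smooth_atlasD(1)[OF M c(2)]] z w e by (simp add: c(1))
    moreover from this have "snd z = snd w"
      using z w e c(2) by (intro tspace_eqI[of "snd z" M "fst z" "snd w" c]) (simp_all add: c(1) charts_at_iff)
    ultimately show "z = w" by (rule prod_eqI)
  qed
  fix l assume "l \<in> tangent_bundle M"
  then obtain d where d: "l = tangent_chart M d" "d \<in> M" by (auto simp: tangent_bundle_def)
  have "cdom k \<inter> cdom l = {z. fst z \<in> cdom c \<inter> cdom d \<and> snd z \<in> tspace M (fst z)}"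
    unfolding c(1) d(1) by auto
  then have im: "cmap k ` (cdom k \<inter> cdom l) = cmap c ` (cdom c \<inter> cdom d) \<times> UNIV"
    unfolding c(1) using image_tangent_chart[OF M c(2), of "cdom c \<inter> cdom d"] by simp
  then show "open (cmap k ` (cdom k \<inter> cdom l))"
    using smooth_atlasD(3)[OF M c(2) d(2)] by (simp add: open_Times)
  have "smooth_on (cmap k ` (cdom k \<inter> cdom l)) (tangent_lift (transition c d))"
    unfolding im by (intro smooth_on_tangent_lift smooth_atlasD(3,4)[OF M c(2) d(2)])
  moreover have "\<forall>z\<in>cdom k \<inter> cdom l. cmap l z = tangent_lift (transition c d) (cmap k z)"
    using c d by (intro ballI) (simp only: c(1) d(1), rule tangent_chart_change[OF M], auto simp: charts_at_iff)
  ultimately show "\<exists>f. smooth_on (cmap k ` (cdom k \<inter> cdom l)) f \<and>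
      (\<forall>x\<in>cdom k \<inter> cdom l. cmap l x = f (cmap k x))" by blast
qed

lemma smooth_atlas_cotangent:
  assumes M: "smooth_atlas M"
  shows "smooth_atlas (cotangent_bundle M)"
proof (rule smooth_atlasI)
  fix k assume "k \<in> cotangent_bundle M"
  then obtain c where c: "k = cotangent_chart M c" "c \<in> M" by (auto simp: cotangent_bundle_def)
  show "inj_on (cmap k) (cdom k)"
  proof (rule inj_onI)
    fix z w assume z: "z \<in> cdom k" and w: "w \<in> cdom k" and e: "cmap k z = cmap k w"
    have "fst z = fst w" using inj_onD[OF smooth_atlasD(1)[OF M c(2)]] z w e by (simp add: c(1))
    moreover from this have "snd z = snd w"
      using z w e c(2) by (intro cspace_eqI[OF M, of "snd z" "fst z" "snd w" c]) (simp_all add: c(1) charts_at_iff)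
    ultimately show "z = w" by (rule prod_eqI)
  qed
  fix l assume "l \<in> cotangent_bundle M"
  then obtain d where d: "l = cotangent_chart M d" "d \<in> M" by (auto simp: cotangent_bundle_def)
  have "cdom k \<inter> cdom l = {z. fst z \<in> cdom c \<inter> cdom d \<and> snd z \<in> cspace M (fst z)}"
    unfolding c(1) d(1) by auto
  then have im: "cmap k ` (cdom k \<inter> cdom l) = cmap c ` (cdom c \<inter> cdom d) \<times> UNIV"
    unfolding c(1) using image_cotangent_chart[OF M c(2), of "cdom c \<inter> cdom d"] by simp
  then show "open (cmap k ` (cdom k \<inter> cdom l))"
    using smooth_atlasD(3)[OF M c(2) d(2)] by (simp add: open_Times)
  have "smooth_on (cmap k ` (cdom k \<inter> cdom l)) (covector_lift (transition c d) (transition d c))"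
    unfolding im using smooth_inverses_covector_lift[OF smooth_inverses_transition[OF M c(2) d(2)]]
    by (rule smooth_inversesD)
  moreover have "\<forall>z\<in>cdom k \<inter> cdom l. cmap l z = covector_lift (transition c d) (transition d c) (cmap k z)"
    using c d by (intro ballI) (simp only: c(1) d(1), rule cotangent_chart_change[OF M], auto simp: charts_at_iff)
  ultimately show "\<exists>f. smooth_on (cmap k ` (cdom k \<inter> cdom l)) f \<and>
      (\<forall>x\<in>cdom k \<inter> cdom l. cmap l x = f (cmap k x))" by blast
qed

text \<open>\<open>transition\<close> is meaningful on the overlap only; any formula agreeing with
  it there has the same derivative.\<close>

lemma tspace_change_local:
  assumes M: "smooth_atlas M" and v: "v \<in> tspace M x" and c: "c \<in> charts_at M x" and d: "d \<in> charts_at M x"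
    and f: "f differentiable (at (cmap c x))"
    and eq: "\<And>z. z \<in> cdom c \<Longrightarrow> z \<in> cdom d \<Longrightarrow> cmap d z = f (cmap c z)"
  shows "v d = fderiv f (cmap c x) (v c)"
proof -
  have c': "c \<in> M" "d \<in> M" using c d by (auto simp: charts_at_iff)
  have "fderiv f (cmap c x) = fderiv (transition c d) (cmap c x)"
  proof (rule fderiv_cong[OF smooth_atlasD(3)[OF M c'] cmap_in_overlap[OF c d] f])
    fix y assume "y \<in> cmap c ` (cdom c \<inter> cdom d)"
    then obtain z where "z \<in> cdom c" "z \<in> cdom d" "y = cmap c z" by blast
    then show "f y = transition c d y" using eq transition_cmap[OF M c'(1)] by simp
  qed
  then show ?thesis using tspace_change[OF v c d] by simp
qed

section \<open>The canonical symplectic form\<close>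

lemma smooth_map_fst_cotangent:
  assumes M: "smooth_atlas M"
  shows "smooth_map (cotangent_bundle M) M (points (cotangent_bundle M)) fst"
proof (rule smooth_mapI[OF smooth_atlas_cotangent[OF M] mopen_points[OF smooth_atlas_cotangent[OF M]]])
  fix z assume "z \<in> points (cotangent_bundle M)"
  then obtain c where c: "c \<in> charts_at M (fst z)" "snd z \<in> cspace M (fst z)"
    unfolding points_cotangent points_iff[of "fst z"] by blast
  have "smooth_on UNIV (fst :: 'b \<times> 'b \<Rightarrow> 'b)"
    using smooth_on_fst[OF smooth_on_ident open_UNIV] .
  then show "\<exists>k\<in>charts_at (cotangent_bundle M) z. \<exists>d\<in>M. \<exists>S f. open S \<and> cmap k z \<in> S \<and> smooth_on S f \<and>
      (\<forall>w\<in>points (cotangent_bundle M) \<inter> cdom k. cmap k w \<in> S \<longrightarrow> fst w \<in> cdom d \<and> cmap d (fst w) = f (cmap k w))"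
    using c by (intro bexI[of _ "cotangent_chart M c"] bexI[of _ c] exI[of _ UNIV] exI[of _ fst])
      (auto simp: charts_at_iff cotangent_bundle_def)
qed

text \<open>In induced coordinates the Liouville form is p dq: the footpoint projection reads as
  \<open>fst\<close>, so it extracts the position part of \<open>e\<close>.\<close>

lemma liouville_tvec_of:
  assumes M: "smooth_atlas M" and c: "c \<in> charts_at M (fst z)" and z: "snd z \<in> cspace M (fst z)"
  shows "liouville M z (tvec_of (cotangent_bundle M) (cotangent_chart M c) z e) =
    snd (cmap (cotangent_chart M c) z) \<bullet> fst e"
proof -
  let ?T = "cotangent_bundle M" and ?k = "cotangent_chart M c"
  note T = smooth_atlas_cotangent[OF M]
  have k: "?k \<in> charts_at ?T z" by (rule cotangent_chart_in[OF c z])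
  have zT: "z \<in> points ?T" using c z by (auto simp: points_cotangent points_iff[of "fst z"])
  note tv = tvec_of_in_tspace[OF T k, of e]
  have "tmap ?T M fst z (tvec_of ?T ?k z e) c = fderiv fst (cmap ?k z) (tvec_of ?T ?k z e ?k)"
    by (rule tmap_coordinates[OF T M smooth_map_fst_cotangent[OF M] zT tv k c open_UNIV])
      (auto intro!: bounded_linear_imp_differentiable bounded_linear_fst)
  also have "\<dots> = fst e"
    using fderiv_eqI[OF bounded_linear_imp_has_derivative[OF bounded_linear_fst]] tvec_of_apply[OF T k] by simp
  finally show ?thesis
    unfolding liouville_def
    using covec_apply[OF M z c tmap_in_tspace[OF T M smooth_map_fst_cotangent[OF M] zT tv]] by simp
qed

text \<open>\<open>ext_deriv\<close> works in the chart picked by \<open>chart_at\<close>. That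
  chart is induced by some chart \<open>a\<close> of the base, where -d(p dq) is dq ^ dp; invariance
  under lifted transitions carries the formula to every other induced chart.\<close>

lemma canonical_form_coordinates:
  assumes M: "smooth_atlas M" and c: "c \<in> charts_at M (fst z)" and z: "snd z \<in> cspace M (fst z)"
    and u: "u \<in> tspace (cotangent_bundle M) z" and w: "w \<in> tspace (cotangent_bundle M) z"
  shows "canonical_form M z u w = symplectic_product (u (cotangent_chart M c)) (w (cotangent_chart M c))"
proof -
  let ?T = "cotangent_bundle M"
  note T = smooth_atlas_cotangent[OF M]
  define k where "k = chart_at ?T z"
  have zT: "z \<in> points ?T" using c z by (auto simp: points_cotangent points_iff[of "fst z"])
  have "k \<in> charts_at ?T z" unfolding k_def by (rule chart_at_in[OF zT])
  then obtain a where a: "k = cotangent_chart M a" "a \<in> charts_at M (fst z)"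
    using charts_at_cotangentE by blast
  have k: "k \<in> charts_at ?T z" using cotangent_chart_in[OF a(2) z] a(1) by simp
  then have k': "k \<in> ?T" "z \<in> cdom k" by (auto simp: charts_at_iff)
  have D: "fderiv (\<lambda>y. liouville M (cinv k y) (tvec_of ?T k (cinv k y) e)) (cmap k z) h = snd h \<bullet> fst e" for e h
  proof -
    have dd: "((\<lambda>y. snd y \<bullet> fst e) has_derivative (\<lambda>h. snd h \<bullet> fst e)) (at (cmap k z))"
      by (intro has_derivative_inner_left has_derivative_snd has_derivative_ident)
    have "fderiv (\<lambda>y. snd y \<bullet> fst e) (cmap k z) =
      fderiv (\<lambda>y. liouville M (cinv k y) (tvec_of ?T k (cinv k y) e)) (cmap k z)"
    proof (rule fderiv_cong[OF smooth_atlasD(2)[OF T k'(1)]])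
      show "cmap k z \<in> cmap k ` cdom k" using k'(2) by simp
      show "(\<lambda>y. snd y \<bullet> fst e) differentiable (at (cmap k z))" using dd differentiable_def by blast
      fix y assume "y \<in> cmap k ` cdom k"
      then have "cinv k y \<in> cdom k" "cmap k (cinv k y) = y" using cinv_in[of y k] cmap_cinv[of y k] by auto
      then show "snd y \<bullet> fst e = liouville M (cinv k y) (tvec_of ?T k (cinv k y) e)"
        using liouville_tvec_of[OF M, of a "cinv k y" e] a(2) unfolding a(1) by (simp add: charts_at_iff)
    qed
    then show ?thesis using fderiv_eqI[OF dd] by metis
  qed
  have "canonical_form M z u w = symplectic_product (u k) (w k)"
    unfolding canonical_form_def ext_deriv_def k_def[symmetric] Let_def D
    by (simp add: symplectic_product_def inner_commute)
  \<comment> \<open>The change from the chart induced by \<open>a\<close> to the one induced by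
    \<open>c\<close> is a covector lift, hence preserves \<open>symplectic_product\<close>.\<close>
  also have "\<dots> = symplectic_product (u (cotangent_chart M c)) (w (cotangent_chart M c))"
  proof -
    have ac: "a \<in> M" "c \<in> M" "fst z \<in> cdom a" "fst z \<in> cdom c" using a c by (auto simp: charts_at_iff)
    note inv = smooth_inverses_transition[OF M ac(1,2)]
    let ?H = "covector_lift (transition a c) (transition c a)"
    have zk: "cmap k z \<in> cmap a ` (cdom a \<inter> cdom c) \<times> UNIV" using ac by (simp add: a(1))
    have df: "?H differentiable (at (cmap k z))"
      using smooth_on_differentiable[OF smooth_inversesD(3)[OF smooth_inverses_covector_lift[OF inv]] zk] .
    have e: "v (cotangent_chart M c) = fderiv ?H (cmap k z) (v k)" if "v \<in> tspace ?T z" for v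
    proof (rule tspace_change_local[OF T that k cotangent_chart_in[OF c z] df])
      fix x assume "x \<in> cdom k" "x \<in> cdom (cotangent_chart M c)"
      then show "cmap (cotangent_chart M c) x = ?H (cmap k x)"
        unfolding a(1) using ac by (intro cotangent_chart_change[OF M]) (auto simp: charts_at_iff)
    qed
    show ?thesis unfolding e[OF u] e[OF w] by (rule symplectic_product_covector_lift[OF inv zk, symmetric])
  qed
  finally show ?thesis .
qed

section \<open>Cotangent lifts\<close>

lemma cotangent_restrict_iff:
  "z \<in> cotangent_restrict M U \<longleftrightarrow> fst z \<in> points M \<and> fst z \<in> U \<and> snd z \<in> cspace M (fst z)"
  by (auto simp: cotangent_restrict_def points_cotangent)

lemma mopen_cotangent_restrict:
  assumes M: "smooth_atlas M" and W: "mopen M W"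
  shows "mopen (cotangent_bundle M) (cotangent_restrict M W)"
  unfolding mopen_def
proof (intro conjI ballI)
  show "cotangent_restrict M W \<subseteq> points (cotangent_bundle M)" by (auto simp: cotangent_restrict_def)
  fix k assume "k \<in> cotangent_bundle M"
  then obtain c where c: "k = cotangent_chart M c" "c \<in> M" by (auto simp: cotangent_bundle_def)
  have "W \<subseteq> points M" using W by (simp add: mopen_def)
  then have "cotangent_restrict M W \<inter> cdom k = {z. fst z \<in> W \<inter> cdom c \<and> snd z \<in> cspace M (fst z)}"
    unfolding c(1) by (auto simp: cotangent_restrict_iff)
  then have "cmap k ` (cotangent_restrict M W \<inter> cdom k) = cmap c ` (W \<inter> cdom c) \<times> UNIV"
    unfolding c(1) using image_cotangent_chart[OF M c(2), of "W \<inter> cdom c"] by simp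
  then show "open (cmap k ` (cotangent_restrict M W \<inter> cdom k))"
    using mopen_chart_image[OF W c(2)] by (simp add: open_Times)
qed

text \<open>By \<open>inv_into_tmap\<close> the covector is evaluated on the tangent map of the
  inverse; taking the adjoint of its coordinate matrix moves that matrix onto the covector
  component.\<close>

lemma cotangent_lift_eq:
  assumes M: "smooth_atlas M" and N: "smooth_atlas N" and F: "diffeo_on M N W F"
    and z: "fst z \<in> W" "snd z \<in> cspace M (fst z)"
    and c: "c \<in> charts_at M (fst z)" and d: "d \<in> charts_at N (F (fst z))"
  shows "cotangent_lift M N F z = (F (fst z), covec_of N d (F (fst z))
    (adjoint (fderiv (local_rep (inv_into W F) d c) (cmap d (F (fst z)))) (covec_comp M c (fst z) (snd z))))"
proof -
  let ?G = "inv_into W F" and ?x = "fst z"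
  note D = diffeo_onD[OF F]
  have Fx: "F ?x \<in> F ` W" "?G (F ?x) = ?x" using z inv_into_f_f[OF D(3)] by auto
  have c2: "c \<in> charts_at M (?G (F ?x))" using c Fx by simp
  obtain T where T: "cmap d (F ?x) \<in> T" "smooth_on T (local_rep ?G d c)"
    using smooth_mapE[OF N M D(5) Fx(1) d c2] by metis
  note lin = smooth_on_linear_fderiv[OF T(2,1)]
  have "snd z (inv_into (tspace M ?x) (tmap M N F ?x) w) =
    adjoint (fderiv (local_rep ?G d c) (cmap d (F ?x))) (covec_comp M c ?x (snd z)) \<bullet> w d"
    if w: "w \<in> tspace N (F ?x)" for w
    using inv_into_tmap(1,2)[OF M N F z(1) w] covec_apply[OF M z(2) c]
      tmap_local_rep[OF N M D(5) Fx(1) w d c2] adjoint_clauses(2)[OF lin] by simp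
  then show ?thesis by (auto simp: cotangent_lift_def covec_of_def case_prod_beta)
qed

lemma cotangent_lift_chart:
  assumes M: "smooth_atlas M" and N: "smooth_atlas N" and F: "diffeo_on M N W F"
    and z: "fst z \<in> W" "snd z \<in> cspace M (fst z)"
    and c: "c \<in> charts_at M (fst z)" and d: "d \<in> charts_at N (F (fst z))"
  shows "cotangent_lift M N F z \<in> cdom (cotangent_chart N d)"
    "cmap (cotangent_chart N d) (cotangent_lift M N F z) =
      covector_lift (local_rep F c d) (local_rep (inv_into W F) d c) (cmap (cotangent_chart M c) z)"
  using cinv_cmap[OF M, of c "fst z"] c d
  by (simp_all add: cotangent_lift_eq[OF assms] covec_of_in_cspace[OF N] covec_comp_of[OF N d]
      covector_lift_def charts_at_iff)

lemma smooth_map_cotangent_lift: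
  assumes M: "smooth_atlas M" and N: "smooth_atlas N" and F: "diffeo_on M N W F"
  shows "smooth_map (cotangent_bundle M) (cotangent_bundle N) (cotangent_restrict M W) (cotangent_lift M N F)"
proof (rule smooth_mapI[OF smooth_atlas_cotangent[OF M] mopen_cotangent_restrict[OF M diffeo_onD(1)[OF F]]])
  fix z assume "z \<in> cotangent_restrict M W"
  then have z: "fst z \<in> W" "snd z \<in> cspace M (fst z)" by (auto simp: cotangent_restrict_iff)
  obtain c where c: "c \<in> charts_at M (fst z)"
    using smooth_map_points(1)[OF diffeo_onD(2)[OF F] z(1)] points_iff by metis
  obtain d where d: "d \<in> charts_at N (F (fst z))"
    using smooth_map_points(2)[OF diffeo_onD(2)[OF F] z(1)] points_iff by metis
  obtain S T where S: "cmap c (fst z) \<in> S" "\<And>y. y \<in> S \<Longrightarrow> F (cinv c y) \<in> cdom d"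
    and inv: "smooth_inverses S T (local_rep F c d) (local_rep (inv_into W F) d c)"
    using smooth_inverses_local_rep[OF M N F z(1) c d] by metis
  let ?f = "covector_lift (local_rep F c d) (local_rep (inv_into W F) d c)"
  note cd = c[unfolded charts_at_iff] d[unfolded charts_at_iff]
  note L = smooth_inverses_covector_lift[OF inv]
  have *: "cotangent_lift M N F w \<in> cdom (cotangent_chart N d) \<and>
      cmap (cotangent_chart N d) (cotangent_lift M N F w) = ?f (cmap (cotangent_chart M c) w)"
    if "w \<in> cotangent_restrict M W \<inter> cdom (cotangent_chart M c)" "cmap (cotangent_chart M c) w \<in> S \<times> UNIV" for w
  proof -
    have w: "fst w \<in> W" "snd w \<in> cspace M (fst w)" "c \<in> charts_at M (fst w)" "cmap c (fst w) \<in> S"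
      using that cd by (auto simp: cotangent_restrict_iff charts_at_iff)
    have "d \<in> charts_at N (F (fst w))"
      using S(2)[OF w(4)] cinv_cmap[OF M, of c "fst w"] w(3) cd by (simp add: charts_at_iff)
    then show ?thesis using cotangent_lift_chart[OF M N F w(1,2,3)] by blast
  qed
  moreover have "cotangent_chart M c \<in> charts_at (cotangent_bundle M) z"
    by (rule cotangent_chart_in[OF c z(2)])
  moreover have "cmap (cotangent_chart M c) z \<in> S \<times> UNIV" using S(1) by simp
  moreover have "cotangent_chart N d \<in> cotangent_bundle N" using cd by (simp add: cotangent_bundle_def)
  ultimately show "\<exists>k\<in>charts_at (cotangent_bundle M) z. \<exists>l\<in>cotangent_bundle N. \<exists>S f. open S \<and>
      cmap k z \<in> S \<and> smooth_on S f \<and> (\<forall>w\<in>cotangent_restrict M W \<inter> cdom k. cmap k w \<in> S \<longrightarrow>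
        cotangent_lift M N F w \<in> cdom l \<and> cmap l (cotangent_lift M N F w) = f (cmap k w))"
    by (intro bexI[of _ "cotangent_chart M c"] bexI[of _ "cotangent_chart N d"] exI[of _ "S \<times> UNIV"]
        exI[of _ ?f] conjI ballI impI conjunct1[OF *] conjunct2[OF *] smooth_inversesD(1,3)[OF L])
qed

lemma cotangent_lift_restrict:
  assumes M: "smooth_atlas M" and N: "smooth_atlas N" and F: "diffeo_on M N W F"
    and z: "z \<in> cotangent_restrict M W"
  shows "cotangent_lift M N F z \<in> cotangent_restrict N (F ` W)"
    "cotangent_lift N M (inv_into W F) (cotangent_lift M N F z) = z"
proof -
  have z': "fst z \<in> W" "snd z \<in> cspace M (fst z)" using z by (auto simp: cotangent_restrict_iff)
  note D = diffeo_onD[OF F]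
  let ?G = "inv_into W F" and ?x = "fst z"
  obtain c where c: "c \<in> charts_at M ?x" using smooth_map_points(1)[OF D(2) z'(1)] points_iff by metis
  obtain d where d: "d \<in> charts_at N (F ?x)" using smooth_map_points(2)[OF D(2) z'(1)] points_iff by metis
  have Fx: "F ?x \<in> F ` W" "?G (F ?x) = ?x" using z' inv_into_f_f[OF D(3)] by auto
  have l: "fst (cotangent_lift M N F z) = F ?x" by (simp add: cotangent_lift_def case_prod_beta)
  show "cotangent_lift M N F z \<in> cotangent_restrict N (F ` W)"
    using cotangent_lift_chart(1)[OF M N F z' c d] l z'(1) d
    by (auto simp: cotangent_restrict_iff points_iff)
  have "snd (cotangent_lift N M ?G (cotangent_lift M N F z)) v = snd z v" for v
  proof (cases "v \<in> tspace M ?x")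
    case True
    \<comment> \<open>The vector at \<open>F ?x\<close> that the tangent map of the inverse sends to
      \<open>v\<close>. The inner lift applies exactly that tangent map to it, which gives back
      \<open>v\<close>.\<close>
    let ?w = "inv_into (tspace N (F ?x)) (tmap N M ?G (F ?x)) v"
    have v: "v \<in> tspace M (?G (F ?x))" using True Fx by simp
    note i = inv_into_tmap[OF N M diffeo_on_inverse[OF M N F] Fx(1) v]
    have w: "?w \<in> tspace N (F ?x)" "tmap N M ?G (F ?x) ?w = v" using i by simp_all
    have "snd (cotangent_lift N M ?G (cotangent_lift M N F z)) v = snd z (tmap N M ?G (F ?x) ?w)"
      using True Fx(2) w(1) inv_into_tmap(1)[OF M N F z'(1) w(1)]
      by (simp add: cotangent_lift_def case_prod_beta)
    then show ?thesis using w(2) by simp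
  next
    case False
    then show ?thesis
      using Fx(2) cspace_outside[OF z'(2) False] by (simp add: cotangent_lift_def case_prod_beta)
  qed
  moreover have "fst (cotangent_lift N M ?G (cotangent_lift M N F z)) = ?x"
    using Fx(2) by (simp add: cotangent_lift_def case_prod_beta)
  ultimately show "cotangent_lift N M ?G (cotangent_lift M N F z) = z"
    by (intro prod_eqI ext) simp_all
qed

lemma diffeo_on_cotangent_lift:
  assumes M: "smooth_atlas M" and N: "smooth_atlas N" and F: "diffeo_on M N W F"
  shows "diffeo_on (cotangent_bundle M) (cotangent_bundle N) (cotangent_restrict M W) (cotangent_lift M N F)"
proof -
  note D = diffeo_onD[OF F]
  note G = diffeo_on_inverse[OF M N F]
  have im: "inv_into W F ` F ` W = W" using D(3) by (simp add: image_inv_into_cancel)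
  note H = cotangent_lift_restrict[OF N M G, unfolded im]
  have "cotangent_lift M N F (cotangent_lift N M (inv_into W F) y) = y"
    if y: "y \<in> cotangent_restrict N (F ` W)" for y
  proof -
    \<comment> \<open>The inverse of \<open>inv_into W F\<close> agrees with \<open>F\<close> on
      \<open>W\<close> but may differ elsewhere, so the right-inverse identity is not an instance of
      the left one. It follows by applying the injective lift of the inverse to both sides.\<close>
    have inj: "inj_on (cotangent_lift N M (inv_into W F)) (cotangent_restrict N (F ` W))"
      using H(2) by (metis inj_onI)
    note y' = H(1)[OF y]
    show ?thesis
      using inj_onD[OF inj, of "cotangent_lift M N F (cotangent_lift N M (inv_into W F) y)" y]
        cotangent_lift_restrict[OF M N F y'] y by simp
  qed
  then show ?thesis
    using smooth_map_cotangent_lift[OF M N F] smooth_map_cotangent_lift[OF N M G]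
      cotangent_lift_restrict[OF M N F] H(1)
    by (intro diffeo_onI[OF smooth_atlas_cotangent[OF M] smooth_atlas_cotangent[OF N]]) simp_all
qed

text \<open>In charts the lift is a \<open>covector_lift\<close> and both canonical forms are
  \<open>symplectic_product\<close>, so the Euclidean invariance applies.\<close>

lemma pullback_cotangent_lift:
  assumes M: "smooth_atlas M" and N: "smooth_atlas N" and F: "diffeo_on M N W F"
    and z: "z \<in> cotangent_restrict M W"
    and u: "u \<in> tspace (cotangent_bundle M) z" and v: "v \<in> tspace (cotangent_bundle M) z"
  shows "pullback2 (cotangent_bundle M) (cotangent_bundle N) (cotangent_lift M N F) (canonical_form N) z u v =
    canonical_form M z u v"
proof -
  let ?TM = "cotangent_bundle M" and ?TN = "cotangent_bundle N" and ?L = "cotangent_lift M N F"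
  note TM = smooth_atlas_cotangent[OF M] and TN = smooth_atlas_cotangent[OF N]
  note L = smooth_map_cotangent_lift[OF M N F]
  note D = diffeo_onD[OF F]
  have z': "fst z \<in> W" "snd z \<in> cspace M (fst z)" using z by (auto simp: cotangent_restrict_iff)
  obtain c where c: "c \<in> charts_at M (fst z)" using smooth_map_points(1)[OF D(2) z'(1)] points_iff by metis
  obtain d where d: "d \<in> charts_at N (F (fst z))" using smooth_map_points(2)[OF D(2) z'(1)] points_iff by metis
  note cd = c[unfolded charts_at_iff] d[unfolded charts_at_iff]
  obtain S T where S: "cmap c (fst z) \<in> S" "\<And>y. y \<in> S \<Longrightarrow> F (cinv c y) \<in> cdom d"
    and inv: "smooth_inverses S T (local_rep F c d) (local_rep (inv_into W F) d c)"
    using smooth_inverses_local_rep[OF M N F z'(1) c d] by metis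
  let ?f = "covector_lift (local_rep F c d) (local_rep (inv_into W F) d c)"
  have zS: "cmap (cotangent_chart M c) z \<in> S \<times> UNIV" using S(1) by simp
  note I = smooth_inversesD[OF smooth_inverses_covector_lift[OF inv]]
  have f: "fst (?L z) = F (fst z)" by (simp add: cotangent_lift_def case_prod_beta)
  have Lz: "d \<in> charts_at N (fst (?L z))" "snd (?L z) \<in> cspace N (fst (?L z))"
    using d f cotangent_lift_chart(1)[OF M N F z' c d] by auto
  have "tmap ?TM ?TN ?L z t (cotangent_chart N d) = fderiv ?f (cmap (cotangent_chart M c) z) (t (cotangent_chart M c))"
    if t: "t \<in> tspace ?TM z" for t
  proof (rule tmap_coordinates[OF TM TN L z t cotangent_chart_in[OF c z'(2)] cotangent_chart_in[OF Lz] I(1) zS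
        smooth_on_differentiable[OF I(3) zS]])
    fix w assume "w \<in> cotangent_restrict M W" "w \<in> cdom (cotangent_chart M c)" "cmap (cotangent_chart M c) w \<in> S \<times> UNIV"
    then have w: "fst w \<in> W" "snd w \<in> cspace M (fst w)" "c \<in> charts_at M (fst w)" "cmap c (fst w) \<in> S"
      using cd by (auto simp: cotangent_restrict_iff charts_at_iff)
    have "d \<in> charts_at N (F (fst w))"
      using S(2)[OF w(4)] cinv_cmap[OF M, of c "fst w"] w(3) cd by (simp add: charts_at_iff)
    then show "cmap (cotangent_chart N d) (?L w) = ?f (cmap (cotangent_chart M c) w)"
      using cotangent_lift_chart(2)[OF M N F w(1,2,3)] by blast
  qed
  then show ?thesis
    unfolding pullback2_def
    using canonical_form_coordinates[OF N Lz tmap_in_tspace[OF TM TN L z u] tmap_in_tspace[OF TM TN L z v]]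
      canonical_form_coordinates[OF M c z'(2) u v] symplectic_product_covector_lift[OF inv zS] u v by simp
qed

text \<open>Common pattern of the Tulczyjew map and \<open>Phi\<close>: in charts with the same
  index the map reads as one global diffeomorphism \<sigma>. By \<open>dom\<close>, points with
  equal images lie in a common chart, which gives injectivity; \<open>im\<close> gives
  surjectivity.\<close>

lemma chartwise_diffeo:
  assumes M: "smooth_atlas (K ` I)" and N: "smooth_atlas (L ` I)"
    and s: "smooth_on UNIV \<sigma>" "smooth_on UNIV \<tau>" "\<And>y. \<tau> (\<sigma> y) = y" "\<And>y. \<sigma> (\<tau> y) = y"
    and im: "\<And>i. i \<in> I \<Longrightarrow> cmap (L i) ` cdom (L i) \<subseteq> \<sigma> ` cmap (K i) ` cdom (K i)"
    and dom: "\<And>i x. i \<in> I \<Longrightarrow> x \<in> points (K ` I) \<Longrightarrow> F x \<in> cdom (L i) \<longleftrightarrow> x \<in> cdom (K i)"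
    and F: "\<And>i x. i \<in> I \<Longrightarrow> x \<in> cdom (K i) \<Longrightarrow> cmap (L i) (F x) = \<sigma> (cmap (K i) x)"
  shows "diffeo_on (K ` I) (L ` I) (points (K ` I)) F" "F ` points (K ` I) = points (L ` I)"
proof -
  let ?P = "points (K ` I)" and ?R = "points (L ` I)"
  have P: "x \<in> ?P \<longleftrightarrow> (\<exists>i\<in>I. x \<in> cdom (K i))" for x by (auto simp: points_def)
  have R: "y \<in> ?R \<longleftrightarrow> (\<exists>i\<in>I. y \<in> cdom (L i))" for y by (auto simp: points_def)
  have inj: "inj_on F ?P"
  proof (rule inj_onI)
    fix x y assume x: "x \<in> ?P" and y: "y \<in> ?P" and e: "F x = F y"
    obtain i where i: "i \<in> I" "x \<in> cdom (K i)" using x P by blast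
    then have yi: "y \<in> cdom (K i)" using dom[OF i(1)] x y e by metis
    have "cmap (K i) x = cmap (K i) y" using F[OF i] F[OF i(1) yi] e s(3) by metis
    then show "x = y" using inj_onD[OF smooth_atlasD(1)[OF M]] i yi by blast
  qed
  show surj: "F ` ?P = ?R"
  proof
    show "F ` ?P \<subseteq> ?R" using P R dom by fastforce
    show "?R \<subseteq> F ` ?P"
    proof
      fix y assume "y \<in> ?R"
      then obtain i where i: "i \<in> I" "y \<in> cdom (L i)" using R by blast
      then obtain x where x: "x \<in> cdom (K i)" "cmap (L i) y = \<sigma> (cmap (K i) x)" using im[OF i(1)] by blast
      then have xP: "x \<in> ?P" using i P by blast
      have "F x \<in> cdom (L i)" using dom[OF i(1) xP] x by blast
      then have "F x = y" using inj_onD[OF smooth_atlasD(1)[OF N, of "L i"]] i F[OF i(1) x(1)] x(2) by simp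
      then show "y \<in> F ` ?P" using xP by blast
    qed
  qed
  have FP: "smooth_map (K ` I) (L ` I) ?P F"
  proof (rule smooth_mapI[OF M mopen_points[OF M]])
    fix x assume "x \<in> ?P"
    then obtain i where i: "i \<in> I" "x \<in> cdom (K i)" using P by blast
    show "\<exists>c\<in>charts_at (K ` I) x. \<exists>d\<in>L ` I. \<exists>S f. open S \<and> cmap c x \<in> S \<and> smooth_on S f \<and>
        (\<forall>z\<in>?P \<inter> cdom c. cmap c z \<in> S \<longrightarrow> F z \<in> cdom d \<and> cmap d (F z) = f (cmap c z))"
      using i dom[OF i(1)] F[OF i(1)] s(1)
      by (intro bexI[of _ "K i"] bexI[of _ "L i"] exI[of _ UNIV] exI[of _ \<sigma>]) (auto simp: charts_at_iff)
  qed
  let ?G = "inv_into ?P F"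
  have G: "?G y \<in> ?P" "F (?G y) = y" if "y \<in> ?R" for y
    using that surj inv_into_into[of y F ?P] f_inv_into_f[of y F ?P] by auto
  have GR: "smooth_map (L ` I) (K ` I) ?R ?G"
  proof (rule smooth_mapI[OF N mopen_points[OF N]])
    fix y assume "y \<in> ?R"
    then obtain i where i: "i \<in> I" "y \<in> cdom (L i)" using R by blast
    have "?G z \<in> cdom (K i) \<and> cmap (K i) (?G z) = \<tau> (cmap (L i) z)" if "z \<in> ?R" "z \<in> cdom (L i)" for z
    proof -
      have "?G z \<in> cdom (K i)" using dom[OF i(1) G(1)[OF that(1)]] G(2)[OF that(1)] that(2) by simp
      then show ?thesis using F[OF i(1), of "?G z"] G(2)[OF that(1)] s(3) by simp
    qed
    then show "\<exists>c\<in>charts_at (L ` I) y. \<exists>d\<in>K ` I. \<exists>S f. open S \<and> cmap c y \<in> S \<and> smooth_on S f \<and>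
        (\<forall>z\<in>?R \<inter> cdom c. cmap c z \<in> S \<longrightarrow> ?G z \<in> cdom d \<and> cmap d (?G z) = f (cmap c z))"
      using i s(2)
      by (intro bexI[of _ "L i"] bexI[of _ "K i"] exI[of _ UNIV] exI[of _ \<tau>]) (auto simp: charts_at_iff)
  qed
  show "diffeo_on (K ` I) (L ` I) ?P F"
    by (rule diffeo_onI[OF M N FP GR]) (use G surj inj in auto)
qed

text \<open>A bounded linear map is its own derivative.\<close>

lemma tmap_chartwise:
  assumes M: "smooth_atlas M" and N: "smooth_atlas N" and F: "smooth_map M N W F" and x: "x \<in> W"
    and v: "v \<in> tspace M x" and c: "c \<in> charts_at M x" and d: "d \<in> charts_at N (F x)"
    and f: "bounded_linear f" and eq: "\<And>z. z \<in> W \<Longrightarrow> z \<in> cdom c \<Longrightarrow> cmap d (F z) = f (cmap c z)"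
  shows "tmap M N F x v d = f (v c)"
proof -
  note h = bounded_linear_imp_has_derivative[OF f, of "at (cmap c x)"]
  have "f differentiable (at (cmap c x))" using h differentiable_def by blast
  from tmap_coordinates[OF M N F x v c d open_UNIV UNIV_I this eq] show ?thesis
    using fderiv_eqI[OF h] by simp
qed

section \<open>The Tulczyjew map\<close>

definition interchange_inv :: "('a \<times> 'c) \<times> ('d \<times> 'b) \<Rightarrow> ('a \<times> 'b) \<times> ('c \<times> 'd)" where
  "interchange_inv = (\<lambda>((q, q'), (p', p)). ((q, p), (q', p')))"

lemma interchange_inverses [simp]:
  "interchange_inv (interchange y) = y" "interchange (interchange_inv z) = z"
  by (auto simp: interchange_def interchange_inv_def case_prod_beta)

lemma interchange_eq: "interchange y = ((fst (fst y), fst (snd y)), (snd (snd y), snd (fst y)))"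
  by (simp add: interchange_def case_prod_beta)

lemma interchange_inv_eq: "interchange_inv y = ((fst (fst y), snd (snd y)), (snd (fst y), fst (snd y)))"
  by (simp add: interchange_inv_def case_prod_beta)

lemma bounded_linear_interchange: "bounded_linear (interchange :: (_ \<times> _ :: euclidean_space) \<times> _ \<Rightarrow> _)"
  unfolding interchange_eq[abs_def]
  by (intro bounded_linear_Pair bounded_linear_compose[OF bounded_linear_fst]
      bounded_linear_compose[OF bounded_linear_snd] bounded_linear_fst bounded_linear_snd)

lemma smooth_on_interchange:
  "smooth_on UNIV (interchange :: ('a::euclidean_space \<times> 'b::euclidean_space) \<times> ('c::euclidean_space \<times> 'd::euclidean_space) \<Rightarrow> _)"
  "smooth_on UNIV (interchange_inv :: ('a \<times> 'c) \<times> ('d \<times> 'b) \<Rightarrow> _)"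
  unfolding interchange_eq[abs_def] interchange_inv_eq[abs_def]
  by (intro smooth_on_Pair smooth_on_fst smooth_on_snd smooth_on_ident open_UNIV)+

lemma transition_tangent_chart:
  assumes M: "smooth_atlas M" and c: "c \<in> M" "d \<in> M" and y: "y \<in> cmap c ` (cdom c \<inter> cdom d) \<times> UNIV"
  shows "transition (tangent_chart M c) (tangent_chart M d) y = tangent_lift (transition c d) y"
proof -
  from y obtain z where z: "y = cmap (tangent_chart M c) z" "fst z \<in> cdom c \<inter> cdom d" "snd z \<in> tspace M (fst z)"
    unfolding image_tangent_chart[OF M c(1) Int_lower1, symmetric] by blast
  have "tangent_chart M c \<in> tangent_bundle M" using c by (simp add: tangent_bundle_def)
  then show ?thesis
    using z c transition_cmap[OF smooth_atlas_tangent[OF M], of "tangent_chart M c" z "tangent_chart M d"]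
      tangent_chart_change[OF M, of c z d] by (simp add: charts_at_iff)
qed

lemma transition_cotangent_chart:
  assumes M: "smooth_atlas M" and c: "c \<in> M" "d \<in> M" and y: "y \<in> cmap c ` (cdom c \<inter> cdom d) \<times> UNIV"
  shows "transition (cotangent_chart M c) (cotangent_chart M d) y =
    covector_lift (transition c d) (transition d c) y"
proof -
  from y obtain z where z: "y = cmap (cotangent_chart M c) z" "fst z \<in> cdom c \<inter> cdom d" "snd z \<in> cspace M (fst z)"
    unfolding image_cotangent_chart[OF M c(1) Int_lower1, symmetric] by blast
  have "cotangent_chart M c \<in> cotangent_bundle M" using c by (simp add: cotangent_bundle_def)
  then show ?thesis
    using z c transition_cmap[OF smooth_atlas_cotangent[OF M], of "cotangent_chart M c" z "cotangent_chart M d"]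
      cotangent_chart_change[OF M, of c z d] by (simp add: charts_at_iff)
qed

text \<open>A bundle transition is known to be a lift only on the overlap. As lifting involves
  derivatives, replacing it inside a second lift needs agreement on an open set around the
  point.\<close>

lemma tangent_lift_cong:
  assumes "open S" "fst z \<in> S" "smooth_on S F" "\<And>y. y \<in> S \<Longrightarrow> F y = G y"
  shows "tangent_lift F z = tangent_lift G z"
  using fderiv_cong[OF assms(1,2) smooth_on_differentiable[OF assms(3,2)] assms(4)] assms(2,4)
  by (simp add: tangent_lift_def)

lemma covector_lift_cong:
  assumes "open T" "F (fst z) \<in> T" "smooth_on T G" "\<And>y. y \<in> T \<Longrightarrow> G y = G' y" "F (fst z) = F' (fst z)"
  shows "covector_lift F G z = covector_lift F' G' z"
  using fderiv_cong[OF assms(1,2) smooth_on_differentiable[OF assms(3,2)] assms(4)] assms(5)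
  by (simp add: covector_lift_def)

text \<open>In these names \<open>s\<close> stands for the star: \<open>TTs Q\<close> is \<open>T(T\<^sup>*Q)\<close>, \<open>TsT Q\<close> is
  \<open>T\<^sup>*(TQ)\<close>, \<open>TsTs Q\<close> is \<open>T\<^sup>*Q \<times> T\<^sup>*Q\<close>, and \<open>TsQQ Q\<close> is \<open>T\<^sup>*(Q \<times> Q)\<close>.\<close>

abbreviation (input) "TTs Q \<equiv> tangent_bundle (cotangent_bundle Q)"
abbreviation (input) "TsT Q \<equiv> cotangent_bundle (tangent_bundle Q)"
abbreviation (input) "TsTs Q \<equiv> prod_manifold (cotangent_bundle Q) (cotangent_bundle Q)"
abbreviation (input) "TsQQ Q \<equiv> cotangent_bundle (prod_manifold Q Q)"

abbreviation (input) TsT_chart where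
  "TsT_chart Q c \<equiv> cotangent_chart (tangent_bundle Q) (tangent_chart Q c)"

text \<open>The definite description is meaningful because one covector meets the requirement in all
  charts at once. Uniqueness is injectivity of a single chart; existence is settled in the chart
  \<open>c\<close> and transported by \<open>interchange_tangent_covector_lift\<close>.\<close>

lemma tulczyjew_chart:
  fixes Q :: "('a, 'e::euclidean_space) atlas"
  assumes Q: "smooth_atlas Q" and c: "c \<in> charts_at Q (fst (fst \<xi>))"
    and \<xi>: "\<xi> \<in> points (TTs Q)"
  shows "tulczyjew Q \<xi> \<in> cdom (TsT_chart Q c)"
    "cmap (TsT_chart Q c) (tulczyjew Q \<xi>) = interchange (cmap (TTs_chart Q c) \<xi>)"
proof -
  note TQ = smooth_atlas_tangent[OF Q] and CQ = smooth_atlas_cotangent[OF Q]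
  let ?x = "fst (fst \<xi>)"
  let ?P = "\<lambda>\<zeta>. \<forall>c\<in>charts_at Q ?x. \<zeta> \<in> cdom (TsT_chart Q c) \<and>
    cmap (TsT_chart Q c) \<zeta> = interchange (cmap (TTs_chart Q c) \<xi>)"
  have tul: "tulczyjew Q \<xi> = (THE \<zeta>. ?P \<zeta>)"
    unfolding tulczyjew_def Let_def interchange_def by (simp only: case_prod_beta fst_conv snd_conv)
  have \<xi>': "snd (fst \<xi>) \<in> cspace Q ?x" "snd \<xi> \<in> tspace (cotangent_bundle Q) (fst \<xi>)"
    using \<xi> by (auto simp: points_tangent points_cotangent)
  have "\<exists>!\<zeta>. ?P \<zeta>"
  proof (rule ex_ex1I)
    fix \<zeta> \<eta> assume "?P \<zeta>" "?P \<eta>"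
    moreover have "TsT_chart Q c \<in> TsT Q"
      using c by (simp add: cotangent_bundle_def tangent_bundle_def charts_at_iff)
    ultimately show "\<zeta> = \<eta>"
      using inj_onD[OF smooth_atlasD(1)[OF smooth_atlas_cotangent[OF TQ]], of "TsT_chart Q c" \<zeta> \<eta>] c by metis
  next
    have c': "c \<in> Q" "?x \<in> cdom c" using c by (auto simp: charts_at_iff)
    have tc: "tangent_chart Q c \<in> tangent_bundle Q" using c' by (simp add: tangent_bundle_def)
    have "cdom (tangent_chart Q c) = {z. fst z \<in> cdom c \<and> snd z \<in> tspace Q (fst z)}" by auto
    then have im: "cmap (TsT_chart Q c) ` {z. fst z \<in> cdom (tangent_chart Q c) \<and> snd z \<in> cspace (tangent_bundle Q) (fst z)} =
        (cmap c ` cdom c \<times> UNIV) \<times> UNIV"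
      using image_tangent_chart[OF Q c'(1) order_refl]
      unfolding image_cotangent_chart[OF TQ tc order_refl] by (simp only:)
    have "interchange (cmap (TTs_chart Q c) \<xi>) \<in> (cmap c ` cdom c \<times> UNIV) \<times> UNIV"
      using c' by (simp add: interchange_eq TTs_chart_def)
    \<comment> \<open>The candidate is prescribed by its coordinates in the chart \<open>c\<close>,
      whose image fills both fibre directions.\<close>
    then obtain \<zeta> where "\<zeta> \<in> {z. fst z \<in> cdom (tangent_chart Q c) \<and> snd z \<in> cspace (tangent_bundle Q) (fst z)}"
      and e: "interchange (cmap (TTs_chart Q c) \<xi>) = cmap (TsT_chart Q c) \<zeta>"
      unfolding im[symmetric] by (rule imageE)
    then have \<zeta>: "fst \<zeta> \<in> cdom (tangent_chart Q c)" "snd \<zeta> \<in> cspace (tangent_bundle Q) (fst \<zeta>)"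
      "cmap (TsT_chart Q c) \<zeta> = interchange (cmap (TTs_chart Q c) \<xi>)" unfolding mem_Collect_eq by simp_all
    have "cmap c (fst (fst \<zeta>)) = cmap c ?x"
      using \<zeta>(3) by (simp add: interchange_eq TTs_chart_def)
    then have x: "fst (fst \<zeta>) = ?x"
      using inj_onD[OF smooth_atlasD(1)[OF Q c'(1)]] \<zeta>(1) c'(2) by simp
    have "?P \<zeta>"
    proof
      fix d assume d: "d \<in> charts_at Q ?x"
      then have d': "d \<in> Q" "?x \<in> cdom d" by (auto simp: charts_at_iff)
      have td: "tangent_chart Q d \<in> tangent_bundle Q" using d' by (simp add: tangent_bundle_def)
      have tcz: "tangent_chart Q c \<in> charts_at (tangent_bundle Q) (fst \<zeta>)"
        "tangent_chart Q d \<in> charts_at (tangent_bundle Q) (fst \<zeta>)"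
        using \<zeta>(1) x d' tc td by (simp_all add: charts_at_iff)
      let ?\<phi> = "transition c d" and ?\<psi> = "transition d c"
      note inv = smooth_inverses_transition[OF Q c'(1) d'(1)]
      let ?A = "cmap c ` (cdom c \<inter> cdom d)" and ?B = "cmap d ` (cdom c \<inter> cdom d)"
      note C = smooth_inverses_covector_lift[OF inv] and T = smooth_inverses_tangent_lift[OF inv]
      let ?y = "cmap (TTs_chart Q c) \<xi>"
      have yA: "fst ?y \<in> ?A \<times> UNIV" using c'(2) d'(2) by (simp add: TTs_chart_def)
      have y'A: "fst (interchange ?y) \<in> ?A \<times> UNIV" using c'(2) d'(2) by (simp add: TTs_chart_def interchange_eq)
      \<comment> \<open>On the source bundle the chart change is the tangent lift of a covector
        lift.\<close>
      have "cmap (TTs_chart Q d) \<xi> = tangent_lift (transition (cotangent_chart Q c) (cotangent_chart Q d)) ?y"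
        unfolding TTs_chart_def
        by (rule tangent_chart_change[OF CQ cotangent_chart_in[OF c \<xi>'(1)] cotangent_chart_in[OF d \<xi>'(1)] \<xi>'(2)])
      also have "\<dots> = tangent_lift (covector_lift ?\<phi> ?\<psi>) ?y"
        by (rule tangent_lift_cong[symmetric, OF smooth_inversesD(1)[OF C] yA smooth_inversesD(3)[OF C]])
          (rule transition_cotangent_chart[OF Q c'(1) d'(1), symmetric])
      finally have 1: "interchange (cmap (TTs_chart Q d) \<xi>) =
          covector_lift (tangent_lift ?\<phi>) (tangent_lift ?\<psi>) (interchange ?y)"
        using interchange_tangent_covector_lift[OF inv yA, of "snd ?y"] by simp
      \<comment> \<open>On the target bundle it is the covector lift of a tangent lift;
        \<open>interchange\<close> intertwines the two changes.\<close>
      have "cmap (TsT_chart Q d) \<zeta> = covector_lift (transition (tangent_chart Q c) (tangent_chart Q d))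
          (transition (tangent_chart Q d) (tangent_chart Q c)) (interchange ?y)"
        using cotangent_chart_change[OF TQ tcz \<zeta>(2)] unfolding \<zeta>(3) .
      also have "\<dots> = covector_lift (tangent_lift ?\<phi>) (tangent_lift ?\<psi>) (interchange ?y)"
      proof (rule covector_lift_cong[symmetric, where F = "tangent_lift ?\<phi>" and G = "tangent_lift ?\<psi>",
            OF smooth_inversesD(2)[OF T] smooth_inversesD(5)[OF T y'A] smooth_inversesD(4)[OF T]])
        show "tangent_lift ?\<psi> y = transition (tangent_chart Q d) (tangent_chart Q c) y" if "y \<in> ?B \<times> UNIV" for y
          using transition_tangent_chart[OF Q d'(1) c'(1), of y] that by (simp add: Int_commute)
        show "tangent_lift ?\<phi> (fst (interchange ?y)) =
            transition (tangent_chart Q c) (tangent_chart Q d) (fst (interchange ?y))"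
          using transition_tangent_chart[OF Q c'(1) d'(1) y'A] by simp
      qed
      finally show "\<zeta> \<in> cdom (TsT_chart Q d) \<and> cmap (TsT_chart Q d) \<zeta> = interchange (cmap (TTs_chart Q d) \<xi>)"
        using 1 \<zeta>(1,2) x d'(2) by simp
    qed
    then show "\<exists>\<zeta>. ?P \<zeta>" by blast
  qed
  from theI'[OF this] show "tulczyjew Q \<xi> \<in> cdom (TsT_chart Q c)"
    "cmap (TsT_chart Q c) (tulczyjew Q \<xi>) = interchange (cmap (TTs_chart Q c) \<xi>)"
    unfolding tul using c by blast+
qed

text \<open>Indexes the atlas of the double bundle by charts of \<open>Q\<close>, the form in which
  \<open>chartwise_diffeo\<close> pairs source and target charts.\<close>

lemma TTs_atlas: "TTs Q = TTs_chart Q ` Q"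
  using image_image[of "tangent_chart (cotangent_bundle Q)" "cotangent_chart Q" Q]
  unfolding TTs_chart_def cotangent_bundle_def[symmetric] tangent_bundle_def[symmetric] .

lemma TsT_atlas: "TsT Q = TsT_chart Q ` Q"
  using image_image[of "cotangent_chart (tangent_bundle Q)" "tangent_chart Q" Q]
  unfolding cotangent_bundle_def[symmetric] tangent_bundle_def[symmetric] .

lemma cdom_TTs_chart: "\<xi> \<in> cdom (TTs_chart Q c) \<longleftrightarrow> fst (fst \<xi>) \<in> cdom c \<and>
    snd (fst \<xi>) \<in> cspace Q (fst (fst \<xi>)) \<and> snd \<xi> \<in> tspace (cotangent_bundle Q) (fst \<xi>)"
  by (simp add: TTs_chart_def)

lemma diffeo_on_tulczyjew:
  fixes Q :: "('a, 'e::euclidean_space) atlas"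
  assumes Q: "smooth_atlas Q"
  defines "P \<equiv> points (TTs Q)"
  shows "diffeo_on (TTs Q) (TsT Q) P (tulczyjew Q)"
    "tulczyjew Q ` P = points (TsT Q)"
proof -
  note TQ = smooth_atlas_tangent[OF Q] and CQ = smooth_atlas_cotangent[OF Q]
  have P: "\<xi> \<in> P \<longleftrightarrow> fst (fst \<xi>) \<in> points Q \<and> snd (fst \<xi>) \<in> cspace Q (fst (fst \<xi>)) \<and>
      snd \<xi> \<in> tspace (cotangent_bundle Q) (fst \<xi>)" for \<xi>
    by (auto simp: P_def points_tangent points_cotangent)
  \<comment> \<open>The map covers the identity of \<open>Q\<close>, so membership in corresponding
    chart domains is equivalent before and after it.\<close>
  have x: "fst (fst (tulczyjew Q \<xi>)) = fst (fst \<xi>)" if \<xi>: "\<xi> \<in> P" for \<xi>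
  proof -
    obtain c where c: "c \<in> charts_at Q (fst (fst \<xi>))" using \<xi> unfolding P points_iff[of "fst (fst \<xi>)"] by blast
    note t = tulczyjew_chart[OF Q c \<xi>[unfolded P_def]]
    have "cmap c (fst (fst (tulczyjew Q \<xi>))) = cmap c (fst (fst \<xi>))"
      using t(2) by (simp add: interchange_eq TTs_chart_def)
    then show ?thesis
      using inj_onD[OF smooth_atlasD(1)[OF Q, of c]] t(1) c by (simp add: charts_at_iff)
  qed
  have ch: "c \<in> charts_at Q (fst (fst \<xi>))" "\<xi> \<in> P" if "c \<in> Q" "\<xi> \<in> cdom (TTs_chart Q c)" for c \<xi>
    using that by (auto simp: charts_at_iff cdom_TTs_chart P points_iff[of "fst (fst \<xi>)"])
  have im: "cmap (TsT_chart Q c) ` cdom (TsT_chart Q c) \<subseteq> interchange ` cmap (TTs_chart Q c) ` cdom (TTs_chart Q c)"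
    if c: "c \<in> Q" for c
  proof (rule image_subsetI)
    fix \<zeta> assume \<zeta>: "\<zeta> \<in> cdom (TsT_chart Q c)"
    let ?y = "interchange_inv (cmap (TsT_chart Q c) \<zeta>)"
    have c1: "c \<in> charts_at Q (fst (fst \<zeta>))" using \<zeta> c by (simp add: charts_at_iff)
    \<comment> \<open>The preimage is assembled from the coordinates \<open>?y\<close>: first the
      covector with momentum \<open>snd (fst ?y)\<close>, then over it the tangent vector with
      component \<open>snd ?y\<close>.\<close>
    define z where "z = (fst (fst \<zeta>), covec_of Q c (fst (fst \<zeta>)) (snd (fst ?y)))"
    have z: "cotangent_chart Q c \<in> charts_at (cotangent_bundle Q) z"
      using c1 by (intro cotangent_chart_in) (simp_all add: z_def covec_of_in_cspace[OF Q])
    define \<xi> where "\<xi> = (z, tvec_of (cotangent_bundle Q) (cotangent_chart Q c) z (snd ?y))"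
    have "\<xi> \<in> cdom (TTs_chart Q c)"
      using \<zeta> tvec_of_in_tspace[OF CQ z] by (simp add: cdom_TTs_chart \<xi>_def) (simp add: z_def covec_of_in_cspace[OF Q])
    moreover have "cmap (TTs_chart Q c) \<xi> = ?y"
      unfolding TTs_chart_def \<xi>_def snd_tangent_chart fst_conv snd_conv tvec_of_apply[OF CQ z]
      by (simp add: z_def covec_comp_of[OF Q c1]) (simp add: interchange_inv_eq)
    then have "cmap (TsT_chart Q c) \<zeta> = interchange (cmap (TTs_chart Q c) \<xi>)" by simp
    ultimately show "cmap (TsT_chart Q c) \<zeta> \<in> interchange ` cmap (TTs_chart Q c) ` cdom (TTs_chart Q c)" by blast
  qed
  have dom: "tulczyjew Q \<xi> \<in> cdom (TsT_chart Q c) \<longleftrightarrow> \<xi> \<in> cdom (TTs_chart Q c)" if c: "c \<in> Q" and \<xi>: "\<xi> \<in> P" for c \<xi>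
  proof
    assume "tulczyjew Q \<xi> \<in> cdom (TsT_chart Q c)"
    then show "\<xi> \<in> cdom (TTs_chart Q c)" using x[OF \<xi>] \<xi> by (simp add: cdom_TTs_chart P)
  next
    assume "\<xi> \<in> cdom (TTs_chart Q c)"
    from tulczyjew_chart(1)[OF Q ch[OF c this, unfolded P_def]] show "tulczyjew Q \<xi> \<in> cdom (TsT_chart Q c)" .
  qed
  have co: "cmap (TsT_chart Q c) (tulczyjew Q \<xi>) = interchange (cmap (TTs_chart Q c) \<xi>)"
    if "c \<in> Q" "\<xi> \<in> cdom (TTs_chart Q c)" for c \<xi>
    by (rule tulczyjew_chart(2)[OF Q ch[OF that, unfolded P_def]])
  note cd = chartwise_diffeo[where K = "TTs_chart Q" and L = "TsT_chart Q" and I = Q and \<sigma> = interchange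
      and \<tau> = interchange_inv and F = "tulczyjew Q", folded TTs_atlas TsT_atlas P_def,
      OF smooth_atlas_tangent[OF CQ] smooth_atlas_cotangent[OF TQ] smooth_on_interchange
      interchange_inverses im dom co]
  show "diffeo_on (TTs Q) (TsT Q) P (tulczyjew Q)"
    "tulczyjew Q ` P = points (TsT Q)"
    by (rule cd(1), simp_all) (rule cd(2), simp_all)
qed

text \<open>The pulled-back form has in every chart the expression required by the definite
  description in \<open>dT_canonical_form\<close>. Chart independence of the latter thus comes
  together with the equality.\<close>

lemma pullback_tulczyjew:
  fixes Q :: "('a, 'e::euclidean_space) atlas"
  assumes Q: "smooth_atlas Q" and \<xi>: "\<xi> \<in> points (TTs Q)"
    and u: "u \<in> tspace (TTs Q) \<xi>"
    and w: "w \<in> tspace (TTs Q) \<xi>"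
  shows "pullback2 (TTs Q) (TsT Q) (tulczyjew Q)
      (canonical_form (tangent_bundle Q)) \<xi> u w = dT_canonical_form Q \<xi> u w"
proof -
  note TQ = smooth_atlas_tangent[OF Q] and CQ = smooth_atlas_cotangent[OF Q]
  note M = smooth_atlas_tangent[OF CQ] and N = smooth_atlas_cotangent[OF TQ]
  let ?l = "pullback2 (TTs Q) (TsT Q) (tulczyjew Q)
      (canonical_form (tangent_bundle Q)) \<xi> u w"
  note F = diffeo_onD(2)[OF diffeo_on_tulczyjew(1)[OF Q]]
  have \<xi>': "snd (fst \<xi>) \<in> cspace Q (fst (fst \<xi>))" "snd \<xi> \<in> tspace (cotangent_bundle Q) (fst \<xi>)"
      "fst (fst \<xi>) \<in> points Q"
    using \<xi> by (auto simp: points_tangent points_cotangent)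
  have l: "?l = symplectic_product (interchange (u (TTs_chart Q c))) (interchange (w (TTs_chart Q c)))"
    if c: "c \<in> charts_at Q (fst (fst \<xi>))" for c
  proof -
    note t = tulczyjew_chart[OF Q c \<xi>]
    have c': "c \<in> Q" using c by (simp add: charts_at_iff)
    have K: "TTs_chart Q c \<in> charts_at (TTs Q) \<xi>"
      using c \<xi>' unfolding TTs_atlas by (simp add: charts_at_iff cdom_TTs_chart)
    have tc: "tangent_chart Q c \<in> charts_at (tangent_bundle Q) (fst (tulczyjew Q \<xi>))"
      "snd (tulczyjew Q \<xi>) \<in> cspace (tangent_bundle Q) (fst (tulczyjew Q \<xi>))"
      using t(1) c' by (simp_all add: charts_at_iff tangent_bundle_def)
    note L = cotangent_chart_in[OF tc]
    have e: "tmap (TTs Q) (TsT Q) (tulczyjew Q) \<xi> v (TsT_chart Q c)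
        = interchange (v (TTs_chart Q c))" if v: "v \<in> tspace (TTs Q) \<xi>" for v
    proof (rule tmap_chartwise[OF M N F \<xi> v K L bounded_linear_interchange])
      fix z assume "z \<in> points (TTs Q)" "z \<in> cdom (TTs_chart Q c)"
      then show "cmap (TsT_chart Q c) (tulczyjew Q z) = interchange (cmap (TTs_chart Q c) z)"
        using c' by (intro tulczyjew_chart(2)[OF Q]) (simp_all add: cdom_TTs_chart charts_at_iff)
    qed
    show ?thesis
      unfolding pullback2_def canonical_form_coordinates[OF TQ tc tmap_in_tspace[OF M N F \<xi> u] tmap_in_tspace[OF M N F \<xi> w]]
        e[OF u] e[OF w] ..
  qed
  have "dT_canonical_form Q \<xi> u w = (THE r. \<forall>c\<in>charts_at Q (fst (fst \<xi>)).
      r = symplectic_product (interchange (u (TTs_chart Q c))) (interchange (w (TTs_chart Q c))))"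
    unfolding dT_canonical_form_def
    by (simp add: symplectic_product_def interchange_def case_prod_beta algebra_simps)
  also have "\<dots> = ?l"
  proof (rule the_equality)
    show "\<forall>c\<in>charts_at Q (fst (fst \<xi>)). ?l = symplectic_product (interchange (u (TTs_chart Q c))) (interchange (w (TTs_chart Q c)))"
      using l by blast
    obtain c where c: "c \<in> charts_at Q (fst (fst \<xi>))" using \<xi>'(3) unfolding points_iff by blast
    fix r assume "\<forall>c\<in>charts_at Q (fst (fst \<xi>)). r = symplectic_product (interchange (u (TTs_chart Q c))) (interchange (w (TTs_chart Q c)))"
    then show "r = ?l" using l[OF c] c by simp
  qed
  finally show ?thesis by simp
qed

section \<open>The map from pairs of covectors to covectors of the product\<close>

lemma smooth_map_prod_fst_snd:
  assumes M: "smooth_atlas M" and N: "smooth_atlas N"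
  shows "smooth_map (prod_manifold M N) M (points (prod_manifold M N)) fst"
    "smooth_map (prod_manifold M N) N (points (prod_manifold M N)) snd"
proof -
  note MN = smooth_atlas_prod[OF M N]
  note f = smooth_on_fst[OF smooth_on_ident open_UNIV] and s = smooth_on_snd[OF smooth_on_ident open_UNIV]
  have ex: "\<exists>c d. c \<in> M \<and> d \<in> N \<and> prod_chart c d \<in> charts_at (prod_manifold M N) z"
    if "z \<in> points (prod_manifold M N)" for z
  proof -
    from that obtain k where "k \<in> charts_at (prod_manifold M N) z" using points_iff by metis
    then show ?thesis by (metis charts_at_iff charts_at_prodE)
  qed
  show "smooth_map (prod_manifold M N) M (points (prod_manifold M N)) fst"
  proof (rule smooth_mapI[OF MN mopen_points[OF MN]])
    fix z assume "z \<in> points (prod_manifold M N)"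
    from ex[OF this] obtain c d where c: "c \<in> M" "d \<in> N" "prod_chart c d \<in> charts_at (prod_manifold M N) z" by blast
    show "\<exists>k\<in>charts_at (prod_manifold M N) z. \<exists>l\<in>M. \<exists>S f. open S \<and> cmap k z \<in> S \<and> smooth_on S f \<and>
      (\<forall>w\<in>points (prod_manifold M N) \<inter> cdom k. cmap k w \<in> S \<longrightarrow> fst w \<in> cdom l \<and> cmap l (fst w) = f (cmap k w))"
      by (rule bexI[OF _ c(3)], rule bexI[OF _ c(1)], rule exI[of _ UNIV], rule exI[of _ fst]) (use f in auto)
  qed
  show "smooth_map (prod_manifold M N) N (points (prod_manifold M N)) snd"
  proof (rule smooth_mapI[OF MN mopen_points[OF MN]])
    fix z assume "z \<in> points (prod_manifold M N)"
    from ex[OF this] obtain c d where c: "c \<in> M" "d \<in> N" "prod_chart c d \<in> charts_at (prod_manifold M N) z" by blast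
    show "\<exists>k\<in>charts_at (prod_manifold M N) z. \<exists>l\<in>N. \<exists>S f. open S \<and> cmap k z \<in> S \<and> smooth_on S f \<and>
      (\<forall>w\<in>points (prod_manifold M N) \<inter> cdom k. cmap k w \<in> S \<longrightarrow> snd w \<in> cdom l \<and> cmap l (snd w) = f (cmap k w))"
      by (rule bexI[OF _ c(3)], rule bexI[OF _ c(2)], rule exI[of _ UNIV], rule exI[of _ snd]) (use s in auto)
  qed
qed

lemma tmap_prod_fst_snd:
  assumes M: "smooth_atlas M" and N: "smooth_atlas N"
    and c: "c \<in> charts_at M (fst z)" and d: "d \<in> charts_at N (snd z)"
    and w: "w \<in> tspace (prod_manifold M N) z"
  shows "tmap (prod_manifold M N) M fst z w c = fst (w (prod_chart c d))"
    "tmap (prod_manifold M N) N snd z w d = snd (w (prod_chart c d))"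
proof -
  note MN = smooth_atlas_prod[OF M N]
  have k: "prod_chart c d \<in> charts_at (prod_manifold M N) z" using prod_chart_in[OF c d] by simp
  then have z: "z \<in> points (prod_manifold M N)" using points_iff by metis
  show "tmap (prod_manifold M N) M fst z w c = fst (w (prod_chart c d))"
    by (rule tmap_chartwise[OF MN M smooth_map_prod_fst_snd(1)[OF M N] z w k c bounded_linear_fst]) simp
  show "tmap (prod_manifold M N) N snd z w d = snd (w (prod_chart c d))"
    by (rule tmap_chartwise[OF MN N smooth_map_prod_fst_snd(2)[OF M N] z w k d bounded_linear_snd]) simp
qed

text \<open>\<open>Phi\<close> in product charts; the sign on the first momentum accounts for the
  minus sign of the first factor in \<open>Omega12\<close>.\<close>

definition phi_local :: "('e::euclidean_space \<times> 'e) \<times> ('e \<times> 'e) \<Rightarrow> ('e \<times> 'e) \<times> ('e \<times> 'e)" where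
  "phi_local y = ((fst (fst y), fst (snd y)), (- snd (fst y), snd (snd y)))"

definition phi_local_inv :: "('e::euclidean_space \<times> 'e) \<times> ('e \<times> 'e) \<Rightarrow> ('e \<times> 'e) \<times> ('e \<times> 'e)" where
  "phi_local_inv y = ((fst (fst y), - fst (snd y)), (snd (fst y), snd (snd y)))"

lemma phi_local_inverses [simp]: "phi_local_inv (phi_local y) = y" "phi_local (phi_local_inv y) = y"
  by (simp_all add: phi_local_def phi_local_inv_def)

lemma bounded_linear_phi_local: "bounded_linear phi_local"
  unfolding phi_local_def[abs_def]
  by (intro bounded_linear_Pair bounded_linear_minus bounded_linear_compose[OF bounded_linear_fst]
      bounded_linear_compose[OF bounded_linear_snd] bounded_linear_fst bounded_linear_snd)

lemma bounded_linear_phi_local_inv: "bounded_linear phi_local_inv"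
  unfolding phi_local_inv_def[abs_def]
  by (intro bounded_linear_Pair bounded_linear_minus bounded_linear_compose[OF bounded_linear_fst]
      bounded_linear_compose[OF bounded_linear_snd] bounded_linear_fst bounded_linear_snd)

abbreviation (input) TsTs_chart where
  "TsTs_chart Q \<equiv> \<lambda>(c, d). prod_chart (cotangent_chart Q c) (cotangent_chart Q d)"

abbreviation (input) TsQQ_chart where
  "TsQQ_chart Q \<equiv> \<lambda>(c, d). cotangent_chart (prod_manifold Q Q) (prod_chart c d)"

lemma TsTs_atlas: "TsTs Q = TsTs_chart Q ` (Q \<times> Q)"
  by (force simp: prod_manifold_eq cotangent_bundle_def image_iff)

lemma TsQQ_atlas: "TsQQ Q = TsQQ_chart Q ` (Q \<times> Q)"
proof -
  have "cotangent_chart (prod_manifold Q Q) ` (\<lambda>(c, d). prod_chart c d) ` (Q \<times> Q) = TsQQ_chart Q ` (Q \<times> Q)"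
    by (simp add: image_image case_prod_beta)
  then show ?thesis unfolding prod_manifold_eq[symmetric] cotangent_bundle_def[symmetric] .
qed

lemma Phi_eq:
  assumes Q: "smooth_atlas Q" and c: "c \<in> charts_at Q (fst (fst z))" and d: "d \<in> charts_at Q (fst (snd z))"
    and z: "snd (fst z) \<in> cspace Q (fst (fst z))" "snd (snd z) \<in> cspace Q (fst (snd z))"
  shows "Phi Q z = ((fst (fst z), fst (snd z)), covec_of (prod_manifold Q Q) (prod_chart c d) (fst (fst z), fst (snd z))
      (- covec_comp Q c (fst (fst z)) (snd (fst z)), covec_comp Q d (fst (snd z)) (snd (snd z))))"
proof -
  let ?x = "(fst (fst z), fst (snd z))"
  note QQ = smooth_atlas_prod[OF Q Q]
  have x: "?x \<in> points (prod_manifold Q Q)"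
    using prod_chart_in[OF c d] points_iff by metis
  have c': "c \<in> charts_at Q (fst ?x)" and d': "d \<in> charts_at Q (snd ?x)" using c d by simp_all
  have "- snd (fst z) (tmap (prod_manifold Q Q) Q fst ?x w) + snd (snd z) (tmap (prod_manifold Q Q) Q snd ?x w)
      = (- covec_comp Q c (fst (fst z)) (snd (fst z)), covec_comp Q d (fst (snd z)) (snd (snd z))) \<bullet> w (prod_chart c d)"
    if w: "w \<in> tspace (prod_manifold Q Q) ?x" for w
    using covec_apply[OF Q z(1) c, of "tmap (prod_manifold Q Q) Q fst ?x w"]
      covec_apply[OF Q z(2) d, of "tmap (prod_manifold Q Q) Q snd ?x w"]
      tmap_in_tspace[OF QQ Q smooth_map_prod_fst_snd(1)[OF Q Q] x w]
      tmap_in_tspace[OF QQ Q smooth_map_prod_fst_snd(2)[OF Q Q] x w]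
      tmap_prod_fst_snd[OF Q Q c' d' w] by (simp add: inner_prod_def)
  then show ?thesis by (auto simp: Phi_def covec_of_def case_prod_beta)
qed

lemma Phi_chart:
  assumes Q: "smooth_atlas Q" and z: "z \<in> cdom (TsTs_chart Q (c, d))" and cd: "c \<in> Q" "d \<in> Q"
  shows "Phi Q z \<in> cdom (TsQQ_chart Q (c, d))"
    "cmap (TsQQ_chart Q (c, d)) (Phi Q z) = phi_local (cmap (TsTs_chart Q (c, d)) z)"
proof -
  have z': "c \<in> charts_at Q (fst (fst z))" "d \<in> charts_at Q (fst (snd z))"
    "snd (fst z) \<in> cspace Q (fst (fst z))" "snd (snd z) \<in> cspace Q (fst (snd z))"
    using z cd by (auto simp: charts_at_iff mem_Times_iff)
  note k = prod_chart_in[OF z'(1,2)]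
  show "Phi Q z \<in> cdom (TsQQ_chart Q (c, d))"
    "cmap (TsQQ_chart Q (c, d)) (Phi Q z) = phi_local (cmap (TsTs_chart Q (c, d)) z)"
    using z' unfolding Phi_eq[OF Q z'] prod.case
    by (simp_all add: covec_of_in_cspace[OF smooth_atlas_prod[OF Q Q]]
        covec_comp_of[OF smooth_atlas_prod[OF Q Q] k] charts_at_iff phi_local_def)
qed

lemma diffeo_on_Phi:
  assumes Q: "smooth_atlas Q"
  defines "P \<equiv> points (TsTs Q)"
  shows "diffeo_on (TsTs Q) (TsQQ Q)
      P (Phi Q)"
    "Phi Q ` P = points (TsQQ Q)"
proof -
  note CQ = smooth_atlas_cotangent[OF Q] and QQ = smooth_atlas_prod[OF Q Q]
  have P: "z \<in> P \<longleftrightarrow> fst (fst z) \<in> points Q \<and> snd (fst z) \<in> cspace Q (fst (fst z)) \<and>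
      fst (snd z) \<in> points Q \<and> snd (snd z) \<in> cspace Q (fst (snd z))" for z
    by (auto simp: P_def points_prod points_cotangent mem_Times_iff)
  have im: "cmap (TsQQ_chart Q i) ` cdom (TsQQ_chart Q i) \<subseteq> phi_local ` cmap (TsTs_chart Q i) ` cdom (TsTs_chart Q i)"
    if i: "i \<in> Q \<times> Q" for i
  proof (rule image_subsetI)
    fix \<zeta> assume \<zeta>: "\<zeta> \<in> cdom (TsQQ_chart Q i)"
    obtain c d where cd: "i = (c, d)" "c \<in> Q" "d \<in> Q" using i by blast
    let ?y = "phi_local_inv (cmap (TsQQ_chart Q i) \<zeta>)"
    have c: "c \<in> charts_at Q (fst (fst \<zeta>))" and d: "d \<in> charts_at Q (snd (fst \<zeta>))"
      using \<zeta> cd by (auto simp: charts_at_iff)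
    define z where "z = ((fst (fst \<zeta>), covec_of Q c (fst (fst \<zeta>)) (snd (fst ?y))),
      (snd (fst \<zeta>), covec_of Q d (snd (fst \<zeta>)) (snd (snd ?y))))"
    have "z \<in> cdom (TsTs_chart Q i)"
      using c d by (simp add: cd(1) z_def covec_of_in_cspace[OF Q] charts_at_iff)
    moreover have "cmap (TsTs_chart Q i) z = ?y"
      unfolding cd(1) prod.case z_def
      by (simp add: covec_comp_of[OF Q c] covec_comp_of[OF Q d]) (simp add: phi_local_inv_def)
    then have "cmap (TsQQ_chart Q i) \<zeta> = phi_local (cmap (TsTs_chart Q i) z)" by simp
    ultimately show "cmap (TsQQ_chart Q i) \<zeta> \<in> phi_local ` cmap (TsTs_chart Q i) ` cdom (TsTs_chart Q i)" by blast
  qed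
  have dom: "Phi Q z \<in> cdom (TsQQ_chart Q i) \<longleftrightarrow> z \<in> cdom (TsTs_chart Q i)" if i: "i \<in> Q \<times> Q" and z: "z \<in> P" for i z
  proof -
    obtain c d where cd: "i = (c, d)" "c \<in> Q" "d \<in> Q" using i by blast
    have "fst (Phi Q z) = (fst (fst z), fst (snd z))" by (simp add: Phi_def case_prod_beta)
    then show ?thesis
      using Phi_chart(1)[OF Q _ cd(2,3), of z] z by (auto simp: cd(1) P mem_Times_iff)
  qed
  have co: "cmap (TsQQ_chart Q i) (Phi Q z) = phi_local (cmap (TsTs_chart Q i) z)"
    if "i \<in> Q \<times> Q" "z \<in> cdom (TsTs_chart Q i)" for i z
    using that Phi_chart(2)[OF Q, of z "fst i" "snd i"] by (simp add: mem_Times_iff)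
  have sm: "smooth_on UNIV (phi_local :: ('b \<times> 'b) \<times> ('b \<times> 'b) \<Rightarrow> _)"
    "smooth_on UNIV (phi_local_inv :: ('b \<times> 'b) \<times> ('b \<times> 'b) \<Rightarrow> _)"
    using smooth_on_linear[OF bounded_linear_phi_local smooth_on_ident open_UNIV]
      smooth_on_linear[OF bounded_linear_phi_local_inv smooth_on_ident open_UNIV] by simp_all
  note cd = chartwise_diffeo[where K = "TsTs_chart Q" and L = "TsQQ_chart Q" and I = "Q \<times> Q" and \<sigma> = phi_local
      and \<tau> = phi_local_inv and F = "Phi Q", folded TsTs_atlas TsQQ_atlas P_def,
      OF smooth_atlas_prod[OF CQ CQ] smooth_atlas_cotangent[OF QQ] sm phi_local_inverses im dom co]
  show "diffeo_on (TsTs Q) (TsQQ Q)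
      P (Phi Q)"
    "Phi Q ` P = points (TsQQ Q)"
    by (rule cd(1); assumption) (rule cd(2); assumption)
qed

text \<open>In product charts the canonical form of the product is the sum of dq ^ dp over both
  factors. Negating the first momentum flips the first summand, leaving second minus first.\<close>

lemma pullback_Phi:
  assumes Q: "smooth_atlas Q" and z: "z \<in> points (TsTs Q)"
    and u: "u \<in> tspace (TsTs Q) z"
    and w: "w \<in> tspace (TsTs Q) z"
  shows "pullback2 (TsTs Q) (TsQQ Q)
      (Phi Q) (canonical_form (prod_manifold Q Q)) z u w = Omega12 Q z u w"
proof -
  let ?T = "cotangent_bundle Q"
  let ?TT = "prod_manifold ?T ?T"
  note CQ = smooth_atlas_cotangent[OF Q] and QQ = smooth_atlas_prod[OF Q Q]
  note CC = smooth_atlas_prod[OF CQ CQ] and CP = smooth_atlas_cotangent[OF QQ]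
  note F = diffeo_onD(2)[OF diffeo_on_Phi(1)[OF Q]]
  have z': "snd (fst z) \<in> cspace Q (fst (fst z))" "snd (snd z) \<in> cspace Q (fst (snd z))"
    "fst (fst z) \<in> points Q" "fst (snd z) \<in> points Q"
    using z by (auto simp: points_prod points_cotangent mem_Times_iff)
  obtain c d where c: "c \<in> charts_at Q (fst (fst z))" and d: "d \<in> charts_at Q (fst (snd z))"
    using z'(3,4) unfolding points_iff by blast
  note cd = c[unfolded charts_at_iff] d[unfolded charts_at_iff]
  note kc = cotangent_chart_in[OF c z'(1)] and kd = cotangent_chart_in[OF d z'(2)]
  let ?K = "prod_chart (cotangent_chart Q c) (cotangent_chart Q d)"
  have K: "?K \<in> charts_at ?TT z" using prod_chart_in[OF kc kd] by simp
  have zK: "z \<in> cdom (TsTs_chart Q (c, d))" using K by (simp add: charts_at_iff)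
  have Pz: "fst (Phi Q z) \<in> cdom (prod_chart c d)" "snd (Phi Q z) \<in> cspace (prod_manifold Q Q) (fst (Phi Q z))"
    using Phi_chart(1)[OF Q zK] cd by auto
  then have kz: "prod_chart c d \<in> charts_at (prod_manifold Q Q) (fst (Phi Q z))"
    using cd by (auto simp: charts_at_iff prod_manifold_eq)
  have e: "tmap ?TT (TsQQ Q) (Phi Q) z v (cotangent_chart (prod_manifold Q Q) (prod_chart c d))
      = phi_local (v ?K)" if v: "v \<in> tspace ?TT z" for v
    using Phi_chart(2)[OF Q, of _ c d] cd
    by (intro tmap_chartwise[OF CC CP F z v K cotangent_chart_in[OF kz Pz(2)] bounded_linear_phi_local]) simp
  have l: "pullback2 ?TT (TsQQ Q) (Phi Q) (canonical_form (prod_manifold Q Q)) z u w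
      = symplectic_product (phi_local (u ?K)) (phi_local (w ?K))"
    unfolding pullback2_def canonical_form_coordinates[OF QQ kz Pz(2) tmap_in_tspace[OF CC CP F z u] tmap_in_tspace[OF CC CP F z w]]
      e[OF u] e[OF w] ..
  note s = smooth_map_prod_fst_snd[OF CQ CQ]
  have 1: "pullback2 ?TT ?T fst (canonical_form Q) z u w = symplectic_product (fst (u ?K)) (fst (w ?K))"
    unfolding pullback2_def canonical_form_coordinates[OF Q c z'(1) tmap_in_tspace[OF CC CQ s(1) z u] tmap_in_tspace[OF CC CQ s(1) z w]]
      tmap_prod_fst_snd(1)[OF CQ CQ kc kd u] tmap_prod_fst_snd(1)[OF CQ CQ kc kd w] ..
  have 2: "pullback2 ?TT ?T snd (canonical_form Q) z u w = symplectic_product (snd (u ?K)) (snd (w ?K))"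
    unfolding pullback2_def canonical_form_coordinates[OF Q d z'(2) tmap_in_tspace[OF CC CQ s(2) z u] tmap_in_tspace[OF CC CQ s(2) z w]]
      tmap_prod_fst_snd(2)[OF CQ CQ kc kd u] tmap_prod_fst_snd(2)[OF CQ CQ kc kd w] ..
  show ?thesis
    unfolding l Omega12_def Let_def 1 2
    by (simp add: symplectic_product_def phi_local_def inner_prod_def)
qed

section \<open>The lifted map\<close>

text \<open>The preimage of \<open>B\<close> is the image of \<open>B\<close> under the inverse
  diffeomorphism, hence open.\<close>

lemma diffeo_on_preimage:
  assumes M: "smooth_atlas M" and N: "smooth_atlas N" and F: "diffeo_on M N W F"
    and B: "mopen N B" "B \<subseteq> F ` W"
  shows "diffeo_on M N {x \<in> W. F x \<in> B} F" "F ` {x \<in> W. F x \<in> B} = B"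
proof -
  note D = diffeo_onD[OF F]
  have "diffeo_on N M B (inv_into W F)"
    by (rule diffeo_on_subset[OF N M diffeo_on_inverse[OF M N F] B])
  then have "mopen M (inv_into W F ` B)" by (rule diffeo_onD(4))
  moreover have "inv_into W F ` B = {x \<in> W. F x \<in> B}"
  proof
    show "inv_into W F ` B \<subseteq> {x \<in> W. F x \<in> B}"
      using B(2) by (auto simp: inv_into_into f_inv_into_f subset_iff)
    show "{x \<in> W. F x \<in> B} \<subseteq> inv_into W F ` B"
      using inv_into_f_f[OF D(3)] by force
  qed
  ultimately show "diffeo_on M N {x \<in> W. F x \<in> B} F"
    by (intro diffeo_on_subset[OF M N F]) auto
  show "F ` {x \<in> W. F x \<in> B} = B" using B(2) by auto
qed

context
  fixes Q :: "('a, 'e::euclidean_space) atlas" and R :: "('a, 'e) tangent \<Rightarrow> 'a \<times> 'a" and V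
  assumes Q: "smooth_atlas Q" and R: "diffeo_on (tangent_bundle Q) (prod_manifold Q Q) V R"
begin

private abbreviation (input) "B \<equiv> cotangent_restrict (tangent_bundle Q) V"
private abbreviation (input) "L \<equiv> cotangent_lift (tangent_bundle Q) (prod_manifold Q Q) R"
private abbreviation (input) "Psi \<equiv> inv_into (points (TsTs Q)) (Phi Q)"

lemma lifted_steps:
  shows "smooth_atlas (TTs Q)" "smooth_atlas (TsT Q)" "smooth_atlas (TsQQ Q)" "smooth_atlas (TsTs Q)"
    "diffeo_on (TTs Q) (TsT Q) (lifted_domain Q V) (tulczyjew Q)" "tulczyjew Q ` lifted_domain Q V = B"
    "diffeo_on (TsT Q) (TsQQ Q) B L" "diffeo_on (TsQQ Q) (TsTs Q) (L ` B) Psi" "L ` B \<subseteq> Phi Q ` points (TsTs Q)"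
proof -
  note TQ = smooth_atlas_tangent[OF Q] and CQ = smooth_atlas_cotangent[OF Q] and QQ = smooth_atlas_prod[OF Q Q]
  show TC: "smooth_atlas (TTs Q)" and CT: "smooth_atlas (TsT Q)" and CP: "smooth_atlas (TsQQ Q)" and CC: "smooth_atlas (TsTs Q)"
    by (intro smooth_atlas_tangent smooth_atlas_cotangent smooth_atlas_prod Q)+
  have oB: "mopen (TsT Q) B" by (rule mopen_cotangent_restrict[OF TQ diffeo_onD(1)[OF R]])
  have "B \<subseteq> tulczyjew Q ` points (TTs Q)"
    unfolding diffeo_on_tulczyjew(2)[OF Q] by (auto simp: cotangent_restrict_def)
  from diffeo_on_preimage[OF TC CT diffeo_on_tulczyjew(1)[OF Q] oB this]
  show "diffeo_on (TTs Q) (TsT Q) (lifted_domain Q V) (tulczyjew Q)" "tulczyjew Q ` lifted_domain Q V = B"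
    by (simp_all add: lifted_domain_def)
  show L: "diffeo_on (TsT Q) (TsQQ Q) B L" by (rule diffeo_on_cotangent_lift[OF TQ QQ R])
  have oL: "mopen (TsQQ Q) (L ` B)" by (rule diffeo_onD(4)[OF L])
  show sub: "L ` B \<subseteq> Phi Q ` points (TsTs Q)"
    unfolding diffeo_on_Phi(2)[OF Q] using oL unfolding mopen_def by blast
  show "diffeo_on (TsQQ Q) (TsTs Q) (L ` B) Psi"
    by (rule diffeo_on_subset[OF CP CC diffeo_on_inverse[OF CC CP diffeo_on_Phi(1)[OF Q]] oL sub])
qed

lemma diffeo_on_lifted_map: "diffeo_on (TTs Q) (TsTs Q) (lifted_domain Q V) (lifted_map Q R)"
proof -
  note s = lifted_steps
  have "diffeo_on (TTs Q) (TsQQ Q) (lifted_domain Q V) (L \<circ> tulczyjew Q)"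
    by (rule diffeo_on_compose[OF s(1-3,5)]) (simp add: s(6,7))
  moreover have "(L \<circ> tulczyjew Q) ` lifted_domain Q V = L ` B"
    unfolding s(6)[symmetric] by (rule image_comp[symmetric])
  ultimately have "diffeo_on (TTs Q) (TsTs Q) (lifted_domain Q V) (Psi \<circ> (L \<circ> tulczyjew Q))"
    using s(8) by (intro diffeo_on_compose[OF s(1,3,4)]) simp_all
  then show ?thesis by (simp add: lifted_map_def o_assoc)
qed

text \<open>Vectors are pushed forward along the three maps as \<open>t\<close>, \<open>l\<close>,
  \<open>p\<close>. The last map is inverse to \<open>Phi\<close>, so the identity for
  \<open>Phi\<close> is used from right to left at the point \<open>Psi (L ?y)\<close>.\<close>

lemma pullback_lifted_map:
  assumes \<xi>: "\<xi> \<in> lifted_domain Q V" and u: "u \<in> tspace (TTs Q) \<xi>" and w: "w \<in> tspace (TTs Q) \<xi>"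
  shows "pullback2 (TTs Q) (TsTs Q) (lifted_map Q R) (Omega12 Q) \<xi> u w = dT_canonical_form Q \<xi> u w"
proof -
  note TQ = smooth_atlas_tangent[OF Q] and QQ = smooth_atlas_prod[OF Q Q]
  note s = lifted_steps
  note T = diffeo_onD(2)[OF s(5)] and L = diffeo_onD(2)[OF s(7)] and P = diffeo_onD(2)[OF s(8)]
  have TB: "tulczyjew Q ` lifted_domain Q V \<subseteq> B" using s(6) by simp
  note LT = smooth_map_compose[OF s(1-3) T L TB]
  have LTB: "(L \<circ> tulczyjew Q) ` lifted_domain Q V \<subseteq> L ` B" using TB by auto
  let ?y = "tulczyjew Q \<xi>"
  have y: "?y \<in> B" and Ly: "L ?y \<in> L ` B" using TB \<xi> by auto
  have \<xi>P: "\<xi> \<in> points (TTs Q)" using \<xi> by (simp add: lifted_domain_def)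
  define t where "t v = tmap (TTs Q) (TsT Q) (tulczyjew Q) \<xi> v" for v
  define l where "l v = tmap (TsT Q) (TsQQ Q) L ?y (t v)" for v
  define p where "p v = tmap (TsQQ Q) (TsTs Q) Psi (L ?y) (l v)" for v
  have t: "t v \<in> tspace (TsT Q) ?y" if "v \<in> tspace (TTs Q) \<xi>" for v
    unfolding t_def by (rule tmap_in_tspace[OF s(1,2) T \<xi> that])
  have l: "l v \<in> tspace (TsQQ Q) (L ?y)" if "v \<in> tspace (TTs Q) \<xi>" for v
    unfolding l_def by (rule tmap_in_tspace[OF s(2,3) L y t[OF that]])
  have p: "p v \<in> tspace (TsTs Q) (Psi (L ?y))" if "v \<in> tspace (TTs Q) \<xi>" for v
    unfolding p_def by (rule tmap_in_tspace[OF s(3,4) P Ly l[OF that]])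
  have "lifted_map Q R = Psi \<circ> (L \<circ> tulczyjew Q)" by (simp add: lifted_map_def o_assoc)
  then have lm: "tmap (TTs Q) (TsTs Q) (lifted_map Q R) \<xi> v = p v" if v: "v \<in> tspace (TTs Q) \<xi>" for v
    using tmap_compose[OF s(1,3,4) LT P LTB \<xi> v] tmap_compose[OF s(1-3) T L TB \<xi> v]
    by (simp add: p_def l_def t_def)
  have Py: "Psi (L ?y) \<in> points (TsTs Q)" "Phi Q (Psi (L ?y)) = L ?y"
    using s(9) Ly by (auto simp: inv_into_into f_inv_into_f subset_iff)
  \<comment> \<open>The tangent map of \<open>Phi\<close> undoes the push-forward by
    \<open>Psi\<close>; this returns \<open>Omega12\<close> to the canonical form of the product at
    \<open>L ?y\<close>.\<close>
  have pl: "tmap (TsTs Q) (TsQQ Q) (Phi Q) (Psi (L ?y)) (p v) = l v" if v: "v \<in> tspace (TTs Q) \<xi>" for v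
    unfolding p_def
  proof (rule tmap_inverse[OF s(3,4) P diffeo_onD(2)[OF diffeo_on_Phi(1)[OF Q]] _ _ Ly l[OF v]])
    show "Psi ` L ` B \<subseteq> points (TsTs Q)" using s(9) by (auto simp: inv_into_into subset_iff)
    show "Phi Q (Psi x) = x" if "x \<in> L ` B" for x using s(9) that by (auto simp: f_inv_into_f subset_iff)
  qed
  have "pullback2 (TTs Q) (TsTs Q) (lifted_map Q R) (Omega12 Q) \<xi> u w = Omega12 Q (Psi (L ?y)) (p u) (p w)"
    by (simp add: pullback2_def lm[OF u] lm[OF w]) (simp add: lifted_map_def)
  also have "\<dots> = canonical_form (prod_manifold Q Q) (L ?y) (l u) (l w)"
    using pullback_Phi[OF Q Py(1) p[OF u] p[OF w]] by (simp add: pullback2_def Py(2) pl[OF u] pl[OF w])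
  also have "\<dots> = canonical_form (tangent_bundle Q) ?y (t u) (t w)"
    using pullback_cotangent_lift[OF TQ QQ R y t[OF u] t[OF w]] by (simp add: pullback2_def l_def)
  also have "\<dots> = dT_canonical_form Q \<xi> u w"
    using pullback_tulczyjew[OF Q \<xi>P u w] by (simp add: pullback2_def t_def)
  finally show ?thesis .
qed

end

text \<open>The two axioms supply the two blocks of the derivative at (x, 0): the values on the zero
  section give the base directions, the condition on fibre derivatives the vertical ones.\<close>

lemma discretization_map_local_diffeo:
  fixes Q :: "('a, 'e::euclidean_space) atlas"
  assumes Q: "smooth_atlas Q" and R: "discretization_map Q U0 R" and x: "x \<in> points Q"
  shows "\<exists>V\<subseteq>U0. (x, \<lambda>_. 0) \<in> V \<and> diffeo_on (tangent_bundle Q) (prod_manifold Q Q) V R"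
proof -
  note TQ = smooth_atlas_tangent[OF Q] and QQ = smooth_atlas_prod[OF Q Q]
  let ?z = "(x, \<lambda>_. 0) :: ('a, 'e) tangent"
  have z: "?z \<in> U0" and sm: "smooth_map (tangent_bundle Q) (prod_manifold Q Q) U0 R"
    and R0: "\<And>x. x \<in> points Q \<Longrightarrow> R (x, \<lambda>_. 0) = (x, x)"
    and Rd: "\<And>v c. v \<in> tspace Q x \<Longrightarrow>
        tmap (tspace_manifold Q x) Q (\<lambda>u. snd (R (x, u))) (\<lambda>_. 0) (tspace_ident Q x v) c -
        tmap (tspace_manifold Q x) Q (\<lambda>u. fst (R (x, u))) (\<lambda>_. 0) (tspace_ident Q x v) c = v c"
    using R x unfolding discretization_map_def zero_section_nhd_def by blast+
  \<comment> \<open>\<open>tmap\<close> on the tangent space uses this chosen linear chart. Taking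
    for \<open>Q\<close> the chart \<open>c\<close> that induces it lets the second axiom unfold
    directly into derivatives in the coordinates of \<open>c\<close>.\<close>
  define k where "k = chart_at (tspace_manifold Q x) (\<lambda>_. 0)"
  have "(\<lambda>_. 0) \<in> points (tspace_manifold Q x)"
    using x tspace_zero[OF Q] by (auto simp: points_def tspace_manifold_def charts_at_def)
  from chart_at_in[OF this] have "k \<in> tspace_manifold Q x" by (simp add: k_def charts_at_iff)
  then obtain c where c: "c \<in> charts_at Q x" and k: "k = (tspace Q x, \<lambda>v. v c)"
    by (auto simp: tspace_manifold_def)
  have kin: "k \<in> tspace_manifold Q x" using c k by (simp add: tspace_manifold_def)
  note cc = c[unfolded charts_at_iff]
  \<comment> \<open>Coordinates on the fibre are \<open>c\<close>-components, so inverting the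
    linear chart builds the vector with prescribed component.\<close>
  have cinvk: "cinv k y = tvec_of Q c x y" for y
    unfolding cinv_def k fst_conv snd_conv
    by (rule inv_into_f_eq) (auto intro: inj_onI tspace_eqI c simp: tvec_of_in_tspace[OF Q c] tvec_of_apply[OF Q c])
  let ?K = "tangent_chart Q c" and ?P = "prod_chart c c"
  have K: "?K \<in> charts_at (tangent_bundle Q) ?z"
    by (rule tangent_chart_in) (simp_all add: c tspace_zero[OF Q])
  have P: "?P \<in> charts_at (prod_manifold Q Q) (R ?z)" using prod_chart_in[OF c c] R0[OF x] by simp
  let ?f = "local_rep R ?K ?P"
  obtain S where S: "open S" "cmap ?K ?z \<in> S" "smooth_on S ?f"
    using smooth_mapE[OF TQ QQ sm z K P] by metis
  let ?q = "cmap c x"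
  have qS: "(?q, 0) \<in> S" using S(2) by simp
  note df = smooth_on_differentiable[OF S(3) qS] and hf = smooth_on_has_derivative[OF S(3) qS]
  have KT: "?K \<in> tangent_bundle Q" using K by (simp add: charts_at_iff)
  have "cinv ?K (?q, y) = (x, tvec_of Q c x y)" for y
    using cinv_cmap[OF TQ KT, of "(x, tvec_of Q c x y)"] cc tvec_of_in_tspace[OF Q c] tvec_of_apply[OF Q c] by simp
  then have f1: "?f (?q, y) = (cmap c (fst (R (x, cinv k y))), cmap c (snd (R (x, cinv k y))))" for y
    by (simp add: cinvk)
  \<comment> \<open>The axiom on zero vectors holds on the whole chart image, an open set, so it can
    be differentiated in the base variable; this gives \<open>D1\<close>.\<close>
  have f2: "(q, q) = ?f (q, 0)" if q: "q \<in> cmap c ` cdom c" for q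
  proof -
    from q obtain x' where x': "x' \<in> cdom c" "q = cmap c x'" by blast
    then have "cinv ?K (q, 0) = (x', \<lambda>_. 0)"
      using cinv_cmap[OF TQ KT, of "(x', \<lambda>_. 0)"] tspace_zero[OF Q] by simp
    moreover have "x' \<in> points Q" using x'(1) cc by (auto simp: points_def)
    ultimately show ?thesis using x' R0 by simp
  qed
  have "fderiv (\<lambda>q. (q, q)) ?q = fderiv (\<lambda>q. ?f (q, 0)) ?q"
    by (rule fderiv_cong[OF smooth_atlasD(2)[OF Q] _ _ f2])
      (use cc in \<open>auto simp: differentiable_def intro!: exI has_derivative_Pair has_derivative_ident\<close>)
  moreover have "fderiv (\<lambda>q. (q, q)) ?q h = (h, h)" for h
    by (rule fderiv_eqI[OF has_derivative_Pair[OF has_derivative_ident has_derivative_ident]])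
  ultimately have D1: "fderiv (\<lambda>q. ?f (q, 0)) ?q h = (h, h)" for h by metis
  let ?g = "fderiv (\<lambda>y. ?f (?q, y)) 0"
  have "((\<lambda>y. (?q, y)) has_derivative (\<lambda>h. (0, h))) (at 0)"
    by (intro has_derivative_Pair has_derivative_ident has_derivative_const)
  from has_derivative_compose[OF this hf] have "(\<lambda>y. ?f (?q, y)) differentiable (at 0)"
    unfolding differentiable_def by blast
  then have hg: "((\<lambda>y. ?f (?q, y)) has_derivative ?g) (at 0)" by (simp add: frechet_derivative_works[symmetric])
  have fs: "fderiv (\<lambda>y. fst (?f (?q, y))) 0 e = fst (?g e)" "fderiv (\<lambda>y. snd (?f (?q, y))) 0 e = snd (?g e)" for e
    by (rule fderiv_eqI[OF has_derivative_fst[OF hg]], rule fderiv_eqI[OF has_derivative_snd[OF hg]])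
  \<comment> \<open>The second axiom for the vector with component \<open>e\<close>, with both
    tangent maps read in the chart \<open>c\<close>.\<close>
  have D2: "snd (?g e) - fst (?g e) = e" for e
  proof -
    have v: "tvec_of Q c x e \<in> tspace Q x" "tvec_of Q c x e c = e"
      using tvec_of_in_tspace[OF Q c] tvec_of_apply[OF Q c] by auto
    have k': "chart_at (tspace_manifold Q x) (\<lambda>_. 0) = (tspace Q x, \<lambda>v. v c)" using k k_def by simp
    have "c \<in> charts_at Q (snd (R ?z))" "c \<in> charts_at Q (fst (R ?z))" using R0[OF x] c by simp_all
    then have "tmap (tspace_manifold Q x) Q (\<lambda>u. snd (R (x, u))) (\<lambda>_. 0) (tspace_ident Q x (tvec_of Q c x e)) c
        = fderiv (\<lambda>y. snd (?f (?q, y))) 0 e"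
      "tmap (tspace_manifold Q x) Q (\<lambda>u. fst (R (x, u))) (\<lambda>_. 0) (tspace_ident Q x (tvec_of Q c x e)) c
        = fderiv (\<lambda>y. fst (?f (?q, y))) 0 e"
      unfolding tmap_def Let_def k' f1 fst_conv snd_conv
      using kin v(2) unfolding k by (simp_all add: tspace_ident_def)
    then show ?thesis using Rd[OF v(1), of c] v(2) unfolding fs by simp
  qed
  have "inj (fderiv ?f (?q, 0))"
    unfolding linear_injective_0[OF linear_fderiv[OF df]]
  proof (intro allI impI)
    \<comment> \<open>The kernel equation splits into \<open>h + fst (?g e) = 0\<close> and
      \<open>h + snd (?g e) = 0\<close>; subtracting them and using \<open>D2\<close> forces
      \<open>e = 0\<close>, then \<open>h = 0\<close>.\<close>
    fix w assume w: "fderiv ?f (?q, 0) w = 0"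
    obtain h e where he: "w = (h, e)" by fastforce
    have "(h, h) + ?g e = 0" using w fderiv_Pair[OF df, of h e] unfolding he D1 by metis
    then have "h + fst (?g e) = 0" "h + snd (?g e) = 0" by (simp_all add: prod_eq_iff)
    moreover from this have "e = 0" using D2[of e] by (metis add_left_cancel diff_self)
    moreover have "?g 0 = 0" using D2 linear_0[OF linear_fderiv[OF \<open>(\<lambda>y. ?f (?q, y)) differentiable (at 0)\<close>]] by simp
    ultimately show "w = 0" by (simp add: he zero_prod_def)
  qed
  then show ?thesis
    using local_diffeo_inverse_function[OF TQ QQ sm z K P] by simp
qed

theorem proposition3p7:
  fixes Q :: "('a, 'e::euclidean_space) atlas"
    and U0 :: "('a, 'e) tangent set"
    and R :: "('a, 'e) tangent \<Rightarrow> 'a \<times> 'a"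
  assumes "smooth_manifold Q"
    and "discretization_map Q U0 R"
  shows "(\<exists>U\<subseteq>U0. zero_section_nhd Q U \<and>
             local_diffeo_on (tangent_bundle Q) (prod_manifold Q Q) U R) \<and>
         (\<forall>U\<subseteq>U0. zero_section_nhd Q U \<and>
             local_diffeo_on (tangent_bundle Q) (prod_manifold Q Q) U R \<longrightarrow>
           local_symplecto_on
             (tangent_bundle (cotangent_bundle Q)) (dT_canonical_form Q)
             (prod_manifold (cotangent_bundle Q) (cotangent_bundle Q)) (Omega12 Q)
             (lifted_domain Q U) (lifted_map Q R) \<and>
           (diffeo_on (tangent_bundle Q) (prod_manifold Q Q) U R \<longrightarrow>
             diffeo_on
               (tangent_bundle (cotangent_bundle Q))
               (prod_manifold (cotangent_bundle Q) (cotangent_bundle Q))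
               (lifted_domain Q U) (lifted_map Q R)))"
proof (intro conjI allI impI)
  let ?D = "diffeo_on (tangent_bundle Q) (prod_manifold Q Q)"
  have Q: "smooth_atlas Q" using assms(1) by (simp add: smooth_manifold_def)
  note TQ = smooth_atlas_tangent[OF Q] and CQ = smooth_atlas_cotangent[OF Q]
  show "\<exists>U\<subseteq>U0. zero_section_nhd Q U \<and> local_diffeo_on (tangent_bundle Q) (prod_manifold Q Q) U R"
  \<comment> \<open>The union of all open \<open>V\<close> on which \<open>R\<close> is a
    diffeomorphism; no uniform size of the neighbourhoods is required for a local
    diffeomorphism.\<close>
  proof (intro exI[of _ "\<Union>{V. V \<subseteq> U0 \<and> ?D V R}"] conjI)
    show "zero_section_nhd Q (\<Union>{V. V \<subseteq> U0 \<and> ?D V R})"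
      unfolding zero_section_nhd_def
    proof (intro conjI ballI)
      show "mopen (tangent_bundle Q) (\<Union>{V. V \<subseteq> U0 \<and> ?D V R})"
        by (rule mopen_Union) (auto dest: diffeo_onD(1))
      fix x assume "x \<in> points Q"
      from discretization_map_local_diffeo[OF Q assms(2) this]
      show "(x, \<lambda>_. 0) \<in> \<Union>{V. V \<subseteq> U0 \<and> ?D V R}" by blast
    qed
  qed (auto simp: local_diffeo_on_def)
  fix U assume U: "U \<subseteq> U0"
    "zero_section_nhd Q U \<and> local_diffeo_on (tangent_bundle Q) (prod_manifold Q Q) U R"
  show "diffeo_on (TTs Q) (TsTs Q)
      (lifted_domain Q U) (lifted_map Q R)"
    if "?D U R"
    by (rule diffeo_on_lifted_map[OF Q that])
  \<comment> \<open>Every point of the lifted domain lies over a vector in \<open>U\<close>, and a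
    neighbourhood \<open>V\<close> of that vector on which \<open>R\<close> is injective gives a
    lifted domain containing the point. Smoothness and pullback are then checked over
    \<open>V\<close>.\<close>
  have local: "\<exists>V. \<xi> \<in> lifted_domain Q V \<and> lifted_domain Q V \<subseteq> lifted_domain Q U \<and>
      ?D V R" if \<xi>: "\<xi> \<in> lifted_domain Q U" for \<xi>
  proof -
    have "fst (tulczyjew Q \<xi>) \<in> U" using \<xi> by (simp add: lifted_domain_def cotangent_restrict_def)
    then obtain V where V: "fst (tulczyjew Q \<xi>) \<in> V" "V \<subseteq> U" "?D V R"
      using U(2) unfolding local_diffeo_on_def by blast
    then show ?thesis using \<xi> by (intro exI[of _ V]) (auto simp: lifted_domain_def cotangent_restrict_def)
  qed
  show "local_symplecto_on (TTs Q) (dT_canonical_form Q)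
      (TsTs Q) (Omega12 Q)
      (lifted_domain Q U) (lifted_map Q R)"
    unfolding local_symplecto_on_def
  proof (intro conjI ballI)
    have "mopen (TsT Q) (cotangent_restrict (tangent_bundle Q) U)"
      using U(2) by (intro mopen_cotangent_restrict[OF TQ]) (simp add: zero_section_nhd_def)
    moreover have "cotangent_restrict (tangent_bundle Q) U \<subseteq> tulczyjew Q ` points (TTs Q)"
      unfolding diffeo_on_tulczyjew(2)[OF Q] by (auto simp: cotangent_restrict_def)
    ultimately have "diffeo_on (TTs Q) (TsT Q)
        {\<xi> \<in> points (TTs Q). tulczyjew Q \<xi> \<in> cotangent_restrict (tangent_bundle Q) U} (tulczyjew Q)"
      by (rule diffeo_on_preimage(1)[OF smooth_atlas_tangent[OF CQ] smooth_atlas_cotangent[OF TQ] diffeo_on_tulczyjew(1)[OF Q]])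
    then show "mopen (TTs Q) (lifted_domain Q U)"
      unfolding lifted_domain_def by (rule diffeo_onD(1))
    show "local_diffeo_on (TTs Q)
        (TsTs Q) (lifted_domain Q U) (lifted_map Q R)"
      unfolding local_diffeo_on_def
    proof
      fix \<xi> assume "\<xi> \<in> lifted_domain Q U"
      from local[OF this] obtain V where V: "\<xi> \<in> lifted_domain Q V" "lifted_domain Q V \<subseteq> lifted_domain Q U"
        "?D V R" by blast
      then show "\<exists>V. \<xi> \<in> V \<and> V \<subseteq> lifted_domain Q U \<and> diffeo_on (TTs Q)
          (TsTs Q) V (lifted_map Q R)"
        using diffeo_on_lifted_map[OF Q V(3)] by blast
    qed
    fix \<xi> u w assume \<xi>: "\<xi> \<in> lifted_domain Q U"
      and u: "u \<in> tspace (TTs Q) \<xi>"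
      and w: "w \<in> tspace (TTs Q) \<xi>"
    from local[OF \<xi>] obtain V where V: "\<xi> \<in> lifted_domain Q V" "?D V R"
      by blast
    show "pullback2 (TTs Q) (TsTs Q)
        (lifted_map Q R) (Omega12 Q) \<xi> u w = dT_canonical_form Q \<xi> u w"
      by (rule pullback_lifted_map[OF Q V(2,1) u w])
  qed
qed

end
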